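(* Let $d\ge 3$ and let $\{\mathbf S_n\}_{n\ge 0}$ be the simple symmetric random walk on $\mathbb{Z}^d$ started at $\mathbf 0$. For each $\varepsilon>0$, with probability 1 there exists a (random) $n_0=n_0(\varepsilon)$ such that if $n\ge n_0$ then: (i) $(\xi(\mathbf S_j+\mathbf e_i,\infty),\Xi(\mathbf S_j+\mathbf e_i,\infty))\in ((1+\varepsilon)\log n)\,\mathcal D$ for all $j=1,2,\dots,n$ and all $i=1,2,\dots,2d$; (ii) for any pair of nonnegative integers $(k,\ell)\in ((1-\varepsilon)\log n)\,\mathcal D$ and for arbitrary $i\in\{1,2,\dots,2d\}$ there exists a random integer $j=j(k,\ell)\le n$ for which $$(\xi(\mathbf S_j+\mathbf e_i,\infty),\Xi(\mathbf S_j+\mathbf e_i,\infty))=(k,\ell+1).$$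
   Context: Simple symmetric random walk on $\mathbb{Z}^d$: $\mathbf S_0=\mathbf 0$, $\mathbf S_n=\sum_{k=1}^n\mathbf X_k$, with $\mathbf X_k$ i.i.d., $\mathbf P(\mathbf X_1=\mathbf e_i)=\frac1{2d}$ for $i=1,\dots,2d$, where $\mathbf e_1,\dots,\mathbf e_d$ are the standard orthogonal unit vectors and $\mathbf e_{d+j}=-\mathbf e_j$, $j=1,\dots,d$. Total local time: $\xi(\mathbf z,\infty)=\#\{k: k>0,\ \mathbf S_k=\mathbf z\}$ (time $0$ is not counted). $\mathcal S(1)=\{\mathbf z\in\mathbb{Z}^d:\|\mathbf z\|=1\}=\{\mathbf e_1,\dots,\mathbf e_{2d}\}$ (Euclidean norm), and $\Xi(\mathbf z,\infty)=\sum_{i=1}^{2d}\xi(\mathbf z+\mathbf e_i,\infty)$ is the total occupation time of the surface $\mathcal S(1)+\mathbf z$ of the unit ball centered at $\mathbf z$. Let $T=\min\{i\ge1:\mathbf S_i=\mathbf 0\}$ and $T_{\mathcal S(1)}=\min\{i\ge 1:\mathbf S_i\in\mathcal S(1)\}$ (with value $\infty$ if no such $i$), and let $\mathbf P_{\mathbf z}$ be the law of the walk started from $\mathbf z$. Put $p=\mathbf P_{\mathbf e_1}(T_{\mathcal S(1)}<T)$ (including the case $T_{\mathcal S(1)}<T=\infty$). $\mathcal D=\{(x,y)\in\mathbb{R}^2: y\ge x\ge0,\ -y\log y+x\log(2dx)+(y-x)\log((y-x)/p)\le1\}$, with the convention that a term of the form $0\log 0$ equals $0$. For real $c$, $c\,\mathcal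 D=\{(cx,cy):(x,y)\in\mathcal D\}$. *)

theory Defs
  imports "HOL-Probability.Probability"
begin

text \<open>
  The lattice of dimension \<open>d\<close> is \<open>int ^ 'd\<close> with \<open>d = CARD('d)\<close>. Since the index type carries no
  order, a numbering \<open>coord 1, \<dots>, coord d\<close> of the coordinates is fixed once and for all, so that
  the unit vectors can be numbered \<open>e 1, \<dots>, e (2 * d)\<close>.
\<close>

definition coord :: "nat \<Rightarrow> 'd::finite"
  where "coord = (SOME b. bij_betw b {1..CARD('d)} UNIV)"

definition e :: "nat \<Rightarrow> int ^ 'd::finite"
  where "e i = (if i \<le> CARD('d) then axis (coord i) 1 else - axis (coord (i - CARD('d))) 1)"

definition unit_sphere :: "(int ^ 'd::finite) set"
  where "unit_sphere = {z. norm (\<chi> i. real_of_int (z $ i)) = 1}"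

text \<open>The index \<open>0\<close> of the steps is not used; \<open>X k\<close> is the \<open>k\<close>-th step for \<open>k \<ge> 1\<close>.\<close>

locale simple_random_walk = prob_space M
  for M :: "'a measure" +
  fixes X :: "nat \<Rightarrow> 'a \<Rightarrow> int ^ 'd::finite"
  assumes indep_steps: "indep_vars (\<lambda>_. count_space UNIV) X {1..}"
    and step_law: "\<And>k i. k \<ge> 1 \<Longrightarrow> i \<in> {1..2 * CARD('d)} \<Longrightarrow>
      prob {\<omega> \<in> space M. X k \<omega> = e i} = 1 / (2 * real CARD('d))"

definition walk :: "(nat \<Rightarrow> 'a \<Rightarrow> int ^ 'd::finite) \<Rightarrow> 'a \<Rightarrow> nat \<Rightarrow> int ^ 'd"
  where "walk X \<omega> n = (\<Sum>k=1..n. X k \<omega>)"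

text \<open>Local and occupation times of a path \<open>s\<close> are extended naturals: \<open>card\<close> alone would give the
  value 0 to a site visited infinitely often.\<close>

definition local_time :: "(nat \<Rightarrow> int ^ 'd::finite) \<Rightarrow> int ^ 'd \<Rightarrow> enat"
  where "local_time s z =
    (if finite {k. k > 0 \<and> s k = z} then enat (card {k. k > 0 \<and> s k = z}) else \<infinity>)"

definition occupation_time :: "(nat \<Rightarrow> int ^ 'd::finite) \<Rightarrow> int ^ 'd \<Rightarrow> enat"
  where "occupation_time s z = (\<Sum>i=1..2 * CARD('d). local_time s (z + e i))"

text \<open>\<open>hit_time A s\<close> is \<open>\<infinity>\<close> if the path never enters \<open>A\<close> after time 0, as \<open>Inf {} = \<infinity>\<close> in \<open>enat\<close>.\<close>

definition hit_time :: "(int ^ 'd::finite) set \<Rightarrow> (nat \<Rightarrow> int ^ 'd) \<Rightarrow> enat"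
  where "hit_time A s = Inf (enat ` {i. i \<ge> 1 \<and> s i \<in> A})"

definition walk_law ::
  "'a measure \<Rightarrow> (nat \<Rightarrow> 'a \<Rightarrow> int ^ 'd::finite) \<Rightarrow> int ^ 'd \<Rightarrow> (nat \<Rightarrow> int ^ 'd) measure"
  where "walk_law M X z = distr M (\<Pi>\<^sub>M n\<in>UNIV. count_space UNIV) (\<lambda>\<omega> n. z + walk X \<omega> n)"

definition sphere_return_prob :: "'a measure \<Rightarrow> (nat \<Rightarrow> 'a \<Rightarrow> int ^ 'd::finite) \<Rightarrow> real"
  where "sphere_return_prob M X =
    measure (walk_law M X (e 1)) {s. hit_time unit_sphere s < hit_time {0} s}"

text \<open>The convention \<open>0 log 0 = 0\<close> holds automatically, as \<open>ln 0\<close> is a real number in HOL.\<close>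

definition joint_region :: "nat \<Rightarrow> real \<Rightarrow> (real \<times> real) set"
  where "joint_region d p = {(x, y). y \<ge> x \<and> x \<ge> 0 \<and>
    - y * ln y + x * ln (2 * real d * x) + (y - x) * ln ((y - x) / p) \<le> 1}"

definition dilate :: "real \<Rightarrow> (real \<times> real) set \<Rightarrow> (real \<times> real) set"
  where "dilate c A = {(c * x, c * y) | x y. (x, y) \<in> A}"

lemma bij_betw_coord: "bij_betw (coord :: nat \<Rightarrow> 'd::finite) {1..CARD('d)} UNIV"
proof -
  have "\<exists>b :: nat \<Rightarrow> 'd. bij_betw b {1..CARD('d)} UNIV"
    by (rule finite_same_card_bij) auto
  then show ?thesis
    unfolding coord_def by (rule someI_ex)
qed

lemma inj_on_e: "inj_on (e :: nat \<Rightarrow> int ^ 'd::finite) {1..2 * CARD('d)}"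
proof (rule inj_onI)
  fix i j :: nat
  assume ij: "i \<in> {1..2 * CARD('d)}" "j \<in> {1..2 * CARD('d)}" and eq: "e i = (e j :: int ^ 'd)"
  let ?d = "CARD('d)"
  let ?c = "coord :: nat \<Rightarrow> 'd"
  have inj: "a = b" if "?c a = ?c b" "a \<in> {1..?d}" "b \<in> {1..?d}" for a b
    using bij_betw_coord[where 'd = 'd] that unfolding bij_betw_def inj_on_def by blast
  have pm: "axis a (1::int) \<noteq> - axis b 1" for a b :: 'd
  proof
    assume "axis a (1::int) = - axis b 1"
    then have "axis a (1::int) $ a = (- axis b 1) $ a" by simp
    then show False by (simp add: axis_def split: if_splits)
  qed
  show "i = j"
  proof (cases "i \<le> ?d"; cases "j \<le> ?d")
    assume "i \<le> ?d" "j \<le> ?d"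
    with eq have "?c i = ?c j" by (simp add: e_def axis_eq_axis)
    with inj[of i j] ij \<open>i \<le> ?d\<close> \<open>j \<le> ?d\<close> show ?thesis by simp
  next
    assume a: "i \<le> ?d" "\<not> j \<le> ?d"
    with eq pm show ?thesis by (simp add: e_def)
  next
    assume a: "\<not> i \<le> ?d" "j \<le> ?d"
    with eq pm show ?thesis by (metis e_def)
  next
    assume a: "\<not> i \<le> ?d" "\<not> j \<le> ?d"
    with eq have "?c (i - ?d) = ?c (j - ?d)" by (simp add: e_def axis_eq_axis)
    moreover have "i - ?d \<in> {1..?d}" "j - ?d \<in> {1..?d}" using ij a by auto
    ultimately have "i - ?d = j - ?d" by (rule inj)
    with a show ?thesis by linarith
  qed
qed

lemma unit_sphere_eq: "(unit_sphere :: (int ^ 'd::finite) set) = e ` {1..2 * CARD('d)}"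
proof
  let ?d = "CARD('d)"
  show "(unit_sphere :: (int ^ 'd) set) \<subseteq> e ` {1..2 * ?d}"
  proof
    fix z :: "int ^ 'd"
    assume "z \<in> unit_sphere"
    then have "(\<Sum>i\<in>UNIV. (real_of_int (z $ i))\<^sup>2) = 1"
      by (simp add: unit_sphere_def norm_vec_def L2_set_def)
    then have "real_of_int (\<Sum>i\<in>UNIV. (z $ i)\<^sup>2) = 1" by simp
    then have sq: "(\<Sum>i\<in>UNIV. (z $ i)\<^sup>2) = 1" by linarith
    then obtain a where a: "z $ a \<noteq> 0" by (metis (mono_tags, lifting) sum.neutral zero_neq_one zero_power2)
    have "(z $ a)\<^sup>2 + (\<Sum>i\<in>UNIV - {a}. (z $ i)\<^sup>2) = 1"
      using sq by (simp add: sum.remove[of UNIV a])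
    moreover have "(z $ a)\<^sup>2 \<ge> 1" using a by (simp add: int_one_le_iff_zero_less)
    moreover have "(\<Sum>i\<in>UNIV - {a}. (z $ i)\<^sup>2) \<ge> 0" by (intro sum_nonneg) simp
    ultimately have one: "(z $ a)\<^sup>2 = 1" and "(\<Sum>i\<in>UNIV - {a}. (z $ i)\<^sup>2) = 0" by linarith+
    then have "z $ i = 0" if "i \<noteq> a" for i
      using that by (subst (asm) sum_nonneg_eq_0_iff) auto
    then have z: "z = axis a (z $ a)" by (simp add: vec_eq_iff axis_def)
    obtain m where m: "m \<in> {1..?d}" "coord m = a"
      using bij_betw_coord[where 'd = 'd] unfolding bij_betw_def by (metis UNIV_I imageE)
    from one have "z $ a = 1 \<or> z $ a = -1" by (simp add: power2_eq_1_iff)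
    then show "z \<in> e ` {1..2 * ?d}"
    proof
      assume "z $ a = 1"
      then have "z = e m" using z m by (simp add: e_def)
      then show ?thesis using m by auto
    next
      assume "z $ a = -1"
      then have "z = - axis a 1" using z by (simp add: vec_eq_iff axis_def)
      then have "z = e (m + ?d)" using m by (simp add: e_def)
      moreover have "m + ?d \<in> {1..2 * ?d}" using m by auto
      ultimately show ?thesis by blast
    qed
  qed
  have "norm (\<chi> i. real_of_int (axis a 1 $ i)) = 1" "norm (\<chi> i. real_of_int ((- axis a 1) $ i)) = 1"
    for a :: 'd
  proof -
    have "(\<chi> i. real_of_int (axis a 1 $ i)) = axis a (1::real)"
      "(\<chi> i. real_of_int ((- axis a 1) $ i)) = - axis a (1::real)"
      by (simp_all add: vec_eq_iff axis_def)
    then show "norm (\<chi> i. real_of_int (axis a 1 $ i)) = 1"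
      "norm (\<chi> i. real_of_int ((- axis a 1) $ i)) = 1" by simp_all
  qed
  then show "e ` {1..2 * ?d} \<subseteq> (unit_sphere :: (int ^ 'd) set)"
    by (auto simp: unit_sphere_def e_def)
qed

end

theory Submission
  imports Defs
begin

text \<open>
  A walk on the unit sphere around a site \<open>z\<close> either steps to \<open>z\<close> and comes back, with probability
  \<open>1 / (2 d)\<close>, or returns to the sphere without visiting \<open>z\<close>, with probability \<open>p\<close>, or never
  returns. Hence the number \<open>k\<close> of later visits to \<open>z\<close> and the number \<open>l\<close> of later visits to the
  sphere are equal to given values with probability comparable to
  \<open>W = (l choose k) (1 / (2 d)) ^ k p ^ (l - k)\<close>, and \<open>- ln W\<close> is the function defining the region
  up to logarithmic terms. The upper bound is Borel--Cantelli over the first visits to the spheres.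
  For the lower bound, the path is cut into long windows; the events that a given pair \<open>(k, l)\<close>
  is realised inside a window are independent, and a realised pair is spoilt by visits outside of
  the window only with a probability that is a negative power of the window length, by the heat
  kernel bound \<open>P (S t = y) = O (t ^ (- 3 / 2))\<close>.
\<close>

subsection \<open>Step sequences\<close>

text \<open>Probabilities are handled as finite averages over step lists; the probability space
  enters only through the bridge \<open>prob_steps\<close>. The lattice symmetries act transitively
  on the unit sphere, so the sphere behaves like one state of a renewal process, and this is what
  produces a plain binomial weight. Two obstacles shape the rest. In the upper bound infinitely many
  pairs (k, l) compete at every time j, so the weight has to be summable in j and in l
  simultaneously; it is interpolated between a power of j and a geometric factor in l. In the lower
  bound about 1 / W windows are needed, and a union bound over so many of them survives only because
  a spoiling event includes the occurrence of the pattern itself, so that its probability carries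
  the factor W. Visits before a given time count as much as later ones. A window must therefore be
  free of earlier visits to the ball, which reversal of time turns into one more escape. The
  entrance to the sphere is itself a visit, hence l + 1.\<close>

lemma finite_unit_sphere [simp]: "finite (unit_sphere :: (int ^ 'd::finite) set)"
  by (simp add: unit_sphere_eq)

lemma card_unit_sphere: "card (unit_sphere :: (int ^ 'd::finite) set) = 2 * CARD('d)"
  unfolding unit_sphere_eq by (subst card_image[OF inj_on_e]) simp

lemma mem_unit_sphere_iff: "z \<in> unit_sphere \<longleftrightarrow> (\<Sum>i\<in>UNIV. (z $ i)\<^sup>2) = 1"
  for z :: "int ^ 'd::finite"
proof -
  have "z \<in> unit_sphere \<longleftrightarrow> real_of_int (\<Sum>i\<in>UNIV. (z $ i)\<^sup>2) = 1"
    by (simp add: unit_sphere_def norm_vec_def L2_set_def)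
  then show ?thesis
    by (metis of_int_eq_1_iff)
qed

lemma uminus_mem_unit_sphere_iff [simp]: "- z \<in> unit_sphere \<longleftrightarrow> z \<in> unit_sphere"
  for z :: "int ^ 'd::finite"
  by (simp add: mem_unit_sphere_iff)

lemma zero_notin_unit_sphere [simp]: "0 \<notin> (unit_sphere :: (int ^ 'd::finite) set)"
  by (simp add: mem_unit_sphere_iff)

text \<open>The vectors \<open>axis c 1\<close> and their negatives are distinct unit vectors, and
  the cardinality of the sphere leaves no others.\<close>

lemma sum_unit_sphere:
  "(\<Sum>v\<in>unit_sphere. F v) = (\<Sum>c\<in>UNIV. F (axis c 1) + F (- axis c (1::int)))"
  for F :: "int ^ 'd::finite \<Rightarrow> real"
proof -
  let ?P = "range (\<lambda>c::'d. axis c (1::int))" and ?N = "range (\<lambda>c::'d. - axis c (1::int))"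
  have inj: "inj (\<lambda>c::'d. axis c (1::int))" by (auto simp: inj_def axis_eq_axis)
  have injn: "inj (\<lambda>c::'d. - axis c (1::int))" by (auto simp: inj_def axis_eq_axis)
  have disj: "?P \<inter> ?N = {}"
  proof -
    have "axis a (1::int) \<noteq> - axis b 1" for a b :: 'd
    proof
      assume "axis a (1::int) = - axis b 1"
      then have "axis a (1::int) $ a = (- axis b 1) $ a" by simp
      then show False by (simp add: axis_def split: if_splits)
    qed
    then show ?thesis by auto
  qed
  have sub: "?P \<union> ?N \<subseteq> unit_sphere"
  proof -
    have "(\<Sum>i\<in>UNIV. (axis c x $ i)\<^sup>2) = (\<Sum>i\<in>UNIV. if i = c then x\<^sup>2 else 0)" for c :: 'd and x :: int
      by (rule sum.cong) (auto simp: axis_def)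
    then show ?thesis
      by (auto simp: mem_unit_sphere_iff)
  qed
  have "card (?P \<union> ?N) = 2 * CARD('d)"
    using disj inj injn by (simp add: card_Un_disjoint card_image)
  then have eq: "?P \<union> ?N = unit_sphere"
    by (intro card_subset_eq[OF _ sub]) (simp_all add: card_unit_sphere)
  have "sum F unit_sphere = sum F ?P + sum F ?N"
    unfolding eq[symmetric] by (rule sum.union_disjoint) (use disj in simp_all)
  also have "\<dots> = (\<Sum>c\<in>UNIV. F (axis c 1)) + (\<Sum>c\<in>UNIV. F (- axis c 1))"
    using inj injn by (simp add: sum.reindex)
  finally show ?thesis by (simp add: sum.distrib)
qed

definition step_lists :: "nat \<Rightarrow> (int ^ 'd::finite) list set"
  where "step_lists t = {l. set l \<subseteq> unit_sphere \<and> length l = t}"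

text \<open>The expectation over \<open>t\<close> independent uniform steps, kept as a finite sum so
  that conditioning, reversal and reflection become manipulations of lists.\<close>

definition pavg :: "nat \<Rightarrow> ((int ^ 'd::finite) list \<Rightarrow> real) \<Rightarrow> real"
  where "pavg t f = (\<Sum>l\<in>step_lists t. f l) / (2 * real CARD('d)) ^ t"

lemma finite_step_lists [simp]: "finite (step_lists t)"
  unfolding step_lists_def by (rule finite_lists_length_eq) simp

lemma card_step_lists: "card (step_lists t :: (int ^ 'd::finite) list set) = (2 * CARD('d)) ^ t"
  unfolding step_lists_def by (simp add: card_lists_length_eq card_unit_sphere)

lemma step_lists_0 [simp]: "step_lists 0 = {[]}"
  by (auto simp: step_lists_def)

lemma step_lists_Suc: "step_lists (Suc t) = (\<lambda>(v, l). v # l) ` (unit_sphere \<times> step_lists t)"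
  by (auto simp: step_lists_def length_Suc_conv)

lemma pavg_0 [simp]: "pavg 0 f = f []"
  by (simp add: pavg_def)

lemma pavg_Suc:
  "pavg (Suc t) f = (\<Sum>v\<in>unit_sphere. pavg t (\<lambda>l. f (v # l))) / (2 * real CARD('d))"
  for f :: "(int ^ 'd::finite) list \<Rightarrow> real"
proof -
  have "inj_on (\<lambda>(v, l). v # l) (unit_sphere \<times> (step_lists t :: (int ^ 'd) list set))"
    by (auto simp: inj_on_def)
  then have "(\<Sum>l\<in>step_lists (Suc t). f l) = (\<Sum>(v, l)\<in>unit_sphere \<times> step_lists t. f (v # l))"
    unfolding step_lists_Suc by (subst sum.reindex) (auto intro!: sum.cong)
  also have "\<dots> = (\<Sum>v\<in>unit_sphere. \<Sum>l\<in>step_lists t. f (v # l))"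
    by (simp add: sum.cartesian_product)
  finally show ?thesis
    by (simp add: pavg_def sum_divide_distrib mult.commute)
qed

lemma pavg_cong:
  assumes "\<And>l. set l \<subseteq> unit_sphere \<Longrightarrow> length l = t \<Longrightarrow> f l = f' l"
  shows "pavg t f = pavg t f'"
  unfolding pavg_def using assms by (auto simp: step_lists_def intro!: sum.cong)

lemma pavg_mono:
  assumes "\<And>l. set l \<subseteq> unit_sphere \<Longrightarrow> length l = t \<Longrightarrow> f l \<le> f' l"
  shows "pavg t f \<le> pavg t f'"
  unfolding pavg_def using assms by (auto simp: step_lists_def intro!: sum_mono divide_right_mono)

lemma pavg_const [simp]: "pavg t (\<lambda>_. c) = c"
  by (simp add: pavg_def card_step_lists)

lemma pavg_nonneg: "(\<And>l. f l \<ge> 0) \<Longrightarrow> pavg t f \<ge> 0"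
  unfolding pavg_def by (auto intro!: sum_nonneg divide_nonneg_nonneg)

lemma pavg_add: "pavg t (\<lambda>l. f l + f' l) = pavg t f + pavg t f'"
  by (simp add: pavg_def sum.distrib add_divide_distrib)

lemma pavg_diff: "pavg t (\<lambda>l. f l - f' l) = pavg t f - pavg t f'"
  by (simp add: pavg_def sum_subtractf diff_divide_distrib)

lemma pavg_cmult: "pavg t (\<lambda>l. c * f l) = c * pavg t f"
  by (simp add: pavg_def sum_distrib_left)

lemma pavg_multc: "pavg t (\<lambda>l. f l * c) = pavg t f * c"
  by (simp add: pavg_def sum_distrib_right)

lemma pavg_sum: "pavg t (\<lambda>l. \<Sum>i\<in>I. f i l) = (\<Sum>i\<in>I. pavg t (f i))"
  unfolding pavg_def by (subst sum.swap) (simp add: sum_divide_distrib)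

text \<open>The Markov property: the first \<open>s\<close> steps are frozen while the remaining
  \<open>t\<close> are averaged.\<close>

lemma pavg_append: "pavg (s + t) f = pavg s (\<lambda>l. pavg t (\<lambda>m. f (l @ m)))"
  by (induction s arbitrary: f) (simp_all add: pavg_Suc)

lemma pavg_reindex:
  fixes h :: "(int ^ 'd::finite) list \<Rightarrow> (int ^ 'd) list"
  assumes "bij_betw h (step_lists t) (step_lists t)"
  shows "pavg t (\<lambda>l. f (h l)) = pavg t f"
  unfolding pavg_def using sum.reindex_bij_betw[OF assms, of f] by simp

text \<open>Together with \<open>pavg_uminus\<close>, this lets the path before a given time be read
  as a walk running backwards from there.\<close>

lemma pavg_rev: "pavg t (\<lambda>l. f (rev l)) = pavg t f"
proof (rule pavg_reindex)
  show "bij_betw rev (step_lists t) (step_lists t)"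
    by (rule bij_betw_byWitness[where f' = rev]) (auto simp: step_lists_def)
qed

lemma pavg_map:
  fixes s :: "int ^ 'd::finite \<Rightarrow> int ^ 'd"
  assumes "inj s" and "\<And>v. v \<in> unit_sphere \<Longrightarrow> s v \<in> unit_sphere"
  shows "pavg t (\<lambda>l. f (map s l)) = pavg t f"
proof (rule pavg_reindex)
  have "inj_on (map s) (step_lists t)"
    using assms(1) by (meson inj_mapI inj_on_subset subset_UNIV)
  moreover have "map s ` step_lists t \<subseteq> step_lists t"
    using assms(2) by (auto simp: step_lists_def subset_iff)
  ultimately show "bij_betw (map s) (step_lists t) (step_lists t)"
    by (simp add: bij_betw_def endo_inj_surj)
qed

lemma pavg_uminus: "pavg t (\<lambda>l. f (map uminus l)) = pavg t f"
  by (rule pavg_map[of uminus]) auto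

section \<open>Visit counts and lattice symmetries\<close>

primrec visits :: "(int ^ 'd::finite) set \<Rightarrow> int ^ 'd \<Rightarrow> (int ^ 'd) list \<Rightarrow> nat"
  where
    "visits A x [] = 0"
  | "visits A x (v # l) = (if x + v \<in> A then 1 else 0) + visits A (x + v) l"

text \<open>The start \<open>x\<close> is not counted, just as local times omit time 0; hence
  nothing is counted twice where two pieces meet.\<close>

lemma visits_append: "visits A x (l @ m) = visits A x l + visits A (x + sum_list l) m"
  by (induction l arbitrary: x) (simp_all add: add.assoc)

lemma visits_eq_card:
  "visits A x l = card {i \<in> {1..length l}. x + sum_list (take i l) \<in> A}"
proof (induction l rule: rev_induct)
  case Nil
  then show ?case by simp
next
  case (snoc v l)
  let ?S = "\<lambda>l. {i \<in> {1..length l}. x + sum_list (take i l) \<in> A}"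
  have "?S (l @ [v]) = ?S l \<union> (if x + sum_list (l @ [v]) \<in> A then {Suc (length l)} else {})"
    by (auto simp: le_Suc_eq)
  then show ?case
    using snoc by (simp add: visits_append card_insert_if add.assoc)
qed

text \<open>The hyperoctahedral group acts transitively on the unit vectors. The witness swaps two
  axes and, if required, flips one sign.\<close>

lemma exists_signed_permutation:
  fixes x y :: "int ^ 'd::finite"
  assumes "x \<in> unit_sphere" "y \<in> unit_sphere"
  obtains s :: "int ^ 'd \<Rightarrow> int ^ 'd" where "inj s" "\<And>u v. s (u + v) = s u + s v"
    "\<And>v. s v \<in> unit_sphere \<longleftrightarrow> v \<in> unit_sphere" "s x = y"
proof -
  have *: "\<exists>a c. (c = 1 \<or> c = -1) \<and> z = axis a c" if "z \<in> unit_sphere" for z :: "int ^ 'd"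
  proof -
    from that obtain i where "z = e i" unfolding unit_sphere_eq by auto
    moreover have "- axis a 1 = axis a (-1 :: int)" for a :: 'd
      by (simp add: vec_eq_iff axis_def)
    ultimately have "z = axis (coord i) 1 \<or> z = axis (coord (i - CARD('d))) (- 1)"
      by (auto simp: e_def)
    then show ?thesis by blast
  qed
  obtain a c where x: "c = 1 \<or> c = -1" "x = axis a c" using *[OF assms(1)] by auto
  obtain b c' where y: "c' = 1 \<or> c' = -1" "y = axis b c'" using *[OF assms(2)] by auto
  define t where "t = Transposition.transpose a b"
  \<comment> \<open>As both signs are 1 or -1, the factor \<open>c * c'\<close> carries the entry
    \<open>c\<close> of \<open>x\<close> to the entry \<open>c'\<close> of \<open>y\<close>.\<close>
  define g where "g = (\<lambda>i. if i = b then c * c' else 1)"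
  define s :: "int ^ 'd \<Rightarrow> int ^ 'd" where "s z = (\<chi> i. g i * z $ t i)" for z
  have g: "g i = 1 \<or> g i = -1" for i using x(1) y(1) by (auto simp: g_def)
  have g2: "g i * g i = 1" for i using g[of i] by auto
  have tt: "t (t i) = i" for i by (simp add: t_def)
  have "inj s"
  proof (rule injI)
    fix u v assume "s u = s v"
    then have "g i * u $ t i = g i * v $ t i" for i by (simp add: s_def vec_eq_iff)
    moreover have "g i \<noteq> 0" for i using g[of i] by auto
    ultimately have "u $ t i = v $ t i" for i by simp
    then have "u $ t (t i) = v $ t (t i)" for i by blast
    then show "u = v" by (simp add: vec_eq_iff tt)
  qed
  moreover have "s (u + v) = s u + s v" for u v
    by (simp add: s_def vec_eq_iff distrib_left)
  moreover have "s v \<in> unit_sphere \<longleftrightarrow> v \<in> unit_sphere" for v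
  proof -
    have "(\<Sum>i\<in>UNIV. (s v $ i)\<^sup>2) = (\<Sum>i\<in>UNIV. (v $ t i)\<^sup>2)"
      by (rule sum.cong) (auto simp: s_def power_mult_distrib power2_eq_square g2)
    also have "\<dots> = (\<Sum>i\<in>UNIV. (v $ i)\<^sup>2)"
      by (rule sum.reindex_bij_betw) (auto simp: t_def)
    finally show ?thesis by (simp add: mem_unit_sphere_iff)
  qed
  moreover have "s x = y"
  proof -
    have "s x $ i = y $ i" for i
      using x(1) y(1) unfolding s_def x y g_def t_def
      by (cases "i = b"; cases "i = a") (auto simp: axis_def transpose_def)
    then show ?thesis by (simp add: vec_eq_iff)
  qed
  ultimately show ?thesis using that by blast
qed

lemma visits_map:
  assumes "\<And>u v. s (u + v) = s u + s v" "\<And>v. s v \<in> A \<longleftrightarrow> v \<in> A"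
  shows "visits A (s x) (map s l) = visits A x l"
proof (induction l arbitrary: x)
  case (Cons v l)
  have "s x + s v = s (x + v)" by (simp add: assms(1))
  then show ?case using Cons[of "x + v"] assms(2)[of "x + v"] by (simp only: list.map visits.simps)
qed simp

lemma sum_list_map_additive:
  assumes "\<And>u v. s (u + v) = s u + (s v :: int ^ 'd::finite)"
  shows "sum_list (map s l) = s (sum_list l)"
proof -
  have "s 0 = 0" using assms[of 0 0] by simp
  then show ?thesis by (induction l) (simp_all add: assms)
qed

subsection \<open>The heat kernel\<close>

primrec srw1 :: "nat \<Rightarrow> int \<Rightarrow> real"
  where
    "srw1 0 y = (if y = 0 then 1 else 0)"
  | "srw1 (Suc n) y = (srw1 n (y - 1) + srw1 n (y + 1)) / 2"

text \<open>\<open>k\<close> is the number of steps upwards, so Pascal's rule gives a binomial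
  value. Positions of the wrong parity are carried along in the same induction, and \<open>k\<close>
  is an integer so that all positions are covered.\<close>

lemma srw1_eq:
  "srw1 n (2 * k - int n) = (if k \<ge> 0 then real (n choose nat k) else 0) / 2 ^ n \<and>
   srw1 n (2 * k - int n + 1) = 0"
proof (induction n arbitrary: k)
  case 0
  have "2 * k + 1 \<noteq> 0" by presburger
  then show ?case
    by (cases "k > 0") (auto simp: binomial_eq_0)
next
  case (Suc n)
  have a: "2 * k - int (Suc n) - 1 = 2 * (k - 1) - int n" "2 * k - int (Suc n) + 1 = 2 * k - int n"
    "2 * k - int (Suc n) + 1 - 1 = 2 * (k - 1) - int n + 1"
    "2 * k - int (Suc n) + 1 + 1 = 2 * k - int n + 1" by simp_all
  have z: "srw1 (Suc n) (2 * k - int (Suc n) + 1) = 0"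
    using Suc[of k] Suc[of "k - 1"] unfolding srw1.simps a by simp
  have "srw1 (Suc n) (2 * k - int (Suc n)) =
      (srw1 n (2 * (k - 1) - int n) + srw1 n (2 * k - int n)) / 2"
    unfolding srw1.simps a by simp
  also have "\<dots> = (if k \<ge> 0 then real (Suc n choose nat k) else 0) / 2 ^ Suc n"
  proof (cases "k \<ge> 1")
    case True
    define j where "j = nat (k - 1)"
    have "nat k = Suc j" "nat (k - 1) = j" using True by (auto simp: j_def)
    then show ?thesis using Suc[of k] Suc[of "k - 1"] True by (simp add: add_divide_distrib)
  next
    case False
    then show ?thesis using Suc[of k] Suc[of "k - 1"] by (cases "k = 0") auto
  qed
  finally show ?case using z by simp
qed

text \<open>The left-hand side is nonincreasing in \<open>m\<close>: its successive ratio is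
  \<open>(2 m + 1) (2 m + 3) / (2 m + 2)^2\<close>, at most 1.\<close>

lemma central_binomial_upper: "((2 * m choose m) / 4 ^ m)\<^sup>2 * (2 * real m + 1) \<le> 1"
proof (induction m)
  case (Suc m)
  have "(2 * Suc m choose Suc m) * Suc m = 2 * (2 * m + 1) * (2 * m choose m)"
  proof -
    have 1: "Suc (2 * m + 1) * (2 * m + 1 choose m) = (2 * Suc m choose Suc m) * Suc m"
      using Suc_times_binomial_eq[of "2 * m + 1" m] by simp
    have "(2 * m + 1 choose Suc m) * Suc m = (2 * m + 1) * (2 * m choose m)"
      using Suc_times_binomial_eq[of "2 * m" m] by simp
    moreover have "(2 * m + 1 choose Suc m) = (2 * m + 1 choose m)"
      by (subst binomial_symmetric) auto
    ultimately have "(2 * m + 1 choose m) * Suc m = (2 * m + 1) * (2 * m choose m)" by simp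
    moreover have "Suc (2 * m + 1) * (2 * m + 1 choose m) = 2 * ((2 * m + 1 choose m) * Suc m)"
      by simp
    ultimately show ?thesis using 1 by (simp add: algebra_simps)
  qed
  then have "real ((2 * Suc m choose Suc m) * Suc m) = real (2 * (2 * m + 1) * (2 * m choose m))"
    by (rule arg_cong)
  then have eq: "real (2 * Suc m choose Suc m) = 2 * (2 * real m + 1) * real (2 * m choose m) / real (Suc m)"
    by (simp add: field_simps)
  define c where "c = real (2 * m choose m) / 4 ^ m"
  have "real (2 * Suc m choose Suc m) / 4 ^ Suc m = c * ((2 * real m + 1) / (2 * real m + 2))"
  proof -
    have *: "2 * A * b / S / (4 * P) = b / P * (A / (2 * S))" if "S > 0" "P > 0" for A b S P :: real
      using that by (simp add: field_simps)
    have "4 ^ Suc m = 4 * (4 ^ m :: real)" "2 * real m + 2 = 2 * real (Suc m)" by simp_all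
    then show ?thesis
      unfolding eq c_def by (simp only:) (rule *, auto)
  qed
  then have "(real (2 * Suc m choose Suc m) / 4 ^ Suc m)\<^sup>2 * (2 * real (Suc m) + 1) =
     (c\<^sup>2 * (2 * real m + 1)) * ((2 * real m + 1) * (2 * real m + 3) / (2 * real m + 2)\<^sup>2)"
    by (simp add: power_mult_distrib power_divide power2_eq_square)
  also have "\<dots> \<le> 1 * 1"
  proof (rule mult_mono)
    show "c\<^sup>2 * (2 * real m + 1) \<le> 1" using Suc by (simp add: c_def)
    show "(2 * real m + 1) * (2 * real m + 3) / (2 * real m + 2)\<^sup>2 \<le> 1"
      by (simp add: divide_le_eq_1 power2_eq_square algebra_simps add_pos_nonneg)
  qed auto
  finally show ?case by simp
qed simp

lemma srw1_nonneg: "srw1 n y \<ge> 0"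
  by (induction n arbitrary: y) auto

text \<open>At an even time the central position is the most likely one. The maximum at time
  \<open>2 * m + 1\<close> equals the central value at time \<open>2 * m + 2\<close>, by Pascal's
  rule and symmetry, so the same estimate serves.\<close>

lemma srw1_le: "srw1 n y \<le> 1 / sqrt (real n + 1)"
proof -
  have half: "srw1 (2 * m) y \<le> 1 / sqrt (2 * real m + 1)" for m y
  proof -
    have "srw1 (2 * m) y \<le> (2 * m choose m) / 4 ^ m"
    proof (cases "even y")
      case True
      then obtain k where k: "y = 2 * k" by auto
      have "srw1 (2 * m) y = (if k + int m \<ge> 0 then real (2 * m choose nat (k + int m)) else 0) / 2 ^ (2 * m)"
        using srw1_eq[of "2 * m" "k + int m"] by (simp add: k)
      moreover have "real (2 * m choose nat (k + int m)) \<le> real (2 * m choose m)"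
        using binomial_maximum[of "2 * m" "nat (k + int m)"] by simp
      ultimately show ?thesis by (auto simp: power_mult divide_right_mono)
    next
      case False
      then obtain k where k: "y = 2 * k + 1" by (metis oddE)
      show ?thesis
        using srw1_eq[of "2 * m" "k + int m"] by (simp add: k)
    qed
    also have "\<dots> \<le> 1 / sqrt (2 * real m + 1)"
    proof -
      have "((2 * m choose m) / 4 ^ m)\<^sup>2 \<le> (1 / sqrt (2 * real m + 1))\<^sup>2"
        using central_binomial_upper[of m] by (simp add: power_divide field_simps)
      then show ?thesis by (rule power2_le_imp_le) simp
    qed
    finally show ?thesis .
  qed
  show ?thesis
  proof (cases "even n")
    case True
    then obtain m where "n = 2 * m" by (rule evenE)
    then show ?thesis using half[of m y] by simp
  next
    case False
    then obtain m where n: "n = Suc (2 * m)" by (metis oddE Suc_eq_plus1)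
    show ?thesis
    proof (cases "even y")
      case True
      then obtain k where k: "y = 2 * k" by auto
      have "srw1 n (2 * (k + int m) - int n + 1) = 0" using srw1_eq[of n "k + int m"] by simp
      moreover have "2 * (k + int m) - int n + 1 = y" by (simp add: n k)
      ultimately show ?thesis by simp
    next
      case False
      then have "y = 2 * ((y + 1) div 2) - 1" by presburger
      then obtain k where k: "y = 2 * k - 1" by blast
      have "y = 2 * (k + int m) - int n" by (simp add: n k)
      then have "srw1 n y = (if k + int m \<ge> 0 then real (n choose nat (k + int m)) else 0) / 2 ^ n"
        using srw1_eq[of n "k + int m"] by simp
      also have "\<dots> \<le> real (n choose (n div 2)) / 2 ^ n"
        using binomial_maximum[of n "nat (k + int m)"] by (auto intro: divide_right_mono)
      also have "real (n choose (n div 2)) / 2 ^ n = (2 * Suc m choose Suc m) / 4 ^ Suc m"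
      proof -
        have "(2 * Suc m choose Suc m) = (n choose Suc m) + (n choose m)" by (simp add: n)
        moreover have "(n choose Suc m) = (n choose m)" by (subst binomial_symmetric) (auto simp: n)
        ultimately show ?thesis by (simp add: n power_mult)
      qed
      also have "\<dots> \<le> 1 / sqrt (real n + 1)"
      proof -
        have "((2 * Suc m choose Suc m) / 4 ^ Suc m)\<^sup>2 * (real n + 1)
            \<le> ((2 * Suc m choose Suc m) / 4 ^ Suc m)\<^sup>2 * (2 * real (Suc m) + 1)"
          by (intro mult_left_mono) (auto simp: n)
        also have "\<dots> \<le> 1" by (rule central_binomial_upper)
        finally have "((2 * Suc m choose Suc m) / 4 ^ Suc m)\<^sup>2 \<le> (1 / sqrt (real n + 1))\<^sup>2"
          by (simp add: power_divide field_simps)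
        then show ?thesis by (rule power2_le_imp_le) simp
      qed
      finally show ?thesis .
    qed
  qed
qed

section \<open>Averages over the numbers of steps along the axes\<close>

primrec cavg :: "nat \<Rightarrow> (('d::finite \<Rightarrow> nat) \<Rightarrow> real) \<Rightarrow> real"
  where
    "cavg 0 h = h (\<lambda>_. 0)"
  | "cavg (Suc t) h = (\<Sum>b\<in>UNIV. cavg t (\<lambda>n. h (n(b := Suc (n b))))) / real CARD('d)"

lemma cavg_mono: "(\<And>n. h n \<le> h' n) \<Longrightarrow> cavg t h \<le> cavg t h'"
  by (induction t arbitrary: h h') (auto intro!: divide_right_mono sum_mono)

lemma cavg_const [simp]: "cavg t (\<lambda>_. c) = c"
  by (induction t) auto

lemma cavg_add: "cavg t (\<lambda>n. h n + h' n) = cavg t h + cavg t h'"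
  by (induction t arbitrary: h h') (auto simp: sum.distrib add_divide_distrib)

lemma cavg_cmult: "cavg t (\<lambda>n. c * h n) = c * cavg t h"
  by (induction t arbitrary: h) (auto simp: sum_distrib_left)

text \<open>Size biasing of multinomial counts: one of the \<open>t + 1\<close> steps is singled
  out, it runs along axis \<open>a\<close> with probability \<open>1 / d\<close>, and
  \<open>t\<close> free steps remain.\<close>

lemma cavg_size_bias:
  fixes h :: "('d::finite \<Rightarrow> nat) \<Rightarrow> real"
  shows "cavg (Suc t) (\<lambda>n. real (n a) * h n) =
     (real t + 1) / real CARD('d) * cavg t (\<lambda>n. h (n(a := Suc (n a))))"
proof (induction t arbitrary: h)
  case 0
  have "(\<Sum>b\<in>UNIV. real (((\<lambda>_. 0)(b := Suc 0)) a) * h ((\<lambda>_. 0)(b := Suc 0))) = 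
     (\<Sum>b\<in>UNIV. if b = a then h ((\<lambda>_. 0)(a := Suc 0)) else 0)"
    by (rule sum.cong) auto
  then show ?case by (simp del: fun_upd_apply)
next
  case (Suc t)
  let ?u = "\<lambda>b n::'d \<Rightarrow> nat. n(b := Suc (n b))"
  have comm: "?u a (?u b n) = ?u b (?u a n)" for a b n by auto
  have "cavg (Suc t) (\<lambda>n. real (?u b n a) * h (?u b n)) =
      cavg (Suc t) (\<lambda>n. real (n a) * h (?u b n)) + (if b = a then cavg (Suc t) (\<lambda>n. h (?u a n)) else 0)" for b
  proof (cases "b = a")
    case True
    have "(\<lambda>n. real (?u a n a) * h (?u a n)) = (\<lambda>n. real (n a) * h (?u a n) + h (?u a n))"
      by (simp add: algebra_simps)
    then show ?thesis
      unfolding True by (simp only: cavg_add if_True refl)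
  qed simp
  moreover have "cavg (Suc t) (\<lambda>n. real (n a) * h (?u b n)) =
      (real t + 1) / real CARD('d) * cavg t (\<lambda>n. h (?u a (?u b n)))" for b
    by (subst Suc.IH) (simp only: comm)
  ultimately have *: "cavg (Suc t) (\<lambda>n. real (?u b n a) * h (?u b n)) =
     (real t + 1) / real CARD('d) * cavg t (\<lambda>n. h (?u a (?u b n)))
       + (if b = a then cavg (Suc t) (\<lambda>n. h (?u a n)) else 0)" for b
    by presburger
  have "cavg (Suc (Suc t)) (\<lambda>n. real (n a) * h n) =
      (\<Sum>b\<in>UNIV. cavg (Suc t) (\<lambda>n. real (?u b n a) * h (?u b n))) / real CARD('d)"
    by (subst cavg.simps(2)) simp
  also have "\<dots> = ((real t + 1) / real CARD('d) * (\<Sum>b\<in>UNIV. cavg t (\<lambda>n. h (?u a (?u b n))))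
       + cavg (Suc t) (\<lambda>n. h (?u a n))) / real CARD('d)"
    unfolding * by (simp add: sum.distrib sum_distrib_left del: cavg.simps fun_upd_apply)
  also have "(\<Sum>b\<in>UNIV. cavg t (\<lambda>n. h (?u a (?u b n)))) = real CARD('d) * cavg (Suc t) (\<lambda>n. h (?u a n))"
    by simp
  finally have "cavg (Suc (Suc t)) (\<lambda>n. real (n a) * h n) =
      ((real t + 1) / real CARD('d) * (real CARD('d) * cavg (Suc t) (\<lambda>n. h (?u a n)))
       + cavg (Suc t) (\<lambda>n. h (?u a n))) / real CARD('d)" .
  moreover have *: "((real t + 1) / k * (k * c) + c) / k = (real (Suc t) + 1) / k * c" if "k > 0" for k c :: real
    using that by (simp add: field_simps)
  ultimately show ?case
    by (simp only: *[of "real CARD('d)"] of_nat_0_less_iff zero_less_card_finite)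
qed

text \<open>Size biasing applied to a function divided by \<open>n a\<close> removes the factor
  \<open>1 / (n a + 1)\<close> at the cost of \<open>d / (t + 1)\<close>, one axis after
  another.\<close>

lemma cavg_prod_inverse_le:
  fixes A :: "'d::finite set"
  shows "cavg t (\<lambda>n. \<Prod>i\<in>A. 1 / (real (n i) + 1)) \<le> (real CARD('d) / (real t + 1)) ^ card A"
proof (induction A arbitrary: t rule: finite_induct[OF finite])
  case 1
  then show ?case by simp
next
  case (2 a A)
  let ?d = "real CARD('d)"
  define g where "g n = (\<Prod>i\<in>A. 1 / (real (n i) + 1))" for n :: "'d \<Rightarrow> nat"
  have g0: "g n \<ge> 0" for n by (auto simp: g_def intro!: prod_nonneg)
  have ga: "g (n(a := m)) = g n" for n m
    unfolding g_def using 2 by (intro prod.cong) auto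
  have "(real t + 1) / ?d * cavg t (\<lambda>n. g n / (real (n a) + 1)) = cavg (Suc t) (\<lambda>n. real (n a) * (g n / real (n a)))"
    unfolding cavg_size_bias ga by (simp add: add.commute)
  \<comment> \<open>The two integrands differ only where \<open>n a = 0\<close>, and there the left
    one is 0.\<close>
  also have "\<dots> \<le> cavg (Suc t) g"
    by (rule cavg_mono) (auto simp: g0)
  also have "\<dots> \<le> (?d / (real (Suc t) + 1)) ^ card A"
    unfolding g_def by (rule 2)
  also have "\<dots> \<le> (?d / (real t + 1)) ^ card A"
    by (intro power_mono divide_left_mono) auto
  finally have "cavg t (\<lambda>n. g n / (real (n a) + 1)) \<le> (?d / (real t + 1)) ^ card A * (?d / (real t + 1))"
    by (simp add: field_simps del: power_divide)
  moreover have "(\<Prod>i\<in>insert a A. 1 / (real (n i) + 1)) = g n / (real (n a) + 1)" for n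
    using 2 by (simp add: g_def)
  ultimately show ?case using 2 by (simp add: mult.commute)
qed

text \<open>The Cauchy-Schwarz inequality for the average, obtained from
  \<open>h \<le> h^2 / (2 * s) + s / 2\<close>.\<close>

lemma cavg_le_of_square:
  assumes "cavg t (\<lambda>n. (h n)\<^sup>2) \<le> s\<^sup>2" "s > 0"
  shows "cavg t h \<le> s"
proof -
  have "h n \<le> (h n)\<^sup>2 * (1 / (2 * s)) + s / 2" for n
  proof -
    have "0 \<le> (h n - s)\<^sup>2" by simp
    then show ?thesis using assms(2) by (simp add: power2_eq_square field_simps)
  qed
  then have "cavg t h \<le> cavg t (\<lambda>n. 1 / (2 * s) * (h n)\<^sup>2 + s / 2)"
    by (intro cavg_mono) (simp add: mult.commute)
  also have "\<dots> = 1 / (2 * s) * cavg t (\<lambda>n. (h n)\<^sup>2) + s / 2"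
    unfolding cavg_add cavg_cmult by simp
  also have "\<dots> \<le> 1 / (2 * s) * s\<^sup>2 + s / 2"
    using assms by (intro add_right_mono mult_left_mono) auto
  also have "\<dots> = s" using assms(2) by (simp add: power2_eq_square)
  finally show ?thesis .
qed

text \<open>Conditionally on the number of steps along each axis, the coordinates of the walk are
  independent one-dimensional walks.\<close>

lemma pavg_sum_list_eq:
  fixes y :: "int ^ 'd::finite"
  shows "pavg t (\<lambda>l. of_bool (sum_list l = y)) = cavg t (\<lambda>n. \<Prod>i\<in>UNIV. srw1 (n i) (y $ i))"
proof (induction t arbitrary: y)
  case 0
  show ?case
  proof (cases "y = 0")
    case False
    then obtain i where "y $ i \<noteq> 0" by (auto simp: vec_eq_iff)
    then have "(\<Prod>i\<in>UNIV. srw1 0 (y $ i)) = 0" by (intro prod_zero) auto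
    with False show ?thesis by simp
  qed simp
next
  case (Suc t)
  let ?w = "\<lambda>(y :: int ^ 'd) n. \<Prod>i\<in>UNIV. srw1 (n i) (y $ i)"
  have split: "?w y (n(c := Suc (n c))) = 1 / 2 * (?w (y - axis c 1) n + ?w (y + axis c 1) n)" for c n
  proof -
    have *: "?w z m = srw1 (m c) (z $ c) * (\<Prod>i\<in>UNIV - {c}. srw1 (m i) (z $ i))" for z m
      by (subst prod.remove[of _ c]) auto
    have **: "(\<Prod>i\<in>UNIV - {c}. srw1 (m i) (z $ i)) = (\<Prod>i\<in>UNIV - {c}. srw1 (n i) (y $ i))"
      if "\<And>i. i \<noteq> c \<Longrightarrow> m i = n i \<and> z $ i = y $ i" for z m
      using that by (intro prod.cong) auto
    show ?thesis
      unfolding * by (subst (1 2 3) **) (auto simp: axis_def algebra_simps add_divide_distrib)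
  qed
  have "pavg (Suc t) (\<lambda>l. of_bool (sum_list l = y)) =
     (\<Sum>c\<in>UNIV. pavg t (\<lambda>l. of_bool (sum_list l = y - axis c 1)) + pavg t (\<lambda>l. of_bool (sum_list l = y + axis c 1)))
       / (2 * real CARD('d))"
    unfolding pavg_Suc sum_unit_sphere by (simp add: algebra_simps eq_diff_eq)
  also have "\<dots> = (\<Sum>c\<in>UNIV. cavg t (\<lambda>n. ?w y (n(c := Suc (n c))))) / real CARD('d)"
    unfolding split cavg_cmult cavg_add Suc.IH by (simp add: sum_divide_distrib)
  finally show ?case by simp
qed

text \<open>Three coordinates contribute one inverse square root each and the others are bounded by
  1. The resulting exponent \<open>3 / 2\<close> gives summability in every dimension from 3
  on.\<close>

lemma heat_kernel_bound:
  fixes y :: "int ^ 'd::finite"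
  assumes "CARD('d) \<ge> 3"
  shows "pavg t (\<lambda>l. of_bool (sum_list l = y)) \<le> sqrt ((real CARD('d) / (real t + 1)) ^ 3)"
proof -
  let ?s = "sqrt ((real CARD('d) / (real t + 1)) ^ 3)"
  obtain A :: "'d set" where A: "card A = 3"
    using assms obtain_subset_with_card_n[of 3 "UNIV :: 'd set"] by blast
  have "pavg t (\<lambda>l. of_bool (sum_list l = y)) = cavg t (\<lambda>n. \<Prod>i\<in>UNIV. srw1 (n i) (y $ i))"
    by (rule pavg_sum_list_eq)
  also have "\<dots> \<le> cavg t (\<lambda>n. \<Prod>i\<in>A. 1 / sqrt (real (n i) + 1))"
  proof (rule cavg_mono)
    fix n :: "'d \<Rightarrow> nat"
    have "1 / sqrt (real k + 1) \<le> 1" for k :: nat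
      by (simp add: divide_le_eq_1)
    then have "(\<Prod>i\<in>UNIV. srw1 (n i) (y $ i)) \<le> (\<Prod>i\<in>UNIV. if i \<in> A then 1 / sqrt (real (n i) + 1) else 1)"
      by (intro prod_mono) (auto simp: srw1_nonneg srw1_le intro: order_trans[OF srw1_le])
    also have "\<dots> = (\<Prod>i\<in>A. 1 / sqrt (real (n i) + 1))"
      by (simp add: prod.If_cases)
    finally show "(\<Prod>i\<in>UNIV. srw1 (n i) (y $ i)) \<le> \<dots>" .
  qed
  also have "\<dots> \<le> ?s"
  proof (rule cavg_le_of_square)
    have "(\<Prod>i\<in>A. 1 / sqrt (real (n i) + 1))\<^sup>2 = (\<Prod>i\<in>A. 1 / (real (n i) + 1))" for n :: "'d \<Rightarrow> nat"
      by (simp add: power_divide prod_power_distrib)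
    then have "cavg t (\<lambda>n. (\<Prod>i\<in>A. 1 / sqrt (real (n i) + 1))\<^sup>2) \<le> (real CARD('d) / (real t + 1)) ^ 3"
      using cavg_prod_inverse_le[of t A] A by simp
    then show "cavg t (\<lambda>n. (\<Prod>i\<in>A. 1 / sqrt (real (n i) + 1))\<^sup>2) \<le> ?s\<^sup>2"
      by simp
  qed simp
  finally show ?thesis .
qed

subsection \<open>Excursions from the sphere\<close>

text \<open>The first visit to the sphere happens at time \<open>u + 1\<close>, and the centre is not visited before.\<close>

primrec hit_kernel :: "nat \<Rightarrow> int ^ 'd::finite \<Rightarrow> real"
  where
    "hit_kernel 0 x = (\<Sum>v\<in>unit_sphere. if x + v \<in> unit_sphere then 1 else 0) / (2 * real CARD('d))"
  | "hit_kernel (Suc u) x =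
      (\<Sum>v\<in>unit_sphere. if x + v \<in> unit_sphere \<or> x + v = 0 then 0 else hit_kernel u (x + v)) / (2 * real CARD('d))"

primrec avoid_prob :: "nat \<Rightarrow> int ^ 'd::finite \<Rightarrow> real"
  where
    "avoid_prob 0 x = 1"
  | "avoid_prob (Suc u) x =
      (\<Sum>v\<in>unit_sphere. if x + v \<in> unit_sphere \<or> x + v = 0 then 0 else avoid_prob u (x + v)) / (2 * real CARD('d))"

lemma hit_kernel_nonneg: "hit_kernel u x \<ge> 0"
  by (induction u arbitrary: x) (auto intro!: divide_nonneg_nonneg sum_nonneg)

lemma sum_sphere_opposite:
  fixes x :: "int ^ 'd::finite"
  shows "(\<Sum>v\<in>unit_sphere. if x + v = 0 then c else 0) = (if x \<in> unit_sphere then c else (0::real))"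
proof -
  have "(\<Sum>v\<in>unit_sphere. if x + v = 0 then c else 0) = (\<Sum>v\<in>unit_sphere. if v = - x then c else 0)"
    by (rule sum.cong) (auto simp: eq_neg_iff_add_eq_0 add.commute)
  then show ?thesis by simp
qed

text \<open>First-step analysis is unrolled until the first visit to the sphere or its centre. The centre
  can be reached before the sphere only in the very first step, and only from the sphere.\<close>

lemma renewal:
  fixes x :: "int ^ 'd::finite"
  assumes step: "\<And>t x. h (Suc t) x = (\<Sum>v\<in>unit_sphere. if x + v \<in> unit_sphere then g t
      else if x + v = 0 then gc t else h t (x + v)) / (2 * real CARD('d))"
    and init: "\<And>x. h 0 x = c" and "x \<noteq> 0"
  shows "h t x = (\<Sum>u<t. hit_kernel u x * g (t - Suc u))
      + (if x \<in> unit_sphere \<and> t > 0 then gc (t - 1) / (2 * real CARD('d)) else 0)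
      + c * avoid_prob t x"
  using \<open>x \<noteq> 0\<close>
proof (induction t arbitrary: x)
  case 0
  then show ?case by (simp add: init)
next
  case (Suc t)
  let ?D = "2 * real CARD('d)"
  let ?S = "unit_sphere :: (int ^ 'd) set"
  let ?in = "\<lambda>v. x + v \<in> ?S \<or> x + v = 0"
  \<comment> \<open>Off the ball the induction hypothesis applies, and its centre term vanishes
    because \<open>x + v\<close> is not on the sphere.\<close>
  have split: "(if x + v \<in> ?S then g t else if x + v = 0 then gc t else h t (x + v)) =
      (if x + v \<in> ?S then 1 else 0) * g t + (if x + v = 0 then gc t else 0)
      + (\<Sum>u<t. (if ?in v then 0 else hit_kernel u (x + v)) * g (t - Suc u))
      + c * (if ?in v then 0 else avoid_prob t (x + v))" for v
    using Suc.IH[of "x + v"] by auto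
  have "h (Suc t) x * ?D = (\<Sum>v\<in>?S. if x + v \<in> ?S then 1 else 0) * g t + (if x \<in> ?S then gc t else 0)
      + (\<Sum>u<t. (\<Sum>v\<in>?S. if ?in v then 0 else hit_kernel u (x + v)) * g (t - Suc u))
      + c * (\<Sum>v\<in>?S. if ?in v then 0 else avoid_prob t (x + v))"
  proof -
    have "h (Suc t) x * ?D = (\<Sum>v\<in>?S. if x + v \<in> ?S then g t else if x + v = 0 then gc t else h t (x + v))"
      unfolding step by simp
    also have "\<dots> = (\<Sum>v\<in>?S. (if x + v \<in> ?S then 1 else 0) * g t) + (\<Sum>v\<in>?S. if x + v = 0 then gc t else 0)
      + (\<Sum>v\<in>?S. \<Sum>u<t. (if ?in v then 0 else hit_kernel u (x + v)) * g (t - Suc u))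
      + (\<Sum>v\<in>?S. c * (if ?in v then 0 else avoid_prob t (x + v)))"
      unfolding split by (simp only: sum.distrib)
    also have "(\<Sum>v\<in>?S. \<Sum>u<t. (if ?in v then 0 else hit_kernel u (x + v)) * g (t - Suc u)) =
        (\<Sum>u<t. (\<Sum>v\<in>?S. if ?in v then 0 else hit_kernel u (x + v)) * g (t - Suc u))"
      by (subst sum.swap) (simp only: sum_distrib_right)
    finally show ?thesis
      by (simp only: sum_sphere_opposite sum_distrib_left sum_distrib_right)
  qed
  moreover have "(\<Sum>v\<in>?S. if x + v \<in> ?S then 1 else 0) = hit_kernel 0 x * ?D"
    "(\<Sum>v\<in>?S. if ?in v then 0 else hit_kernel u (x + v)) = hit_kernel (Suc u) x * ?D"
    "(\<Sum>v\<in>?S. if ?in v then 0 else avoid_prob t (x + v)) = avoid_prob (Suc t) x * ?D" for u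
    by simp_all
  ultimately have "h (Suc t) x * ?D = hit_kernel 0 x * ?D * g t + (if x \<in> ?S then gc t else 0)
      + (\<Sum>u<t. hit_kernel (Suc u) x * ?D * g (t - Suc u)) + c * (avoid_prob (Suc t) x * ?D)"
    by (simp only:)
  also have "(\<Sum>u<t. hit_kernel (Suc u) x * ?D * g (t - Suc u)) = (\<Sum>u<t. hit_kernel (Suc u) x * g (t - Suc u)) * ?D"
    unfolding sum_distrib_right by (rule sum.cong) (simp_all only: mult_ac)
  also have "hit_kernel 0 x * ?D * g t + (if x \<in> ?S then gc t else 0)
      + (\<Sum>u<t. hit_kernel (Suc u) x * g (t - Suc u)) * ?D + c * (avoid_prob (Suc t) x * ?D) =
      ((\<Sum>u<Suc t. hit_kernel u x * g (Suc t - Suc u)) + (if x \<in> ?S \<and> Suc t > 0 then gc (Suc t - 1) / ?D else 0)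
        + c * avoid_prob (Suc t) x) * ?D"
    unfolding sum.lessThan_Suc_shift
    by (cases "x \<in> ?S") (simp_all add: algebra_simps del: hit_kernel.simps avoid_prob.simps)
  finally show ?case
    by (simp del: hit_kernel.simps avoid_prob.simps)
qed

text \<open>Signed permutations permute the step lists and act transitively on the sphere, so an
  invariant functional cannot distinguish its points.\<close>

lemma pavg_sphere_symmetric:
  fixes x y :: "int ^ 'd::finite"
  assumes "x \<in> unit_sphere" "y \<in> unit_sphere"
    and F: "\<And>s x l. inj s \<Longrightarrow> (\<And>u v. s (u + v) = s u + s v) \<Longrightarrow>
      (\<And>v. s v \<in> unit_sphere \<longleftrightarrow> v \<in> unit_sphere) \<Longrightarrow> (\<And>v. s v = 0 \<longleftrightarrow> v = 0) \<Longrightarrow> F (s x) (map s l) = F x l"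
  shows "pavg t (F x) = pavg t (F y)"
proof -
  obtain s :: "int ^ 'd \<Rightarrow> int ^ 'd" where s: "inj s" "\<And>u v. s (u + v) = s u + s v"
    "\<And>v. s v \<in> unit_sphere \<longleftrightarrow> v \<in> unit_sphere" "s x = y"
    using exists_signed_permutation[OF assms(1,2)] by blast
  have "s 0 = 0" using s(2)[of 0 0] by simp
  then have z: "s v = 0 \<longleftrightarrow> v = 0" for v using s(1) by (metis injD)
  have "pavg t (F y) = pavg t (\<lambda>l. F (s x) (map s l))"
    unfolding s(4) using s by (intro pavg_map[symmetric]) auto
  also have "\<dots> = pavg t (F x)"
    by (rule pavg_cong) (rule F[OF s(1-3) z])
  finally show ?thesis by simp
qed

text \<open>The event that the sphere is reached before the centre, cut off at a finite horizon;
  from \<open>e 1\<close> the union over all horizons is the event behind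
  \<open>sphere_return_prob\<close>.\<close>

primrec sphere_first :: "int ^ 'd::finite \<Rightarrow> (int ^ 'd) list \<Rightarrow> bool"
  where
    "sphere_first x [] = False"
  | "sphere_first x (v # l) = (x + v \<in> unit_sphere \<or> x + v \<noteq> 0 \<and> sphere_first (x + v) l)"

lemma sphere_first_map:
  assumes "\<And>u v. s (u + v) = s u + s v" "\<And>v. s v \<in> unit_sphere \<longleftrightarrow> v \<in> unit_sphere" "\<And>v. s v = 0 \<longleftrightarrow> v = 0"
  shows "sphere_first (s x) (map s l) = sphere_first x l"
proof (induction l arbitrary: x)
  case (Cons v l)
  have "s x + s v = s (x + v)" by (simp add: assms(1))
  then show ?case using Cons[of "x + v"] assms(2,3)[of "x + v"] by simp
qed simp

lemma pavg_sphere_first: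
  assumes "x \<noteq> 0"
  shows "pavg t (\<lambda>l. of_bool (sphere_first x l)) = (\<Sum>u<t. hit_kernel u x)"
proof -
  have *: "pavg (Suc t) (\<lambda>l. of_bool (sphere_first x l)) =
     (\<Sum>v\<in>unit_sphere. if x + v \<in> unit_sphere then 1 else if x + v = 0 then 0
       else pavg t (\<lambda>l. of_bool (sphere_first (x + v) l))) / (2 * real CARD('a))" for t and x :: "int ^ 'a"
    unfolding pavg_Suc by (intro arg_cong2[where f = "(/)"] sum.cong) auto
  show ?thesis
    using renewal[where h = "\<lambda>t x. pavg t (\<lambda>l. of_bool (sphere_first x l))" and g = "\<lambda>_. 1" and gc = "\<lambda>_. 0" and c = 0,
      OF * _ assms] by simp
qed

text \<open>The partial sums of the kernel are probabilities of a symmetric event, and the kernel is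
  recovered as their difference.\<close>

lemma hit_kernel_sphere_symmetric:
  fixes x y :: "int ^ 'd::finite"
  assumes "x \<in> unit_sphere" "y \<in> unit_sphere"
  shows "hit_kernel u x = hit_kernel u y"
proof -
  have "(\<Sum>u<t. hit_kernel u x) = (\<Sum>u<t. hit_kernel u y)" for t
  proof -
    have "x \<noteq> 0" "y \<noteq> 0" using assms by auto
    moreover have "pavg t (\<lambda>l. of_bool (sphere_first x l)) = pavg t (\<lambda>l. of_bool (sphere_first y l))"
      by (rule pavg_sphere_symmetric[OF assms, where F = "\<lambda>x l. of_bool (sphere_first x l)"])
        (simp add: sphere_first_map)
    ultimately show ?thesis by (simp add: pavg_sphere_first)
  qed
  from this[of "Suc u"] this[of u] show ?thesis by simp
qed

text \<open>\<open>renewal\<close> for the constant function 1: within \<open>t\<close> steps the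
  walk returns directly to the sphere, steps to the centre, or avoids both.\<close>

lemma avoid_prob_eq:
  fixes x :: "int ^ 'd::finite"
  assumes "x \<in> unit_sphere" "t > 0"
  shows "avoid_prob t x = 1 - (\<Sum>u<t. hit_kernel u x) - 1 / (2 * real CARD('d))"
proof -
  have x: "x \<noteq> 0" using assms by auto
  have "1 = (\<Sum>v\<in>unit_sphere. if x + v \<in> unit_sphere then 1 else if x + v = 0 then 1 else 1) / (2 * real CARD('d))"
    for x :: "int ^ 'd"
  proof -
    have "(if x + v \<in> unit_sphere then 1 else if x + v = 0 then 1 else 1) = (1 :: real)" for v by simp
    then show ?thesis by (simp only:) (simp add: card_unit_sphere)
  qed
  then show ?thesis
    using assms renewal[where h = "\<lambda>t x::int ^ 'd. 1" and g = "\<lambda>_. 1" and gc = "\<lambda>_. 1" and c = 1, OF _ _ x, where t = t]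
    by simp
qed

lemma pavg_avoid:
  fixes x :: "int ^ 'd::finite"
  shows "pavg t (\<lambda>l. of_bool (visits (insert 0 unit_sphere) x l = 0)) = avoid_prob t x"
  by (induction t arbitrary: x) (auto simp: pavg_Suc intro!: arg_cong2[where f = "(/)"] sum.cong)

definition ret_prob :: "'d::finite itself \<Rightarrow> real"
  where "ret_prob _ = (\<Sum>u. hit_kernel u (e 1 :: int ^ 'd))"

text \<open>The chance that a walk started on the sphere never meets sphere or centre again, as the
  limit of \<open>avoid_prob\<close>. This number and \<open>ret_prob\<close> depend only on the
  dimension, hence the type argument; \<open>sphere_return_prob_eq\<close> identifies
  \<open>ret_prob\<close> with \<open>p\<close>.\<close>

definition esc_prob :: "'d::finite itself \<Rightarrow> real"
  where "esc_prob _ = 1 - ret_prob TYPE('d) - 1 / (2 * real CARD('d))"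

lemma e_mem_sphere: "i \<in> {1..2 * CARD('d)} \<Longrightarrow> (e i :: int ^ 'd::finite) \<in> unit_sphere"
  by (simp add: unit_sphere_eq)

lemma e1_mem_sphere [simp]: "(e (Suc 0) :: int ^ 'd::finite) \<in> unit_sphere"
  by (rule e_mem_sphere) (simp add: Suc_le_eq)

lemma e1_nonzero [simp]: "(e (Suc 0) :: int ^ 'd::finite) \<noteq> 0"
  using e1_mem_sphere[where 'd = 'd] zero_notin_unit_sphere by metis

lemma sum_hit_kernel_le_1: "x \<noteq> 0 \<Longrightarrow> (\<Sum>u<t. hit_kernel u x) \<le> 1"
  unfolding pavg_sphere_first[symmetric]
  by (rule order_trans[OF pavg_mono[of t _ "\<lambda>_. 1"]]) auto

lemma summable_hit_kernel: "summable (\<lambda>u. hit_kernel u (e 1 :: int ^ 'd::finite))"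
proof (rule bounded_imp_summable)
  show "(\<Sum>u\<le>t. hit_kernel u (e 1 :: int ^ 'd)) \<le> 1" for t
    unfolding lessThan_Suc_atMost[symmetric] by (rule sum_hit_kernel_le_1) simp
qed (rule hit_kernel_nonneg)

lemma hit_kernel_sums: "(\<lambda>u. hit_kernel u (e 1 :: int ^ 'd::finite)) sums ret_prob TYPE('d)"
  unfolding ret_prob_def using summable_hit_kernel by (rule summable_sums)

lemma sum_hit_kernel_le: "(\<Sum>u<t. hit_kernel u (e 1 :: int ^ 'd::finite)) \<le> ret_prob TYPE('d)"
  unfolding ret_prob_def by (rule sum_le_suminf[OF summable_hit_kernel]) (auto simp: hit_kernel_nonneg)

lemma avoid_prob_ge:
  fixes x :: "int ^ 'd::finite"
  assumes "x \<in> unit_sphere" "t > 0"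
  shows "avoid_prob t x \<ge> esc_prob TYPE('d)"
proof -
  have "(\<Sum>u<t. hit_kernel u x) = (\<Sum>u<t. hit_kernel u (e 1 :: int ^ 'd))"
    using assms by (intro sum.cong hit_kernel_sphere_symmetric) auto
  then show ?thesis
    using sum_hit_kernel_le[of t, where 'd = 'd] by (simp add: avoid_prob_eq[OF assms] esc_prob_def)
qed

text \<open>Witness path: from \<open>e 1\<close> straight outwards and back. Positivity is needed
  because \<open>p\<close> occurs as a divisor inside a logarithm.\<close>

lemma ret_prob_pos: "ret_prob TYPE('d::finite) > 0"
proof -
  let ?x = "e 1 :: int ^ 'd"
  let ?D = "2 * real CARD('d)"
  have x: "?x \<in> unit_sphere" by simp
  have q: "?x + ?x \<notin> unit_sphere" "?x + ?x \<noteq> 0"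
  proof -
    have "(\<Sum>i\<in>UNIV. ((?x + ?x) $ i)\<^sup>2) = 4 * (\<Sum>i\<in>UNIV. (?x $ i)\<^sup>2)"
      unfolding sum_distrib_left by (rule sum.cong) (auto simp: power2_eq_square algebra_simps)
    also have "\<dots> = 4" using x by (simp add: mem_unit_sphere_iff)
    finally have "(\<Sum>i\<in>UNIV. ((?x + ?x) $ i)\<^sup>2) = 4" .
    moreover have "(\<Sum>i\<in>UNIV. ((0 :: int ^ 'd) $ i)\<^sup>2) = 0" by simp
    ultimately show "?x + ?x \<notin> unit_sphere" "?x + ?x \<noteq> 0"
      unfolding mem_unit_sphere_iff by (presburger, metis zero_neq_numeral)
  qed
  have "(if ?x + ?x + - ?x \<in> unit_sphere then 1 else 0) \<le>
      (\<Sum>v\<in>unit_sphere. if ?x + ?x + v \<in> unit_sphere then 1 else (0::real))"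
    by (rule member_le_sum[where f = "\<lambda>v. if ?x + ?x + v \<in> unit_sphere then 1 else 0"]) auto
  then have 1: "hit_kernel 0 (?x + ?x) > 0" using x by (auto intro!: divide_pos_pos)
  have "(if ?x + ?x \<in> unit_sphere \<or> ?x + ?x = 0 then 0 else hit_kernel 0 (?x + ?x)) \<le>
      (\<Sum>v\<in>unit_sphere. if ?x + v \<in> unit_sphere \<or> ?x + v = 0 then 0 else hit_kernel 0 (?x + v))"
    by (rule member_le_sum[where f = "\<lambda>v. if ?x + v \<in> unit_sphere \<or> ?x + v = 0 then 0 else hit_kernel 0 (?x + v)"])
      (auto simp: hit_kernel_nonneg simp del: hit_kernel.simps)
  then have "(\<Sum>v\<in>unit_sphere. if ?x + v \<in> unit_sphere \<or> ?x + v = 0 then 0 else hit_kernel 0 (?x + v)) > 0"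
    using 1 q by (simp del: hit_kernel.simps)
  then have "hit_kernel (Suc 0) ?x > 0"
    unfolding hit_kernel.simps(2) by (rule divide_pos_pos) simp
  moreover have "hit_kernel 0 ?x \<ge> 0" by (rule hit_kernel_nonneg)
  ultimately have "0 < (\<Sum>u<2. hit_kernel u ?x)" by (simp add: numeral_2_eq_2 del: hit_kernel.simps)
  also have "\<dots> \<le> ret_prob TYPE('d)" by (rule sum_hit_kernel_le)
  finally show ?thesis .
qed

subsection \<open>Transience and excursion counts\<close>

definition heat_bound :: "'d::finite itself \<Rightarrow> nat \<Rightarrow> real"
  where "heat_bound _ t = sqrt ((real CARD('d) / (real t + 1)) ^ 3)"

lemma heat_bound_nonneg: "heat_bound T t \<ge> 0"
  by (simp add: heat_bound_def)

lemma pavg_mem_le: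
  fixes A :: "(int ^ 'd::finite) set"
  assumes "CARD('d) \<ge> 3" "finite A"
  shows "pavg t (\<lambda>l. of_bool (x + sum_list l \<in> A)) \<le> real (card A) * heat_bound TYPE('d) t"
proof -
  have "pavg t (\<lambda>l. of_bool (x + sum_list l \<in> A)) \<le> pavg t (\<lambda>l. \<Sum>y\<in>A. of_bool (sum_list l = y - x))"
  proof (rule pavg_mono)
    fix l :: "(int ^ 'd) list"
    show "of_bool (x + sum_list l \<in> A) \<le> (\<Sum>y\<in>A. of_bool (sum_list l = y - x) :: real)"
    proof (cases "x + sum_list l \<in> A")
      case True
      have "of_bool (sum_list l = (x + sum_list l) - x) \<le> (\<Sum>y\<in>A. of_bool (sum_list l = y - x) :: real)"
        by (rule member_le_sum[OF True]) (use assms in auto)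
      then show ?thesis using True by simp
    qed (simp add: sum_nonneg)
  qed
  also have "\<dots> = (\<Sum>y\<in>A. pavg t (\<lambda>l. of_bool (sum_list l = y - x)))"
    by (rule pavg_sum)
  also have "\<dots> \<le> (\<Sum>y\<in>A. heat_bound TYPE('d) t)"
    unfolding heat_bound_def by (intro sum_mono heat_kernel_bound assms)
  finally show ?thesis by simp
qed

text \<open>With \<open>a\<close> and \<open>b\<close> the square roots of \<open>t\<close> and
  \<open>t + 1\<close>, the difference \<open>1 / a - 1 / b\<close> equals
  \<open>1 / ((a + b) a b)\<close> and is at least \<open>1 / (2 b^3)\<close>. The telescoping form
  bounds finite and infinite tails alike by a multiple of \<open>1 / sqrt T\<close>.\<close>

lemma heat_bound_telescope:
  assumes "t \<ge> 1"
  shows "heat_bound TYPE('d::finite) t \<le>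
    2 * sqrt (real CARD('d) ^ 3) * (1 / sqrt (real t) - 1 / sqrt (real t + 1))"
proof -
  define a b where "a = sqrt (real t)" "b = sqrt (real t + 1)"
  have ab: "0 < a" "a \<le> b" "b\<^sup>2 = a\<^sup>2 + 1" using assms by (auto simp: a_b_def)
  have "heat_bound TYPE('d) t = sqrt (real CARD('d) ^ 3) * (1 / b ^ 3)"
    by (simp add: heat_bound_def power_divide real_sqrt_divide real_sqrt_power a_b_def)
  also have "1 / b ^ 3 \<le> 2 * (1 / a - 1 / b)"
  proof -
    have "(b - a) * (b + a) = 1" using ab(3) by (simp add: power2_eq_square algebra_simps)
    then have e: "b - a = 1 / (b + a)" using ab by (simp add: field_simps)
    have "1 / a - 1 / b = (b - a) / (a * b)" using ab by (simp add: field_simps)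
    also have "\<dots> = 1 / ((b + a) * (a * b))" unfolding e by simp
    finally have 1: "2 * (1 / a - 1 / b) = 2 / ((b + a) * (a * b))" by simp
    have "(b + a) * (a * b) \<le> (b + b) * (b * b)"
      using ab by (intro mult_mono) auto
    then have "(b + a) * (a * b) \<le> 2 * b ^ 3" by (simp add: power3_eq_cube)
    then have "2 / (2 * b ^ 3) \<le> 2 / ((b + a) * (a * b))"
      using ab by (intro divide_left_mono) auto
    then show ?thesis using 1 by simp
  qed
  finally have "heat_bound TYPE('d) t \<le> sqrt (real CARD('d) ^ 3) * (2 * (1 / a - 1 / b))"
    by (simp add: mult_left_mono)
  then show ?thesis by (simp add: a_b_def algebra_simps)
qed

lemma sum_heat_bound_le:
  assumes "T \<ge> 1"
  shows "(\<Sum>t<k. heat_bound TYPE('d::finite) (T + t)) \<le> 2 * sqrt (real CARD('d) ^ 3) / sqrt (real T)"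
proof -
  let ?C = "2 * sqrt (real CARD('d) ^ 3)"
  have "(\<Sum>t<k. heat_bound TYPE('d) (T + t)) \<le> ?C * (1 / sqrt (real T) - 1 / sqrt (real (T + k)))"
  proof (induction k)
    case (Suc k)
    have "heat_bound TYPE('d) (T + k) \<le> ?C * (1 / sqrt (real (T + k)) - 1 / sqrt (real (T + Suc k)))"
      using heat_bound_telescope[of "T + k", where 'd = 'd] assms by (simp add: add_ac)
    then show ?case using Suc by (simp add: algebra_simps)
  qed simp
  also have "\<dots> \<le> ?C * (1 / sqrt (real T))"
    by (intro mult_left_mono) auto
  finally show ?thesis by simp
qed

lemma summable_heat_bound:
  assumes "T \<ge> 1"
  shows "summable (\<lambda>t. heat_bound TYPE('d::finite) (T + t))"
proof (rule bounded_imp_summable)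
  show "(\<Sum>t\<le>k. heat_bound TYPE('d) (T + t)) \<le> 2 * sqrt (real CARD('d) ^ 3) / sqrt (real T)" for k
    unfolding lessThan_Suc_atMost[symmetric] by (rule sum_heat_bound_le[OF assms])
qed (rule heat_bound_nonneg)

lemma suminf_heat_bound_le:
  assumes "T \<ge> 1"
  shows "(\<Sum>t. heat_bound TYPE('d::finite) (T + t)) \<le> 2 * sqrt (real CARD('d) ^ 3) / sqrt (real T)"
  using summable_heat_bound[OF assms] sum_heat_bound_le[OF assms]
  by (intro suminf_le_const) auto

text \<open>Transience in quantitative form: the expected number of visits is a sum of heat kernels,
  bounded uniformly in the horizon \<open>t\<close>.\<close>

lemma pavg_visits_le:
  fixes x :: "int ^ 'd::finite"
  assumes "CARD('d) \<ge> 3"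
  shows "pavg t (\<lambda>l. real (visits unit_sphere x l)) \<le> 4 * real CARD('d) * sqrt (real CARD('d) ^ 3)"
proof -
  let ?S = "unit_sphere :: (int ^ 'd) set"
  have "pavg t (\<lambda>l. real (visits ?S x l)) = pavg t (\<lambda>l. \<Sum>i\<in>{1..t}. of_bool (x + sum_list (take i l) \<in> ?S))"
  proof (rule pavg_cong)
    fix l :: "(int ^ 'd) list" assume "length l = t"
    have "real (card {i \<in> {1..t}. x + sum_list (take i l) \<in> ?S}) = (\<Sum>i\<in>{1..t}. of_bool (x + sum_list (take i l) \<in> ?S))"
      by (simp add: of_bool_def sum.If_cases Int_def)
    then show "real (visits ?S x l) = (\<Sum>i\<in>{1..t}. of_bool (x + sum_list (take i l) \<in> ?S))"
      using \<open>length l = t\<close> by (simp add: visits_eq_card)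
  qed
  also have "\<dots> = (\<Sum>i\<in>{1..t}. pavg t (\<lambda>l. of_bool (x + sum_list (take i l) \<in> ?S)))"
    by (rule pavg_sum)
  also have "\<dots> = (\<Sum>i\<in>{1..t}. pavg i (\<lambda>l. of_bool (x + sum_list l \<in> ?S)))"
  proof (rule sum.cong)
    fix i assume "i \<in> {1..t}"
    then have t: "i + (t - i) = t" by simp
    have "pavg t (\<lambda>l. of_bool (x + sum_list (take i l) \<in> ?S)) =
        pavg i (\<lambda>l. pavg (t - i) (\<lambda>m. of_bool (x + sum_list (take i (l @ m)) \<in> ?S)))"
      using pavg_append[of i "t - i" "\<lambda>l. of_bool (x + sum_list (take i l) \<in> ?S)"] unfolding t .
    also have "\<dots> = pavg i (\<lambda>l. of_bool (x + sum_list l \<in> ?S))"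
      by (rule pavg_cong) simp
    finally show "pavg t (\<lambda>l. of_bool (x + sum_list (take i l) \<in> ?S)) = \<dots>" .
  qed simp
  also have "\<dots> \<le> (\<Sum>i\<in>{1..t}. real (card ?S) * heat_bound TYPE('d) i)"
    by (intro sum_mono pavg_mem_le assms) simp
  also have "\<dots> = 2 * real CARD('d) * (\<Sum>i<t. heat_bound TYPE('d) (1 + i))"
    by (simp add: card_unit_sphere sum_distrib_left sum.atLeast1_atMost_eq)
  also have "\<dots> \<le> 2 * real CARD('d) * (2 * sqrt (real CARD('d) ^ 3) / sqrt (real 1))"
    by (intro mult_left_mono sum_heat_bound_le) auto
  finally show ?thesis by simp
qed

text \<open>The expected number of visits \<open>U\<close> to the sphere satisfies \<open>U = r (1 + U)\<close> for the return
  probability \<open>r\<close>, so a finite \<open>U\<close> forces \<open>r < 1\<close>.\<close>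

lemma esc_prob_pos:
  assumes d3: "CARD('d::finite) \<ge> 3"
  shows "esc_prob TYPE('d) > 0"
proof -
  let ?x = "e 1 :: int ^ 'd"
  let ?D = "2 * real CARD('d)"
  let ?S = "unit_sphere :: (int ^ 'd) set"
  define U where "U t y = pavg t (\<lambda>l. real (visits ?S y l))" for t y
  define r where "r = ret_prob TYPE('d) + 1 / ?D"
  have U_sym: "U t y = U t ?x" if "y \<in> ?S" for t y
    unfolding U_def
    by (rule pavg_sphere_symmetric[OF that, where F = "\<lambda>y l. real (visits ?S y l)"]) (simp_all add: visits_map)
  have U_step: "U (Suc t) y = (\<Sum>v\<in>?S. if y + v \<in> ?S then 1 + U t ?x
     else if y + v = 0 then U t 0 else U t (y + v)) / ?D" for t y
  proof -
    have "pavg t (\<lambda>l. real (visits ?S y (v # l))) = (if y + v \<in> ?S then 1 + U t ?x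
        else if y + v = 0 then U t 0 else U t (y + v))" for v
      using U_sym[of "y + v" t] by (auto simp: U_def pavg_add)
    then show ?thesis unfolding U_def[of "Suc t"] pavg_Suc by (simp only:)
  qed
  have "?x \<noteq> 0" by simp
  \<comment> \<open>From the centre the first step always lands on the sphere.\<close>
  have U0: "U (Suc t) 0 = 1 + U t ?x" for t
  proof -
    have "U (Suc t) 0 = (\<Sum>v\<in>?S. 1 + U t ?x) / ?D"
      unfolding U_step by (intro arg_cong2[where f = "(/)"] sum.cong) auto
    then show ?thesis by (simp add: card_unit_sphere)
  qed
  have U_eq: "U t ?x = (\<Sum>u<t. hit_kernel u ?x * (1 + U (t - Suc u) ?x)) + (if t > 0 then U (t - 1) 0 / ?D else 0)" for t
    using renewal[where h = U and g = "\<lambda>t. 1 + U t ?x" and gc = "\<lambda>t. U t 0" and c = 0 and t = t,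
      OF U_step _ \<open>?x \<noteq> 0\<close>] by (simp add: U_def)
  have U_nonneg: "U t y \<ge> 0" for t y unfolding U_def by (rule pavg_nonneg) simp
  have "U t ?x \<le> U (Suc t) ?x" for t
  proof -
    have "U (t + 1) ?x = pavg t (\<lambda>l. pavg 1 (\<lambda>m. real (visits ?S ?x (l @ m))))"
      unfolding U_def by (rule pavg_append)
    also have "\<dots> \<ge> pavg t (\<lambda>l. pavg 1 (\<lambda>m :: (int ^ 'd) list. real (visits ?S ?x l)))"
      by (rule pavg_mono, rule pavg_mono) (simp add: visits_append)
    finally show ?thesis by (simp add: U_def)
  qed
  then have U_mono: "U s ?x \<le> U t ?x" if "s \<le> t" for s t
    using that by (rule lift_Suc_mono_le)
  define V where "V = (SUP t. U t ?x)"
  have bdd: "bdd_above (range (\<lambda>t. U t ?x))"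
    unfolding U_def using pavg_visits_le[OF d3] by (intro bdd_aboveI2)
  have UV: "U t ?x \<le> V" for t unfolding V_def by (rule cSUP_upper2[OF _ _ order_refl]) (use bdd in auto)
  have V0: "V \<ge> 0" using UV[of 0] U_nonneg[of 0 ?x] by linarith
  have key: "((\<Sum>u<m. hit_kernel u ?x) + 1 / ?D) * (1 + U t ?x) \<le> V" for m t
  proof -
    \<comment> \<open>With this horizon every direct return within \<open>m\<close> steps leaves at
      least \<open>t\<close> steps; the two extra steps pay for an excursion to the centre and
      back.\<close>
    let ?T = "t + m + 2"
    have "(\<Sum>u<m. hit_kernel u ?x) * (1 + U t ?x) = (\<Sum>u<m. hit_kernel u ?x * (1 + U t ?x))"
      by (rule sum_distrib_right)
    also have "\<dots> \<le> (\<Sum>u<m. hit_kernel u ?x * (1 + U (?T - Suc u) ?x))"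
      by (intro sum_mono mult_left_mono add_left_mono U_mono hit_kernel_nonneg) auto
    also have "\<dots> \<le> (\<Sum>u<?T. hit_kernel u ?x * (1 + U (?T - Suc u) ?x))"
      using U_nonneg by (intro sum_mono2) (auto intro!: mult_nonneg_nonneg hit_kernel_nonneg add_nonneg_nonneg)
    finally have 1: "(\<Sum>u<m. hit_kernel u ?x) * (1 + U t ?x) \<le> \<dots>" .
    have "(1 + U t ?x) / ?D \<le> U (?T - 1) 0 / ?D"
      using U0[of "t + m"] U_mono[of t "t + m"] by (intro divide_right_mono) auto
    with 1 have "((\<Sum>u<m. hit_kernel u ?x) + 1 / ?D) * (1 + U t ?x) \<le> U ?T ?x"
      unfolding U_eq[of ?T] by (simp add: algebra_simps add_divide_distrib del: sum.lessThan_Suc)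
    also have "\<dots> \<le> V" by (rule UV)
    finally show ?thesis .
  qed
  have "(\<lambda>m. \<Sum>u<m. hit_kernel u ?x) \<longlonglongrightarrow> ret_prob TYPE('d)"
    using hit_kernel_sums[where 'd = 'd] unfolding sums_def .
  then have "(\<lambda>m. ((\<Sum>u<m. hit_kernel u ?x) + 1 / ?D) * (1 + U t ?x)) \<longlonglongrightarrow> r * (1 + U t ?x)" for t
    unfolding r_def by (intro tendsto_intros)
  then have rU: "r * (1 + U t ?x) \<le> V" for t
    by (rule LIMSEQ_le_const2) (intro exI[of _ 0] allI impI key)
  have "r > 0" unfolding r_def using ret_prob_pos[where 'd = 'd] by (simp add: add_pos_nonneg)
  \<comment> \<open>The supremum over \<open>t\<close> is taken in
    \<open>1 + U t ?x \<le> V / r\<close>. As \<open>V\<close> is finite and nonnegative, this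
    excludes \<open>r \<ge> 1\<close>.\<close>
  have "V \<le> V / r - 1"
    unfolding V_def
  proof (rule cSUP_least)
    fix t
    have "1 + U t ?x \<le> V / r" using rU[of t] \<open>r > 0\<close> by (simp add: field_simps)
    then show "U t ?x \<le> (SUP t. U t ?x) / r - 1" by (simp add: V_def)
  qed simp
  then have "r * (V + 1) \<le> V" using \<open>r > 0\<close> by (simp add: field_simps)
  moreover have "1 * (V + 1) \<le> r * (V + 1)" if "1 \<le> r"
    using that V0 by (intro mult_right_mono) auto
  ultimately have "r < 1" by fastforce
  then show ?thesis by (simp add: esc_prob_def r_def)
qed

text \<open>The path starts on the sphere around the origin. The part beyond \<open>s\<close>, free
  of sphere visits, vouches that \<open>l\<close> is complete up to the horizon, whereas visits to
  the centre are counted over the whole path.\<close>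

definition excursion_pattern :: "nat \<Rightarrow> nat \<Rightarrow> nat \<Rightarrow> int ^ 'd::finite \<Rightarrow> (int ^ 'd) list \<Rightarrow> bool"
  where "excursion_pattern k l s x w \<longleftrightarrow> visits unit_sphere x (take s w) = l \<and>
    visits unit_sphere (x + sum_list (take s w)) (drop s w) = 0 \<and> visits {0} x w = k"

definition pattern_prob :: "nat \<Rightarrow> nat \<Rightarrow> nat \<Rightarrow> nat \<Rightarrow> int ^ 'd::finite \<Rightarrow> real"
  where "pattern_prob r k l s x = pavg (s + r) (\<lambda>w. of_bool (excursion_pattern k l s x w))"

text \<open>A choice of the \<open>k\<close> among \<open>l\<close> excursions that pass through the
  centre, without the factor for the final escape. \<open>q\<close> is a parameter because both the
  full and a truncated return probability are inserted.\<close>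

definition excursion_weight :: "'d::finite itself \<Rightarrow> real \<Rightarrow> nat \<Rightarrow> nat \<Rightarrow> real"
  where "excursion_weight _ q k l = real (l choose k) * (1 / (2 * real CARD('d))) ^ k * q ^ (l - k)"

text \<open>Pascal's rule, sorted by the type of one excursion; it is the recursion of
  \<open>pattern_prob_renewal\<close> with the durations forgotten.\<close>

lemma excursion_weight_Suc:
  "excursion_weight (T :: 'd::finite itself) q k (Suc l) =
     q * excursion_weight T q k l + (if k > 0 then excursion_weight T q (k - 1) l / (2 * real CARD('d)) else 0)"
proof (cases k)
  case (Suc j)
  \<comment> \<open>Truncated subtraction spoils the exponent when \<open>j \<ge> l\<close>, but
    then the binomial coefficient is 0.\<close>
  have "real (l choose Suc j) * q ^ (l - j) = real (l choose Suc j) * (q * q ^ (l - Suc j))"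
  proof (cases "Suc j \<le> l")
    case True
    then have "l - j = Suc (l - Suc j)" by simp
    then show ?thesis by simp
  qed (simp add: binomial_eq_0)
  then have *: "real (l choose Suc j) * c ^ Suc j * q ^ (l - j) = q * (real (l choose Suc j) * c ^ Suc j * q ^ (l - Suc j))"
    for c :: real
  proof -
    have "c ^ Suc j * (real (l choose Suc j) * q ^ (l - j)) = c ^ Suc j * (real (l choose Suc j) * (q * q ^ (l - Suc j)))"
      using \<open>real (l choose Suc j) * q ^ (l - j) = _\<close> by (rule arg_cong)
    then show ?thesis by (simp only: mult_ac)
  qed
  define c where "c = 1 / (2 * real CARD('d))"
  have "excursion_weight T q (Suc j) (Suc l) = real (Suc l choose Suc j) * c ^ Suc j * q ^ (l - j)"
    by (simp only: excursion_weight_def c_def diff_Suc_Suc)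
  also have "\<dots> = real (l choose Suc j) * c ^ Suc j * q ^ (l - j) + real (l choose j) * c ^ j * q ^ (l - j) * c"
    by (simp add: algebra_simps)
  also have "real (l choose Suc j) * c ^ Suc j * q ^ (l - j) = q * excursion_weight T q (Suc j) l"
    unfolding excursion_weight_def c_def[symmetric] by (rule *)
  also have "real (l choose j) * c ^ j * q ^ (l - j) * c = excursion_weight T q j l / (2 * real CARD('d))"
    unfolding excursion_weight_def c_def by simp
  finally show ?thesis by (simp add: Suc)
qed (simp add: excursion_weight_def)

lemma pattern_prob_nonneg: "pattern_prob r k l s x \<ge> 0"
  unfolding pattern_prob_def by (rule pavg_nonneg) simp

lemma pattern_prob_sym:
  fixes x y :: "int ^ 'd::finite"
  assumes "x \<in> unit_sphere" "y \<in> unit_sphere"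
  shows "pattern_prob r k l s x = pattern_prob r k l s y"
  unfolding pattern_prob_def
proof (rule pavg_sphere_symmetric[OF assms, where F = "\<lambda>x w. of_bool (excursion_pattern k l s x w)"])
  fix f :: "int ^ 'd \<Rightarrow> int ^ 'd" and x w
  assume f: "inj f" "\<And>u v. f (u + v) = f u + f v" "\<And>v. f v \<in> unit_sphere \<longleftrightarrow> v \<in> unit_sphere" "\<And>v. f v = 0 \<longleftrightarrow> v = 0"
  have "visits unit_sphere (f z) (map f u) = visits unit_sphere z u" for z u
    by (rule visits_map) (use f in auto)
  moreover have "visits {0} (f z) (map f u) = visits {0} z u" for z u
    by (rule visits_map) (use f in auto)
  moreover have "f x + sum_list (map f u) = f (x + sum_list u)" for u
    by (simp only: sum_list_map_additive[OF f(2)] f(2))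
  ultimately show "of_bool (excursion_pattern k l s (f x) (map f w)) = (of_bool (excursion_pattern k l s x w) :: real)"
    by (simp add: excursion_pattern_def take_map drop_map)
qed

lemma pattern_prob_Suc:
  fixes x :: "int ^ 'd::finite"
  shows "pattern_prob r k (Suc l) (Suc s) x = (\<Sum>v\<in>unit_sphere.
     if x + v \<in> unit_sphere then pattern_prob r k l s (e 1 :: int ^ 'd)
     else if x + v = 0 then (if k > 0 then pattern_prob r (k - 1) (Suc l) s (0 :: int ^ 'd) else 0)
     else pattern_prob r k (Suc l) s (x + v)) / (2 * real CARD('d))"
proof -
  have "pavg (s + r) (\<lambda>w. of_bool (excursion_pattern k (Suc l) (Suc s) x (v # w))) =
     (if x + v \<in> unit_sphere then pattern_prob r k l s (e 1 :: int ^ 'd)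
     else if x + v = 0 then (if k > 0 then pattern_prob r (k - 1) (Suc l) s (0 :: int ^ 'd) else 0)
     else pattern_prob r k (Suc l) s (x + v))" for v
  proof -
    have 1: "excursion_pattern k (Suc l) (Suc s) x (v # w) = excursion_pattern k l s (x + v) w"
      if "x + v \<in> unit_sphere" for w
      using that by (auto simp: excursion_pattern_def add.assoc)
    have 2: "excursion_pattern k (Suc l) (Suc s) x (v # w) = (k > 0 \<and> excursion_pattern (k - 1) (Suc l) s (x + v) w)"
      if "x + v = 0" for w
    proof -
      have "x + sum_list (take (Suc s) (v # w)) = x + v + sum_list (take s w)" by (simp add: add.assoc)
      then show ?thesis
        unfolding excursion_pattern_def using that by (auto simp only: take_Suc_Cons drop_Suc_Cons visits.simps) auto
    qed
    have 3: "excursion_pattern k (Suc l) (Suc s) x (v # w) = excursion_pattern k (Suc l) s (x + v) w"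
      if "x + v \<notin> unit_sphere" "x + v \<noteq> 0" for w
      using that by (auto simp: excursion_pattern_def add.assoc)
    show ?thesis
      using pattern_prob_sym[of "x + v" "e 1 :: int ^ 'd" r k l s]
      by (auto simp: 1 2 3 pattern_prob_def)
  qed
  then show ?thesis
    unfolding pattern_prob_def[of r k "Suc l" "Suc s"] add_Suc pavg_Suc by (simp only:)
qed

text \<open>Conditioning on the first excursion. One through the centre takes exactly two steps,
  hence \<open>s - 2\<close>; a direct one of length \<open>u + 1\<close> has probability
  \<open>hit_kernel u\<close>. By symmetry the walk restarts from \<open>e 1\<close>.\<close>

lemma pattern_prob_renewal:
  fixes r :: nat
  defines "P \<equiv> \<lambda>k l s. pattern_prob r k l s (e 1 :: int ^ 'd::finite)"
  shows "P k (Suc l) s = (\<Sum>u<s. hit_kernel u (e 1 :: int ^ 'd) * P k l (s - Suc u))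
     + (if s \<ge> 2 \<and> k > 0 then P (k - 1) l (s - 2) / (2 * real CARD('d)) else 0)"
proof -
  let ?x = "e 1 :: int ^ 'd"
  have "?x \<noteq> 0" by simp
  have init: "pattern_prob r k (Suc l) 0 y = 0" for k and y :: "int ^ 'd"
    by (simp add: pattern_prob_def excursion_pattern_def)
  have center: "pattern_prob r k (Suc l) (Suc s) (0 :: int ^ 'd) = P k l s" for k s
    unfolding pattern_prob_Suc by (simp add: P_def card_unit_sphere)
  have "P k (Suc l) s = (\<Sum>u<s. hit_kernel u ?x * P k l (s - Suc u))
     + (if s > 0 then (if k > 0 then pattern_prob r (k - 1) (Suc l) (s - 1) (0 :: int ^ 'd) else 0) / (2 * real CARD('d)) else 0)"
    unfolding P_def
    using renewal[where h = "\<lambda>s. pattern_prob r k (Suc l) s" and g = "\<lambda>s. pattern_prob r k l s ?x" and t = s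
      and gc = "\<lambda>s. if k > 0 then pattern_prob r (k - 1) (Suc l) s (0 :: int ^ 'd) else 0" and c = 0,
      OF pattern_prob_Suc _ \<open>?x \<noteq> 0\<close>] init by simp
  moreover have "pattern_prob r (k - 1) (Suc l) (s - 1) (0 :: int ^ 'd) = (if s \<ge> 2 then P (k - 1) l (s - 2) else 0)" if "s > 0"
  proof (cases "s \<ge> 2")
    case True
    then have "s - 1 = Suc (s - 2)" by simp
    then show ?thesis using True by (simp only: center if_True)
  next
    case False
    then have "s - 1 = 0" by simp
    then show ?thesis using False by (simp only: init if_False)
  qed
  ultimately show ?thesis by auto
qed

section \<open>Pattern probabilities against excursion weights\<close>

lemma visits_center_eq_0:
  fixes x :: "int ^ 'd::finite"
  assumes "visits unit_sphere x w = 0" "x \<noteq> 0" "x \<notin> unit_sphere" "set w \<subseteq> unit_sphere"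
  shows "visits {0} x w = 0"
  using assms
proof (induction w arbitrary: x)
  case (Cons v w)
  have "x + v \<noteq> 0"
  proof
    assume "x + v = 0"
    then have "x = - v" by (simp add: eq_neg_iff_add_eq_0)
    then show False using Cons.prems by simp
  qed
  then show ?case using Cons by (auto split: if_splits)
qed simp

text \<open>All neighbours of the centre lie on the sphere, so a step to the centre is followed by a
  sphere visit. Two steps are required for that visit to be seen, which is why trailing segments
  have length at least 2.\<close>

lemma visits_center_sphere_eq_0:
  fixes x :: "int ^ 'd::finite"
  assumes "visits unit_sphere x w = 0" "x \<in> unit_sphere" "set w \<subseteq> unit_sphere" "length w \<ge> 2"
  shows "visits {0} x w = 0"
proof -
  from assms(4) obtain v v' w' where w: "w = v # v' # w'"
    unfolding numeral_2_eq_2 Suc_le_length_iff by blast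
  have "x + v \<noteq> 0" using assms by (auto simp: w)
  moreover have "x + v \<notin> unit_sphere" using assms(1) by (auto simp: w)
  moreover have "visits unit_sphere (x + v) (v' # w') = 0" using assms(1) by (auto simp: w split: if_splits)
  ultimately have "visits {0} (x + v) (v' # w') = 0"
    using assms(3) by (intro visits_center_eq_0) (auto simp: w)
  then show ?thesis using \<open>x + v \<noteq> 0\<close> by (simp add: w)
qed

lemma pattern_prob_0_le:
  fixes x :: "int ^ 'd::finite"
  assumes "x \<in> unit_sphere" "r \<ge> 2"
  shows "pattern_prob r k 0 s x \<le> (if k = 0 then 1 else 0)"
  unfolding pattern_prob_def
proof (rule order_trans[OF pavg_mono])
  fix w :: "(int ^ 'd) list" assume w: "set w \<subseteq> unit_sphere" "length w = s + r"
  show "of_bool (excursion_pattern k 0 s x w) \<le> (if k = 0 then 1 else 0 :: real)"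
  proof (cases "excursion_pattern k 0 s x w")
    case True
    then have "visits unit_sphere x (take s w @ drop s w) = 0" 
      unfolding visits_append by (simp add: excursion_pattern_def)
    then have "visits {0} x w = 0" using w assms by (intro visits_center_sphere_eq_0) auto
    then show ?thesis using True by (simp add: excursion_pattern_def)
  qed simp
qed simp

text \<open>Induction on \<open>l\<close> against the recursion of the weights: the partial sums of
  the kernel stay below the return probability whatever the time budget \<open>s\<close>. In the
  case \<open>l = 0\<close> the trailing segment rules out a visit to the centre.\<close>

lemma pattern_prob_le:
  fixes x :: "int ^ 'd::finite"
  assumes "x \<in> unit_sphere" "r \<ge> 2"
  shows "pattern_prob r k l s x \<le> excursion_weight TYPE('d) (ret_prob TYPE('d)) k l"
proof -
  let ?W = "excursion_weight TYPE('d) (ret_prob TYPE('d))"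
  let ?x = "e 1 :: int ^ 'd"
  have W0: "?W k l \<ge> 0" for k l
    unfolding excursion_weight_def using ret_prob_pos[where 'd = 'd] by simp
  have "pattern_prob r k l s ?x \<le> ?W k l"
  proof (induction l arbitrary: k s)
    case 0
    have "pattern_prob r k 0 s ?x \<le> (if k = 0 then 1 else 0)"
      by (rule pattern_prob_0_le) (use assms in auto)
    then show ?case by (cases k) (auto simp: excursion_weight_def)
  next
    case (Suc l)
    have "(\<Sum>u<s. hit_kernel u ?x * pattern_prob r k l (s - Suc u) ?x) \<le> (\<Sum>u<s. hit_kernel u ?x * ?W k l)"
      by (intro sum_mono mult_left_mono Suc hit_kernel_nonneg)
    also have "\<dots> \<le> ret_prob TYPE('d) * ?W k l"
      unfolding sum_distrib_right[symmetric] by (intro mult_right_mono sum_hit_kernel_le W0)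
    finally have 1: "(\<Sum>u<s. hit_kernel u ?x * pattern_prob r k l (s - Suc u) ?x) \<le> ret_prob TYPE('d) * ?W k l" .
    have 2: "(if s \<ge> 2 \<and> k > 0 then pattern_prob r (k - 1) l (s - 2) ?x / (2 * real CARD('d)) else 0) \<le>
       (if k > 0 then ?W (k - 1) l / (2 * real CARD('d)) else 0)"
      using Suc[of "k - 1" "s - 2"] W0 by (auto intro: divide_right_mono)
    show ?case
      unfolding pattern_prob_renewal[of r k l s, where 'd = 'd] excursion_weight_Suc using 1 2 by (rule add_mono)
  qed
  then show ?thesis using pattern_prob_sym[OF assms(1) e1_mem_sphere] by simp
qed

text \<open>Only excursions of at most \<open>m\<close> steps are kept, so that \<open>l\<close> of
  them fit into \<open>m * l\<close> steps; \<open>m \<ge> 2\<close> leaves room for those through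
  the centre. The price is the truncated sum in place of the return probability, and the base case
  contributes the escape.\<close>

lemma pattern_prob_ge:
  fixes x :: "int ^ 'd::finite"
  assumes "x \<in> unit_sphere" "m \<ge> 2" "s \<ge> m * l" "r > 0" and esc: "esc_prob TYPE('d) \<ge> 0"
  shows "pattern_prob r k l s x \<ge>
    esc_prob TYPE('d) * excursion_weight TYPE('d) (\<Sum>u<m. hit_kernel u (e 1 :: int ^ 'd)) k l"
proof -
  let ?q = "\<Sum>u<m. hit_kernel u (e 1 :: int ^ 'd)"
  let ?W = "excursion_weight TYPE('d) ?q"
  let ?x = "e 1 :: int ^ 'd"
  let ?c = "esc_prob TYPE('d)"
  have "pattern_prob r k l s ?x \<ge> ?c * ?W k l"
    using \<open>s \<ge> m * l\<close>
  proof (induction l arbitrary: k s)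
    case 0
    show ?case
    proof (cases k)
      case k: 0
      have "avoid_prob (s + r) ?x \<le> pattern_prob r 0 0 s ?x"
        unfolding pattern_prob_def pavg_avoid[symmetric]
      proof (rule pavg_mono)
        fix w :: "(int ^ 'd) list"
        have v: "visits A y u \<le> visits (insert 0 unit_sphere) y u" if "A \<subseteq> insert 0 unit_sphere" for A y and u :: "(int ^ 'd) list"
        proof (induction u arbitrary: y)
          case (Cons a u)
          have "y + a \<in> A \<Longrightarrow> y + a \<in> insert 0 unit_sphere" using that by blast
          then show ?case using Cons[of "y + a"] by (simp del: insert_iff)
        qed simp
        have "excursion_pattern 0 0 s ?x w" if "visits (insert 0 unit_sphere) ?x w = 0"
        proof -
          have "visits unit_sphere ?x (take s w @ drop s w) = 0" "visits {0} ?x w = 0"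
            using v[of unit_sphere ?x w] v[of "{0}" ?x w] that by auto
          then show ?thesis unfolding visits_append excursion_pattern_def by simp
        qed
        then show "of_bool (visits (insert 0 unit_sphere) ?x w = 0) \<le> (of_bool (excursion_pattern 0 0 s ?x w) :: real)"
          by simp
      qed
      moreover have "avoid_prob (s + r) ?x \<ge> ?c"
        using \<open>r > 0\<close> by (intro avoid_prob_ge) auto
      ultimately show ?thesis by (simp add: k excursion_weight_def)
    qed (simp add: excursion_weight_def pattern_prob_nonneg)
  next
    case (Suc l)
    have s: "s \<ge> m + m * l" using Suc.prems by simp
    have "?q * (?c * ?W k l) = (\<Sum>u<m. hit_kernel u ?x * (?c * ?W k l))"
      by (rule sum_distrib_right)
    also have "\<dots> \<le> (\<Sum>u<m. hit_kernel u ?x * pattern_prob r k l (s - Suc u) ?x)"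
      using s by (intro sum_mono mult_left_mono Suc.IH hit_kernel_nonneg) auto
    also have "\<dots> \<le> (\<Sum>u<s. hit_kernel u ?x * pattern_prob r k l (s - Suc u) ?x)"
      using s by (intro sum_mono2) (auto intro!: mult_nonneg_nonneg hit_kernel_nonneg pattern_prob_nonneg)
    finally have 1: "?q * (?c * ?W k l) \<le> \<dots>" .
    have "m * l \<le> s - 2" "s \<ge> 2" using s \<open>m \<ge> 2\<close> by auto
    then have 2: "(if k > 0 then ?c * ?W (k - 1) l / (2 * real CARD('d)) else 0) \<le>
       (if s \<ge> 2 \<and> k > 0 then pattern_prob r (k - 1) l (s - 2) ?x / (2 * real CARD('d)) else 0)"
      using Suc.IH[of "s - 2" "k - 1"] by (auto intro: divide_right_mono)
    have "?c * ?W k (Suc l) = ?q * (?c * ?W k l) + (if k > 0 then ?c * ?W (k - 1) l / (2 * real CARD('d)) else 0)"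
      unfolding excursion_weight_Suc by (simp add: algebra_simps)
    also have "\<dots> \<le> pattern_prob r k (Suc l) s ?x"
      unfolding pattern_prob_renewal[of r k l s, where 'd = 'd] using 1 2 by (rule add_mono)
    finally show ?case .
  qed
  then show ?thesis using pattern_prob_sym[OF assms(1) e1_mem_sphere] by simp
qed

subsection \<open>The rate function\<close>

definition rate :: "nat \<Rightarrow> real \<Rightarrow> real \<Rightarrow> real \<Rightarrow> real"
  where "rate d p x y = - y * ln y + x * ln (2 * real d * x) + (y - x) * ln ((y - x) / p)"

text \<open>The terms with \<open>ln c\<close> have coefficients \<open>- y\<close>,
  \<open>x\<close> and \<open>y - x\<close>, which cancel.\<close>

lemma rate_scale:
  assumes "c > 0" "d > 0" "p > 0" "0 \<le> x" "x \<le> y"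
  shows "rate d p (c * x) (c * y) = c * rate d p x y"
proof -
  have 1: "(c * z) * ln (c * z) = c * (z * ln z) + c * z * ln c" if "z \<ge> 0" for z
    using that assms by (cases "z = 0") (auto simp: ln_mult algebra_simps)
  have 2: "(c * x) * ln (2 * real d * (c * x)) = c * (x * ln (2 * real d * x)) + c * x * ln c"
    using assms by (cases "x = 0") (auto simp: ln_mult algebra_simps)
  have 3: "(c * z) * ln (c * z / p) = c * (z * ln (z / p)) + c * z * ln c" if "z \<ge> 0" for z
    using that assms by (cases "z = 0") (auto simp: ln_mult ln_div algebra_simps)
  show ?thesis
    using 1[of y] 2 3[of "y - x"] assms unfolding rate_def
    by (simp add: right_diff_distrib[symmetric]) (simp add: algebra_simps)
qed

text \<open>Homogeneity turns the scaling of the region into a change of level, so that membership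
  becomes a bound on \<open>rate\<close> at the unscaled integers.\<close>

lemma mem_dilate_iff:
  assumes "c > 0" "d > 0" "p > 0"
  shows "(x, y) \<in> dilate c (joint_region d p) \<longleftrightarrow> 0 \<le> x \<and> x \<le> y \<and> rate d p x y \<le> c"
proof
  assume "(x, y) \<in> dilate c (joint_region d p)"
  then obtain x' y' where xy: "x = c * x'" "y = c * y'" "y' \<ge> x'" "x' \<ge> 0" "rate d p x' y' \<le> 1"
    by (auto simp: dilate_def joint_region_def rate_def)
  then show "0 \<le> x \<and> x \<le> y \<and> rate d p x y \<le> c"
    using assms rate_scale[of c d p x' y'] by simp
next
  assume *: "0 \<le> x \<and> x \<le> y \<and> rate d p x y \<le> c"
  have "rate d p (c * (x / c)) (c * (y / c)) = c * rate d p (x / c) (y / c)"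
    using assms * by (intro rate_scale) (auto intro: divide_right_mono)
  then have "rate d p (x / c) (y / c) \<le> 1"
    using * assms by (simp add: field_simps)
  then have "(x / c, y / c) \<in> joint_region d p"
    using * assms by (auto simp: joint_region_def rate_def intro: divide_right_mono)
  then show "(x, y) \<in> dilate c (joint_region d p)"
    unfolding dilate_def using assms by (intro CollectI exI[of _ "x / c"] exI[of _ "y / c"]) simp
qed

text \<open>Serves \<epsilon> \<ge> 1, where \<open>(1 - \<epsilon>) * ln n\<close> is not positive
  and the dilated region lies in the closed negative quadrant.\<close>

lemma mem_dilate_nonpos:
  assumes "c \<le> 0" "(real k, real l) \<in> dilate c (joint_region d p)"
  shows "k = 0 \<and> l = 0"
proof -
  from assms(2) obtain x y where xy: "real k = c * x" "real l = c * y" "y \<ge> x" "x \<ge> 0"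
    by (auto simp: dilate_def joint_region_def)
  then have "c * x \<le> 0" "c * y \<le> 0" using assms(1) by (auto intro: mult_nonpos_nonneg)
  then show ?thesis using xy by simp
qed

text \<open>This is the excursion weight with \<open>l choose k\<close> replaced by its entropy
  form; \<open>0 ^ 0 = 1\<close> agrees with \<open>0 * ln 0 = 0\<close>.\<close>

lemma exp_minus_rate:
  assumes "k \<le> l" "d > 0" "p > 0"
  shows "exp (- rate d p (real k) (real l)) =
    real l ^ l / (real k ^ k * real (l - k) ^ (l - k)) * (1 / (2 * real d)) ^ k * p ^ (l - k)"
proof -
  have pw: "exp (real n * ln (real n)) = real n ^ n" for n
    by (cases "n = 0") (simp_all add: exp_of_nat_mult)
  have 1: "exp (real k * ln (2 * real d * real k)) = (2 * real d) ^ k * real k ^ k"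
    using assms by (cases "k = 0") (simp_all add: exp_of_nat_mult power_mult_distrib)
  have 2: "exp (real n * ln (real n / p)) = real n ^ n / p ^ n" for n
    using assms by (cases "n = 0") (simp_all add: exp_of_nat_mult power_divide)
  have "- rate d p (real k) (real l) = real l * ln (real l) - real k * ln (2 * real d * real k)
      - real (l - k) * ln (real (l - k) / p)"
    using assms by (simp add: rate_def of_nat_diff)
  then show ?thesis
    by (simp only: exp_diff pw 1 2) (simp add: power_divide)
qed

section \<open>Elementary Stirling bounds\<close>

lemma binomial_upper:
  assumes "k \<le> l"
  shows "real (l choose k) \<le> real l ^ l / (real k ^ k * real (l - k) ^ (l - k))"
proof -
  have pos: "real n ^ n > 0" for n by (cases "n = 0") auto
  \<comment> \<open>A single term of the binomial expansion of
    \<open>(k + (l - k)) ^ l\<close>.\<close>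
  have "real (l choose k) * real k ^ k * real (l - k) ^ (l - k) \<le>
      (\<Sum>i\<le>l. real (l choose i) * real k ^ i * real (l - k) ^ (l - i))"
    using assms by (intro member_le_sum[where f = "\<lambda>i. real (l choose i) * real k ^ i * real (l - k) ^ (l - i)"]) auto
  also have "\<dots> = (real k + real (l - k)) ^ l" by (simp add: binomial_ring)
  also have "real k + real (l - k) = real l" using assms by simp
  finally show ?thesis
    using pos[of k] pos[of "l - k"] by (simp add: pos_le_divide_eq mult.assoc)
qed

lemma fact_lower: "real n ^ n \<le> exp (real n) * fact n"
proof (induction n)
  case (Suc n)
  show ?case
  proof (cases "n = 0")
    case False
    have "real (Suc n) ^ Suc n = real (Suc n) * ((1 + 1 / real n) ^ n * real n ^ n)"
      using False by (simp add: power_mult_distrib[symmetric] field_simps)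
    also have "\<dots> \<le> real (Suc n) * (exp 1 * (exp (real n) * fact n))"
      using exp_ge_one_plus_x_over_n_power_n[of n 1] False Suc
      by (intro mult_left_mono mult_mono) auto
    also have "\<dots> = exp (real (Suc n)) * fact (Suc n)"
      by (simp add: exp_add algebra_simps)
    finally show ?thesis .
  qed (use exp_ge_add_one_self[of 1] in auto)
qed simp

text \<open>Stirling up to a factor linear in \<open>n\<close>, from
  \<open>(1 - 1 / (n + 1)) ^ (n + 1) \<le> exp (- 1)\<close>.\<close>

lemma fact_upper: "n > 0 \<Longrightarrow> fact n * exp (real n) \<le> exp 1 * real n * real n ^ n"
proof (induction n rule: nat_induct_non_zero)
  case (Suc n)
  have "(1 - 1 / real (Suc n)) ^ Suc n \<le> exp (- 1)"
    by (rule exp_ge_one_minus_x_over_n_power_n[of 1 "Suc n"]) auto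
  moreover have "1 - 1 / real (Suc n) = real n / real (Suc n)" by (simp add: field_simps)
  ultimately have "real n ^ Suc n / real (Suc n) ^ Suc n \<le> exp (- 1)"
    by (simp only: power_divide)
  then have "exp 1 * (real n ^ Suc n / real (Suc n) ^ Suc n) \<le> exp 1 * exp (- 1)"
    by (intro mult_left_mono) auto
  then have *: "exp 1 * real n ^ Suc n \<le> real (Suc n) ^ Suc n"
    by (simp add: mult_exp_exp divide_le_eq del: power_Suc)
  have "fact (Suc n) * exp (real (Suc n)) = real (Suc n) * exp 1 * (fact n * exp (real n))"
    by (simp add: exp_add algebra_simps)
  also have "\<dots> \<le> real (Suc n) * exp 1 * (exp 1 * real n * real n ^ n)"
    using Suc by (intro mult_left_mono) auto
  also have "\<dots> = exp 1 * real (Suc n) * (exp 1 * real n ^ Suc n)"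
    by simp
  also have "\<dots> \<le> exp 1 * real (Suc n) * real (Suc n) ^ Suc n"
    using * by (intro mult_left_mono) auto
  finally show ?case .
qed simp

text \<open>A prefactor that depends only on the bound \<open>N\<close> and also covers
  \<open>n = 0\<close>.\<close>

lemma fact_upper_le:
  assumes "n \<le> N"
  shows "fact n * exp (real n) \<le> exp 1 * (real N + 1) * real n ^ n"
proof (cases "n = 0")
  case False
  then have "fact n * exp (real n) \<le> exp 1 * real n * real n ^ n"
    using fact_upper[of n] by simp
  also have "\<dots> \<le> exp 1 * (real N + 1) * real n ^ n"
    using assms by (intro mult_right_mono mult_left_mono) auto
  finally show ?thesis .
next
  case True
  have "1 * 1 \<le> exp 1 * (real N + 1)"
    by (intro mult_mono) auto
  then show ?thesis using True by simp
qed

text \<open>The exponentials in the factorial bounds cancel and leave a polynomial loss, which is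
  harmless against the slack \<epsilon> in the exponent.\<close>

lemma binomial_lower:
  assumes "k \<le> l"
  shows "real l ^ l / (real k ^ k * real (l - k) ^ (l - k)) \<le> exp 2 * (real l + 1)\<^sup>2 * real (l choose k)"
proof -
  have pos: "real n ^ n > 0" for n by (cases "n = 0") auto
  let ?m = "l - k"
  have "fact k * exp (real k) * (fact ?m * exp (real ?m)) \<le>
      (exp 1 * (real l + 1) * real k ^ k) * (exp 1 * (real l + 1) * real ?m ^ ?m)"
    using assms by (intro mult_mono[OF fact_upper_le fact_upper_le]) auto
  also have "\<dots> = exp 2 * (real l + 1)\<^sup>2 * (real k ^ k * real ?m ^ ?m)"
    using exp_add[of "1::real" 1] by (simp add: power2_eq_square algebra_simps)
  finally have 1: "fact k * exp (real k) * (fact ?m * exp (real ?m)) \<le> \<dots>" .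
  have "exp (real k) * exp (real ?m) = exp (real l)"
    using assms by (simp add: of_nat_diff flip: exp_add)
  then have 2: "fact k * exp (real k) * (fact ?m * exp (real ?m)) = exp (real l) * (fact k * fact ?m)"
    by (simp add: algebra_simps)
  have "real l ^ l \<le> exp (real l) * fact l" by (rule fact_lower)
  also have "fact l = real (l choose k) * (fact k * fact ?m)"
    using binomial_fact_lemma[OF assms] by (metis (no_types) mult.commute of_nat_fact of_nat_mult)
  also have "exp (real l) * \<dots> = real (l choose k) * (exp (real l) * (fact k * fact ?m))" by simp
  also have "\<dots> \<le> real (l choose k) * (exp 2 * (real l + 1)\<^sup>2 * (real k ^ k * real ?m ^ ?m))"
    using 1 unfolding 2 by (intro mult_left_mono) auto
  finally show ?thesis
    using pos[of k] pos[of ?m] by (simp add: divide_le_eq algebra_simps)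
qed

lemma excursion_weight_nonneg: "q \<ge> 0 \<Longrightarrow> excursion_weight T q k l \<ge> 0"
  by (simp add: excursion_weight_def)

lemma excursion_weight_eq_0: "k > l \<Longrightarrow> excursion_weight T q k l = 0"
  by (simp add: excursion_weight_def binomial_eq_0)

lemma excursion_weight_le_exp:
  assumes "k \<le> l" "q > 0"
  shows "excursion_weight TYPE('d::finite) q k l \<le> exp (- rate CARD('d) q (real k) (real l))"
  unfolding exp_minus_rate[OF assms(1) zero_less_card_finite assms(2)] excursion_weight_def
  using assms by (intro mult_right_mono binomial_upper) auto

lemma excursion_weight_ge_exp:
  assumes "k \<le> l" "q > 0"
  shows "exp (- rate CARD('d) q (real k) (real l)) \<le>
    exp 2 * (real l + 1)\<^sup>2 * excursion_weight TYPE('d::finite) q k l"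
proof -
  let ?c = "(1 / (2 * real CARD('d))) ^ k * q ^ (l - k)"
  have "exp (- rate CARD('d) q (real k) (real l)) = real l ^ l / (real k ^ k * real (l - k) ^ (l - k)) * ?c"
    unfolding exp_minus_rate[OF assms(1) zero_less_card_finite assms(2)] by (simp only: mult.assoc)
  also have "\<dots> \<le> exp 2 * (real l + 1)\<^sup>2 * real (l choose k) * ?c"
    using assms by (intro mult_right_mono binomial_lower) auto
  finally show ?thesis by (simp only: excursion_weight_def mult.assoc)
qed

text \<open>One term of a binomial expansion. With the return probability for \<open>q\<close> the
  base is \<open>1 - esc_prob\<close>, so the decay in \<open>l\<close> is geometric, uniformly in
  \<open>k\<close>.\<close>

lemma excursion_weight_le_power:
  assumes "q \<ge> 0"
  shows "excursion_weight TYPE('d::finite) q k l \<le> (q + 1 / (2 * real CARD('d))) ^ l"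
proof (cases "k \<le> l")
  case True
  let ?a = "1 / (2 * real CARD('d))"
  have "excursion_weight TYPE('d) q k l \<le> (\<Sum>i\<le>l. real (l choose i) * ?a ^ i * q ^ (l - i))"
    unfolding excursion_weight_def using True assms
    by (intro member_le_sum[where f = "\<lambda>i. real (l choose i) * ?a ^ i * q ^ (l - i)"]) auto
  also have "\<dots> = (?a + q) ^ l" by (simp only: binomial_ring)
  finally show ?thesis by (simp only: add.commute)
next
  case False
  then show ?thesis using assms by (simp add: excursion_weight_eq_0)
qed

text \<open>Gibbs' inequality: with \<open>r\<close> the argument of the logarithm,
  \<open>rate\<close> plus \<open>y * ln r\<close> is \<open>y\<close> times a relative entropy. For
  \<open>r < 1\<close> it bounds the sublevel sets, so that only \<open>l\<close> of order
  \<open>log n\<close> matter.\<close>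

lemma rate_ge:
  assumes "0 \<le> x" "x \<le> y" "q > 0" "d > 0"
  shows "rate d q x y \<ge> - y * ln (q + 1 / (2 * real d))"
proof (cases "y = 0")
  case True
  then show ?thesis using assms by (simp add: rate_def)
next
  case False
  then have y: "y > 0" using assms by simp
  define r where "r = q + 1 / (2 * real d)"
  have r: "r > 0" unfolding r_def using assms by (simp add: add_pos_nonneg)
  have gibbs: "z * (ln y + ln b - ln z - ln r) \<le> y * b / r - z" if "z \<ge> 0" "b > 0" for z b
  proof (cases "z = 0")
    case True
    then show ?thesis using that y r by simp
  next
    case False
    then have z: "z > 0" using that by simp
    have "ln y + ln b - ln z - ln r = ln (y * b / (z * r))"
      using y z r that by (simp add: ln_mult ln_div)
    also have "\<dots> \<le> y * b / (z * r) - 1"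
      using y z r that by (intro ln_le_minus_one) auto
    finally have "z * (ln y + ln b - ln z - ln r) \<le> z * (y * b / (z * r) - 1)"
      using z by (intro mult_left_mono) auto
    also have "\<dots> = y * b / r - z" using z by (simp add: right_diff_distrib)
    finally show ?thesis .
  qed
  have 1: "x * ln (2 * real d * x) = x * (ln x - ln (1 / (2 * real d)))"
    using assms by (cases "x = 0") (auto simp: ln_mult ln_div)
  have 2: "(y - x) * ln ((y - x) / q) = (y - x) * (ln (y - x) - ln q)"
    using assms by (cases "x = y") (auto simp: ln_div)
  have "- rate d q x y - y * ln r = x * (ln y + ln (1 / (2 * real d)) - ln x - ln r)
      + (y - x) * (ln y + ln q - ln (y - x) - ln r)"
    unfolding rate_def 1 2 by (simp add: algebra_simps)
  also have "\<dots> \<le> (y * (1 / (2 * real d)) / r - x) + (y * q / r - (y - x))"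
    using assms by (intro add_mono gibbs) auto
  also have "\<dots> = y * r / r - y"
    unfolding r_def by (simp add: add_divide_distrib distrib_left)
  also have "\<dots> = 0" using r by simp
  finally show ?thesis by (simp add: r_def)
qed

subsection \<open>The walk and its steps\<close>

lemma sphere_first_iff:
  "sphere_first x l \<longleftrightarrow> (\<exists>u\<in>{1..length l}. x + sum_list (take u l) \<in> unit_sphere \<and>
     (\<forall>i\<in>{1..u}. x + sum_list (take i l) \<noteq> 0))"
proof (induction l arbitrary: x)
  case (Cons v l)
  let ?P = "\<lambda>x l u. x + sum_list (take u l) \<in> unit_sphere \<and> (\<forall>i\<in>{1..u}. x + sum_list (take i l) \<noteq> 0)"
  have 1: "?P x (v # l) 1 \<longleftrightarrow> x + v \<in> unit_sphere" by auto
  have set_eq: "{1..Suc u} = insert 1 (Suc ` {1..u})" for u by (auto simp: image_Suc_atLeastAtMost)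
  have 2: "?P x (v # l) (Suc u) \<longleftrightarrow> x + v \<noteq> 0 \<and> ?P (x + v) l u" for u
    unfolding set_eq ball_simps by (simp add: add.assoc del: image_Suc_atLeastAtMost) blast
  have ex: "(\<exists>u\<in>{1..Suc n}. Q u) \<longleftrightarrow> Q 1 \<or> (\<exists>u\<in>{1..n}. Q (Suc u))" for Q n
    unfolding set_eq by blast
  have len: "length (v # l) = Suc (length l)" by simp
  have "(\<exists>u\<in>{1..length (v # l)}. ?P x (v # l) u) \<longleftrightarrow> ?P x (v # l) 1 \<or> (\<exists>u\<in>{1..length l}. ?P x (v # l) (Suc u))"
    unfolding len by (rule ex)
  also have "\<dots> \<longleftrightarrow> x + v \<in> unit_sphere \<or> x + v \<noteq> 0 \<and> (\<exists>u\<in>{1..length l}. ?P (x + v) l u)"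
    unfolding 2 using 1 by blast
  finally show ?case using Cons[of "x + v"] by (simp only: sphere_first.simps)
qed simp

text \<open>This removes the extended naturals. Nothing is asked after time \<open>u\<close>, so the
  case that \<open>B\<close> is never hit is included.\<close>

lemma hit_time_less_iff:
  "hit_time A s < hit_time B s \<longleftrightarrow> (\<exists>u\<ge>1. s u \<in> A \<and> (\<forall>i\<in>{1..u}. s i \<notin> B))"
proof
  assume "hit_time A s < hit_time B s"
  then obtain u where u: "u \<ge> 1" "s u \<in> A" "enat u < hit_time B s"
    by (auto simp: hit_time_def Inf_less_iff)
  have "s i \<notin> B" if "i \<in> {1..u}" for i
  proof
    assume "s i \<in> B"
    then have "hit_time B s \<le> enat i" unfolding hit_time_def using that by (intro Inf_lower) auto
    then show False using u(3) that by (auto simp: not_le[symmetric] elim!: notE order_trans)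
  qed
  then show "\<exists>u\<ge>1. s u \<in> A \<and> (\<forall>i\<in>{1..u}. s i \<notin> B)" using u by blast
next
  assume "\<exists>u\<ge>1. s u \<in> A \<and> (\<forall>i\<in>{1..u}. s i \<notin> B)"
  then obtain u where u: "u \<ge> 1" "s u \<in> A" "\<forall>i\<in>{1..u}. s i \<notin> B" by blast
  have "hit_time A s \<le> enat u" unfolding hit_time_def using u by (intro Inf_lower) auto
  also have "enat u < enat (Suc u)" by simp
  also have "\<dots> \<le> hit_time B s"
    unfolding hit_time_def using u(3) by (intro Inf_greatest) (auto simp: not_less_eq_eq)
  finally show "hit_time A s < hit_time B s" .
qed

context simple_random_walk
begin

definition steps :: "nat \<Rightarrow> nat \<Rightarrow> 'a \<Rightarrow> (int ^ 'd) list"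
  where "steps j t \<omega> = map (\<lambda>k. X k \<omega>) [Suc j..<Suc (j + t)]"

lemma length_steps [simp]: "length (steps j t \<omega>) = t"
  by (simp add: steps_def)

lemma steps_0 [simp]: "steps j 0 \<omega> = []"
  by (simp add: steps_def)

lemma steps_append: "steps j (s + t) \<omega> = steps j s \<omega> @ steps (j + s) t \<omega>"
proof -
  have "[Suc j..<Suc j + (s + t)] = [Suc j..<Suc j + s] @ [Suc j + s..<Suc j + s + t]"
    using upt_add_eq_append[of "Suc j" "Suc j + s" t] by (simp add: add.assoc)
  then show ?thesis by (simp add: steps_def add.assoc)
qed

lemma take_steps: "s \<le> t \<Longrightarrow> take s (steps j t \<omega>) = steps j s \<omega>"
  using steps_append[of j s "t - s" \<omega>] by simp

lemma drop_steps: "s \<le> t \<Longrightarrow> drop s (steps j t \<omega>) = steps (j + s) (t - s) \<omega>"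
  using steps_append[of j s "t - s" \<omega>] by simp

lemma sum_list_steps: "sum_list (steps j t \<omega>) = walk X \<omega> (j + t) - walk X \<omega> j"
proof (induction t)
  case (Suc t)
  have "steps j (Suc t) \<omega> = steps j t \<omega> @ [X (Suc (j + t)) \<omega>]"
    by (simp add: steps_def)
  then show ?case using Suc by (simp add: walk_def)
qed simp

lemma visits_steps:
  "visits A x (steps j t \<omega>) = card {i \<in> {1..t}. x + (walk X \<omega> (j + i) - walk X \<omega> j) \<in> A}"
  unfolding visits_eq_card by (intro arg_cong[where f = card]) (auto simp: take_steps sum_list_steps)

lemma random_variable_X: "k \<ge> 1 \<Longrightarrow> X k \<in> M \<rightarrow>\<^sub>M count_space UNIV"
  using indep_steps by (auto simp: indep_vars_def)

lemma steps_measurable [measurable]: "steps j t \<in> M \<rightarrow>\<^sub>M count_space UNIV"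
proof (induction t)
  case 0
  then show ?case by (simp add: measurable_const cong: measurable_cong)
next
  case (Suc t)
  have X: "X (Suc (j + t)) \<in> M \<rightarrow>\<^sub>M count_space UNIV" by (rule random_variable_X) simp
  have "count_space UNIV \<Otimes>\<^sub>M count_space UNIV = (count_space UNIV :: ((int ^ 'd) list \<times> (int ^ 'd)) measure)"
    by (simp add: pair_measure_countable)
  then have "(\<lambda>\<omega>. (steps j t \<omega>, X (Suc (j + t)) \<omega>)) \<in> M \<rightarrow>\<^sub>M count_space UNIV"
    using measurable_Pair[OF Suc X] by simp
  then have "(\<lambda>\<omega>. (\<lambda>(u, v). u @ [v]) (steps j t \<omega>, X (Suc (j + t)) \<omega>)) \<in> M \<rightarrow>\<^sub>M count_space UNIV"
    by (rule measurable_compose) simp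
  moreover have "steps j (Suc t) = (\<lambda>\<omega>. (\<lambda>(u, v). u @ [v]) (steps j t \<omega>, X (Suc (j + t)) \<omega>))"
    by (auto simp: steps_def)
  ultimately show ?case by simp
qed

lemma event_steps [measurable]: "{\<omega> \<in> space M. A (steps j t \<omega>)} \<in> events"
proof -
  have "{\<omega> \<in> space M. A (steps j t \<omega>)} = steps j t -` Collect A \<inter> space M" by auto
  then show ?thesis using measurable_sets[OF steps_measurable, of "Collect A"] by simp
qed

lemma prob_X_eq:
  assumes "k \<ge> 1" "v \<in> unit_sphere"
  shows "prob {\<omega> \<in> space M. X k \<omega> = v} = 1 / (2 * real CARD('d))"
  using assms step_law[of k] by (auto simp: unit_sphere_eq)

lemma prob_steps_eq:
  assumes "set l \<subseteq> unit_sphere" "length l = t"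
  shows "prob {\<omega> \<in> space M. steps j t \<omega> = l} = (1 / (2 * real CARD('d))) ^ t"
proof (cases "t = 0")
  case True
  then show ?thesis using assms prob_space by simp
next
  case False
  let ?J = "{Suc j..<Suc (j + t)}"
  have "steps j t \<omega> = l \<longleftrightarrow> (\<forall>k\<in>?J. X k \<omega> = l ! (k - Suc j))" for \<omega>
  proof
    assume "steps j t \<omega> = l"
    then show "\<forall>k\<in>?J. X k \<omega> = l ! (k - Suc j)" by (auto simp: steps_def simp del: upt_Suc)
  next
    assume *: "\<forall>k\<in>?J. X k \<omega> = l ! (k - Suc j)"
    show "steps j t \<omega> = l"
      by (rule nth_equalityI) (use * assms in \<open>auto simp: steps_def simp del: upt_Suc\<close>)
  qed
  then have "{\<omega> \<in> space M. steps j t \<omega> = l} = (\<Inter>k\<in>?J. X k -` {l ! (k - Suc j)} \<inter> space M)"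
    using False by auto
  also have "prob \<dots> = (\<Prod>k\<in>?J. prob (X k -` {l ! (k - Suc j)} \<inter> space M))"
    using False by (intro indep_varsD[OF indep_steps]) auto
  also have "\<dots> = (\<Prod>k\<in>?J. 1 / (2 * real CARD('d)))"
  proof (rule prod.cong)
    fix k assume k: "k \<in> ?J"
    have "X k -` {l ! (k - Suc j)} \<inter> space M = {\<omega> \<in> space M. X k \<omega> = l ! (k - Suc j)}" by auto
    moreover have "l ! (k - Suc j) \<in> unit_sphere"
      using k assms by (intro subsetD[OF assms(1)] nth_mem) auto
    ultimately show "prob (X k -` {l ! (k - Suc j)} \<inter> space M) = 1 / (2 * real CARD('d))"
      using prob_X_eq[of k] k by auto
  qed simp
  finally show ?thesis by simp
qed

text \<open>The \<open>(2 d) ^ t\<close> step lists are equally likely and their probabilities add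
  up to 1, so anything else the steps might do is negligible. The offset \<open>j\<close> disappears
  by stationarity.\<close>

lemma prob_steps:
  "prob {\<omega> \<in> space M. A (steps j t \<omega>)} = pavg t (\<lambda>l. of_bool (A l))"
proof -
  let ?a = "(1 / (2 * real CARD('d))) ^ t"
  have fin: "prob {\<omega> \<in> space M. steps j t \<omega> \<in> B} = card B * ?a" if "B \<subseteq> step_lists t" for B :: "(int ^ 'd) list set"
  proof -
    have "finite B" using finite_subset[OF that] by simp
    have "{\<omega> \<in> space M. steps j t \<omega> \<in> B} = (\<Union>l\<in>B. {\<omega> \<in> space M. steps j t \<omega> = l})" by auto
    also have "prob \<dots> = (\<Sum>l\<in>B. prob {\<omega> \<in> space M. steps j t \<omega> = l})"
      by (rule finite_measure_finite_Union[OF \<open>finite B\<close>]) (auto simp: disjoint_family_on_def)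
    also have "\<dots> = (\<Sum>l\<in>B. ?a)"
      using that by (intro sum.cong prob_steps_eq) (auto simp: step_lists_def)
    finally show ?thesis by simp
  qed
  have "prob {\<omega> \<in> space M. steps j t \<omega> \<in> step_lists t} = 1"
    unfolding fin[OF order_refl] by (simp add: card_step_lists power_one_over)
  then have "AE \<omega> in M. steps j t \<omega> \<in> step_lists t"
    by (subst (asm) prob_Collect_eq_1) simp_all
  then have "prob {\<omega> \<in> space M. A (steps j t \<omega>)} = prob {\<omega> \<in> space M. steps j t \<omega> \<in> {l \<in> step_lists t. A l}}"
    by (intro finite_measure_eq_AE) auto
  also have "\<dots> = card {l \<in> step_lists t. A l} * ?a"
    by (rule fin) auto
  also have "real (card {l \<in> step_lists t. A l}) = (\<Sum>l\<in>step_lists t. of_bool (A l))"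
    by (simp add: of_bool_def sum.If_cases Int_def)
  finally show ?thesis
    by (simp add: pavg_def power_one_over field_simps)
qed

lemma AE_steps_sphere: "AE \<omega> in M. \<forall>j t. set (steps j t \<omega>) \<subseteq> unit_sphere"
  unfolding AE_all_countable
proof (intro allI)
  fix j t
  have "prob {\<omega> \<in> space M. set (steps j t \<omega>) \<subseteq> unit_sphere} = 1"
    unfolding prob_steps[of "\<lambda>l. set l \<subseteq> unit_sphere"] by (subst pavg_cong[where f' = "\<lambda>_. 1"]) auto
  then show "AE \<omega> in M. set (steps j t \<omega>) \<subseteq> unit_sphere"
    by (subst (asm) prob_Collect_eq_1) simp_all
qed

text \<open>Continuity from below: the finite-horizon events increase to the event defining
  \<open>p\<close>, and their probabilities are the partial sums of
  \<open>hit_kernel\<close>.\<close>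

lemma sphere_return_prob_eq: "sphere_return_prob M X = ret_prob TYPE('d)"
proof -
  let ?x = "e 1 :: int ^ 'd"
  let ?N = "\<Pi>\<^sub>M n\<in>(UNIV :: nat set). (count_space UNIV :: (int ^ 'd) measure)"
  let ?S = "{s. hit_time unit_sphere s < hit_time {0} s} :: (nat \<Rightarrow> int ^ 'd) set"
  have walk_steps: "walk X \<omega> n = sum_list (steps 0 n \<omega>)" for \<omega> n
    by (simp add: sum_list_steps) (simp add: walk_def)
  have meas: "(\<lambda>\<omega> n. ?x + walk X \<omega> n) \<in> M \<rightarrow>\<^sub>M ?N"
  proof (rule measurable_PiM_single')
    fix n
    have "(\<lambda>\<omega>. (\<lambda>l. ?x + sum_list l) (steps 0 n \<omega>)) \<in> M \<rightarrow>\<^sub>M count_space UNIV"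
      by (rule measurable_compose[OF steps_measurable]) simp
    then show "(\<lambda>\<omega>. ?x + walk X \<omega> n) \<in> M \<rightarrow>\<^sub>M count_space UNIV"
      by (simp add: walk_steps)
  qed (auto simp: space_PiM)
  have "?S = {s \<in> space ?N. \<exists>u\<in>{1..}. s u \<in> unit_sphere \<and> (\<forall>i\<in>{1..u}. s i \<notin> {0})}"
    unfolding hit_time_less_iff by (auto simp: space_PiM)
  also have "\<dots> \<in> sets ?N" by measurable
  finally have S: "?S \<in> sets ?N" .
  have "sphere_return_prob M X = prob ((\<lambda>\<omega> n. ?x + walk X \<omega> n) -` ?S \<inter> space M)"
    unfolding sphere_return_prob_def walk_law_def by (rule measure_distr[OF meas S])
  also have "(\<lambda>\<omega> n. ?x + walk X \<omega> n) -` ?S \<inter> space M = (\<Union>t. {\<omega> \<in> space M. sphere_first ?x (steps 0 t \<omega>)})"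
  proof -
    have "sphere_first ?x (steps 0 t \<omega>) \<longleftrightarrow> (\<exists>u\<in>{1..t}. ?x + walk X \<omega> u \<in> unit_sphere \<and>
       (\<forall>i\<in>{1..u}. ?x + walk X \<omega> i \<noteq> 0))" for t \<omega>
      unfolding sphere_first_iff walk_steps by (auto simp: take_steps)
    then have "hit_time unit_sphere (\<lambda>n. ?x + walk X \<omega> n) < hit_time {0} (\<lambda>n. ?x + walk X \<omega> n) \<longleftrightarrow>
        (\<exists>t. sphere_first ?x (steps 0 t \<omega>))" for \<omega>
      unfolding hit_time_less_iff by fastforce
    then show ?thesis by auto
  qed
  finally have eq: "sphere_return_prob M X = prob (\<Union>t. {\<omega> \<in> space M. sphere_first ?x (steps 0 t \<omega>)})" .
  have "incseq (\<lambda>t. {\<omega> \<in> space M. sphere_first ?x (steps 0 t \<omega>)})"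
  proof (rule incseq_SucI)
    have "sphere_first x l \<Longrightarrow> sphere_first x (l @ m)" for x and l m :: "(int ^ 'd) list"
      by (induction l arbitrary: x) auto
    then show "{\<omega> \<in> space M. sphere_first ?x (steps 0 t \<omega>)} \<subseteq> {\<omega> \<in> space M. sphere_first ?x (steps 0 (Suc t) \<omega>)}" for t
      using steps_append[of 0 t 1] by auto
  qed
  then have "(\<lambda>t. prob {\<omega> \<in> space M. sphere_first ?x (steps 0 t \<omega>)}) \<longlonglongrightarrow> sphere_return_prob M X"
    unfolding eq by (intro finite_Lim_measure_incseq) auto
  moreover have "(\<lambda>t. prob {\<omega> \<in> space M. sphere_first ?x (steps 0 t \<omega>)}) \<longlonglongrightarrow> ret_prob TYPE('d)"
    using hit_kernel_sums[where 'd = 'd] by (simp add: prob_steps pavg_sphere_first sums_def)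
  ultimately show ?thesis by (rule LIMSEQ_unique)
qed

text \<open>Borel-Cantelli, as the heat kernel is summable in time; the lattice is countable, so all
  sites are treated at once. It makes local times ordinary cardinalities.\<close>

lemma AE_finite_visits:
  assumes "CARD('d) \<ge> 3"
  shows "AE \<omega> in M. \<forall>z. finite {k. walk X \<omega> k = z}"
  unfolding AE_all_countable
proof
  fix z :: "int ^ 'd"
  let ?A = "\<lambda>k. {\<omega> \<in> space M. sum_list (steps 0 k \<omega>) = z}"
  have walk_steps: "walk X \<omega> n = sum_list (steps 0 n \<omega>)" for \<omega> n
    by (simp add: sum_list_steps) (simp add: walk_def)
  have "prob (?A k) \<le> heat_bound TYPE('d) k" for k
    unfolding prob_steps[of "\<lambda>l. sum_list l = z"] heat_bound_def by (rule heat_kernel_bound[OF assms])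
  moreover have "summable (heat_bound TYPE('d))"
    using summable_heat_bound[of 1, where 'd = 'd] by (simp add: summable_Suc_iff)
  ultimately have "summable (\<lambda>k. prob (?A k))"
    by (intro summable_comparison_test[of "\<lambda>k. prob (?A k)" "heat_bound TYPE('d)"]) auto
  then have "AE \<omega> in M. \<forall>\<^sub>F k in sequentially. \<omega> \<in> space M - ?A k"
    by (intro borel_cantelli_AE1) (auto simp: emeasure_eq_measure)
  then show "AE \<omega> in M. finite {k. walk X \<omega> k = z}"
  proof eventually_elim
    case (elim \<omega>)
    then obtain K where "\<forall>k\<ge>K. walk X \<omega> k \<noteq> z"
      unfolding eventually_sequentially walk_steps by auto
    then have "{k. walk X \<omega> k = z} \<subseteq> {..<K}" by (auto simp: not_le[symmetric])
    then show ?case by (rule finite_subset) simp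
  qed
qed

end

subsection \<open>The upper bound\<close>

lemma local_time_eq:
  assumes "finite {k. s k = z}"
  shows "local_time s z = enat (card {k. k > 0 \<and> s k = z})"
proof -
  have "finite {k. k > 0 \<and> s k = z}" by (rule finite_subset[OF _ assms]) auto
  then show ?thesis by (simp add: local_time_def)
qed

text \<open>The sites \<open>z + e i\<close> are pairwise distinct, so the sets of times counted by
  their local times are disjoint.\<close>

lemma occupation_time_eq:
  fixes z :: "int ^ 'd::finite"
  assumes fin: "\<And>z. finite {k. s k = z}"
  shows "occupation_time s z = enat (card {k. k > 0 \<and> s k - z \<in> unit_sphere})"
proof -
  let ?I = "{1..2 * CARD('d)}"
  have fin': "finite {k. k > 0 \<and> s k = y}" for y
    by (rule finite_subset[OF _ fin[of y]]) auto
  have "occupation_time s z = (\<Sum>i\<in>?I. enat (card {k. k > 0 \<and> s k = z + e i}))"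
    unfolding occupation_time_def using fin by (simp add: local_time_eq)
  also have "\<dots> = enat (\<Sum>i\<in>?I. card {k. k > 0 \<and> s k = z + e i})"
    by (simp flip: of_nat_eq_enat)
  also have "(\<Sum>i\<in>?I. card {k. k > 0 \<and> s k = z + e i}) = card (\<Union>i\<in>?I. {k. k > 0 \<and> s k = z + e i})"
  proof (rule card_UN_disjoint[symmetric])
    show "\<forall>i\<in>?I. \<forall>j\<in>?I. i \<noteq> j \<longrightarrow> {k. k > 0 \<and> s k = z + e i} \<inter> {k. k > 0 \<and> s k = z + e j} = {}"
    proof (intro ballI impI)
      fix i j assume "i \<in> ?I" "j \<in> ?I" "i \<noteq> j"
      then have "(e i :: int ^ 'd) \<noteq> e j" using inj_on_e[where 'd = 'd] by (blast dest: inj_onD)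
      then show "{k. k > 0 \<and> s k = z + e i} \<inter> {k. k > 0 \<and> s k = z + e j} = {}" by auto
    qed
  qed (use fin' in auto)
  also have "(\<Union>i\<in>?I. {k. k > 0 \<and> s k = z + e i}) = {k. k > 0 \<and> s k - z \<in> unit_sphere}"
    unfolding unit_sphere_eq by (auto simp: image_iff diff_eq_eq add.commute)
  finally show ?thesis .
qed

text \<open>Summability is needed in \<open>j\<close> and in \<open>l\<close>. The weight is a
  geometric mean of two bounds, \<open>j powr (- (1 + \<epsilon>))\<close> from the rate and
  geometric decay in \<open>l\<close>. The exponent \<theta> satisfies
  \<open>(1 + \<epsilon>) * \<theta> = 1 + \<epsilon> / 2\<close>, which still exceeds 1.\<close>

lemma weight_le_powr:
  assumes d3: "CARD('d::finite) \<ge> 3" and kl: "k \<le> l" and "j \<ge> 1" "\<epsilon> > 0"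
    and rate: "rate CARD('d) (ret_prob TYPE('d)) (real k) (real (Suc l)) > (1 + \<epsilon>) * ln (real j)"
  defines "\<theta> \<equiv> (1 + \<epsilon> / 2) / (1 + \<epsilon>)" and "p \<equiv> ret_prob TYPE('d)"
  shows "excursion_weight TYPE('d) p k l \<le>
    (1 / p) powr \<theta> * real j powr (- (1 + \<epsilon> / 2)) * ((p + 1 / (2 * real CARD('d))) powr (1 - \<theta>)) ^ l"
proof -
  let ?w = "excursion_weight TYPE('d) p"
  let ?r = "p + 1 / (2 * real CARD('d))"
  have p: "p > 0" unfolding p_def by (rule ret_prob_pos)
  have r: "?r > 0" using p by (simp add: add_pos_nonneg)
  have \<theta>: "0 < \<theta>" "\<theta> < 1" using \<open>\<epsilon> > 0\<close> by (auto simp: \<theta>_def)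
  have w0: "?w k l \<ge> 0" for k l using p by (intro excursion_weight_nonneg) simp
  \<comment> \<open>The rate is taken at \<open>Suc l\<close> because the visit at time
    \<open>j\<close> itself will be counted; this shift costs one factor \<open>p\<close>.\<close>
  have "p * ?w k l \<le> ?w k (Suc l)"
    unfolding excursion_weight_Suc using w0 by simp
  also have "\<dots> \<le> exp (- rate CARD('d) p (real k) (real (Suc l)))"
    using kl p by (intro excursion_weight_le_exp) auto
  also have "\<dots> \<le> exp (- ((1 + \<epsilon>) * ln (real j)))"
    using rate by (simp add: p_def)
  also have "\<dots> = real j powr (- (1 + \<epsilon>))"
    using \<open>j \<ge> 1\<close> by (simp add: powr_def algebra_simps)
  finally have w1: "?w k l \<le> 1 / p * real j powr (- (1 + \<epsilon>))"
    using p by (simp add: field_simps)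
  have w2: "?w k l \<le> ?r ^ l"
    using p by (intro excursion_weight_le_power) simp
  have "?w k l = ?w k l powr \<theta> * ?w k l powr (1 - \<theta>)"
    using w0[of k l] by (simp flip: powr_add)
  also have "\<dots> \<le> (1 / p * real j powr (- (1 + \<epsilon>))) powr \<theta> * (?r ^ l) powr (1 - \<theta>)"
    using w0 w1 w2 \<theta> by (intro mult_mono powr_mono2) auto
  also have "(1 / p * real j powr (- (1 + \<epsilon>))) powr \<theta> = (1 / p) powr \<theta> * real j powr (- (1 + \<epsilon>) * \<theta>)"
    by (simp only: powr_mult powr_powr)
  also have "- (1 + \<epsilon>) * \<theta> = - (1 + \<epsilon> / 2)"
    using \<open>\<epsilon> > 0\<close> by (simp add: \<theta>_def field_simps)
  also have "(?r ^ l) powr (1 - \<theta>) = (?r powr (1 - \<theta>)) ^ l"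
  proof -
    have "(?r powr (1 - \<theta>)) ^ l = (?r powr (1 - \<theta>)) powr real l"
      by (rule powr_realpow[symmetric]) (use r in simp)
    moreover have "?r ^ l = ?r powr real l"
      by (rule powr_realpow[symmetric, OF r])
    ultimately show ?thesis by (simp only: powr_powr mult.commute)
  qed
  finally show ?thesis .
qed

context simple_random_walk
begin

text \<open>The counts after time \<open>j\<close> are final: the pattern persists at every later
  horizon. The start \<open>- e i\<close> moves the site next to the walk to the origin, and 2 is
  the trailing length demanded by \<open>pattern_prob_le\<close>.\<close>

definition stable_pattern :: "nat \<Rightarrow> nat \<Rightarrow> nat \<Rightarrow> nat \<Rightarrow> 'a set"
  where "stable_pattern k l j i =
    (\<Union>s. {\<omega> \<in> space M. \<forall>s'\<in>{s..}. excursion_pattern k l s' (- e i) (steps j (s' + 2) \<omega>)})"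

lemma event_stable_pattern [measurable]: "stable_pattern k l j i \<in> events"
  unfolding stable_pattern_def by measurable

text \<open>Each of the increasing events lies inside a pattern event at one horizon, and the bound
  there does not depend on the horizon.\<close>

lemma prob_stable_pattern_le:
  assumes "i \<in> {1..2 * CARD('d)}"
  shows "prob (stable_pattern k l j i) \<le> excursion_weight TYPE('d) (ret_prob TYPE('d)) k l"
proof -
  let ?D = "\<lambda>s. {\<omega> \<in> space M. \<forall>s'\<in>{s..}. excursion_pattern k l s' (- e i) (steps j (s' + 2) \<omega>)}"
  have D: "?D s \<in> events" for s by measurable
  have "prob (?D s) \<le> excursion_weight TYPE('d) (ret_prob TYPE('d)) k l" for s
  proof -
    have "prob (?D s) \<le> prob {\<omega> \<in> space M. excursion_pattern k l s (- e i) (steps j (s + 2) \<omega>)}"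
      by (intro finite_measure_mono) auto
    also have "\<dots> = pattern_prob 2 k l s (- e i :: int ^ 'd)"
      unfolding pattern_prob_def by (rule prob_steps)
    also have "\<dots> \<le> excursion_weight TYPE('d) (ret_prob TYPE('d)) k l"
      using e_mem_sphere[OF assms] by (intro pattern_prob_le) auto
    finally show ?thesis .
  qed
  moreover have "(\<lambda>s. prob (?D s)) \<longlonglongrightarrow> prob (\<Union>s. ?D s)"
    using D by (intro finite_Lim_measure_incseq) (auto simp: incseq_def)
  ultimately show ?thesis
    unfolding stable_pattern_def by (intro LIMSEQ_le_const2[of "\<lambda>s. prob (?D s)"]) auto
qed

text \<open>For \<open>k > l\<close> the binomial coefficient vanishes and the event is
  null.\<close>

lemma AE_stable_pattern_le:
  "AE \<omega> in M. \<forall>i\<in>{1..2 * CARD('d)}. \<forall>j k l. \<omega> \<in> stable_pattern k l j i \<longrightarrow> k \<le> l"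
proof -
  have "AE \<omega> in M. \<omega> \<in> stable_pattern k l j i \<longrightarrow> k \<le> l" if "i \<in> {1..2 * CARD('d)}" for i j k l
  proof (cases "k \<le> l")
    case False
    then have "prob (stable_pattern k l j i) \<le> 0"
      using prob_stable_pattern_le[OF that, of k l j] by (simp add: excursion_weight_eq_0)
    then have "stable_pattern k l j i \<in> null_sets M"
      by (intro null_setsI) (auto simp: emeasure_eq_measure measure_le_0_iff)
    from AE_not_in[OF this] show ?thesis by eventually_elim simp
  qed simp
  then have "\<forall>i\<in>{1..2 * CARD('d)}. AE \<omega> in M. \<forall>j k l. \<omega> \<in> stable_pattern k l j i \<longrightarrow> k \<le> l"
    unfolding AE_all_countable by blast
  then show ?thesis by (subst AE_ball_countable) auto
qed

text \<open>Borel-Cantelli over \<open>j\<close>. For fixed \<open>j\<close> a union bound runs over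
  all pairs \<open>k \<le> l\<close>; the interpolated weights leave
  \<open>(l + 1) * \<rho> ^ l\<close>, summed by the derivative of the geometric series.\<close>

lemma AE_eventually_rate_le:
  assumes d3: "CARD('d) \<ge> 3" and "\<epsilon> > 0" and i: "i \<in> {1..2 * CARD('d)}"
  shows "AE \<omega> in M. \<forall>\<^sub>F j in sequentially. \<forall>k l. k \<le> l \<longrightarrow> \<omega> \<in> stable_pattern k l j i \<longrightarrow>
    rate CARD('d) (ret_prob TYPE('d)) (real k) (real (Suc l)) \<le> (1 + \<epsilon>) * ln (real j)"
proof -
  let ?p = "ret_prob TYPE('d)"
  let ?bad = "\<lambda>j k l. rate CARD('d) ?p (real k) (real (Suc l)) > (1 + \<epsilon>) * ln (real j)"
  define \<theta> where "\<theta> = (1 + \<epsilon> / 2) / (1 + \<epsilon>)"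
  define r where "r = ?p + 1 / (2 * real CARD('d))"
  define \<rho> where "\<rho> = r powr (1 - \<theta>)"
  define F where "F j l = (\<Union>k\<in>{k. k \<le> l \<and> ?bad j k l}. stable_pattern k l j i)" for j l
  define B where "B j = (\<Union>l. F j l)" for j
  define c where "c j = (1 / ?p) powr \<theta> * real j powr (- (1 + \<epsilon> / 2))" for j
  have \<theta>: "\<theta> < 1" using \<open>\<epsilon> > 0\<close> by (auto simp: \<theta>_def)
  have r: "0 < r" "r < 1"
    using ret_prob_pos[where 'd = 'd] esc_prob_pos[OF d3] by (auto simp: r_def esc_prob_def add_pos_nonneg)
  then have \<rho>: "0 < \<rho>" "\<rho> < 1" using \<theta> powr_less_mono2[of "1 - \<theta>" r 1] by (auto simp: \<rho>_def)
  have c0: "c j \<ge> 0" for j by (simp add: c_def)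
  have F_event: "F j l \<in> events" for j l
    unfolding F_def by (intro sets.finite_UN ballI event_stable_pattern) simp
  have F_le: "prob (F j l) \<le> c j * (real (Suc l) * \<rho> ^ l)" if "j \<ge> 1" for j l
  proof -
    have "prob (F j l) \<le> (\<Sum>k\<in>{k. k \<le> l \<and> ?bad j k l}. prob (stable_pattern k l j i))"
      unfolding F_def by (rule finite_measure_subadditive_finite) auto
    also have "\<dots> \<le> (\<Sum>k\<in>{k. k \<le> l \<and> ?bad j k l}. c j * \<rho> ^ l)"
    proof (rule sum_mono)
      fix k assume "k \<in> {k. k \<le> l \<and> ?bad j k l}"
      then have "excursion_weight TYPE('d) ?p k l \<le> c j * \<rho> ^ l"
        using weight_le_powr[OF d3, of k l j \<epsilon>] \<open>\<epsilon> > 0\<close> \<open>j \<ge> 1\<close>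
        unfolding c_def \<rho>_def r_def \<theta>_def by simp
      then show "prob (stable_pattern k l j i) \<le> c j * \<rho> ^ l"
        using prob_stable_pattern_le[OF i, of k l j] by simp
    qed
    also have "\<dots> \<le> (\<Sum>k\<in>{..l}. c j * \<rho> ^ l)"
      using c0 \<rho> by (intro sum_mono2) auto
    finally show ?thesis by (simp add: mult_ac)
  qed
  have geo: "(\<lambda>l. real (Suc l) * \<rho> ^ l) sums (1 / (1 - \<rho>)\<^sup>2)"
    using geometric_deriv_sums[of \<rho>] \<rho> by simp
  have B_le: "prob (B j) \<le> c j * (1 / (1 - \<rho>)\<^sup>2)" if "j \<ge> 1" for j
  proof -
    have sum_c: "(\<lambda>l. c j * (real (Suc l) * \<rho> ^ l)) sums (c j * (1 / (1 - \<rho>)\<^sup>2))"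
      by (intro sums_mult geo)
    have sum_F: "summable (\<lambda>l. prob (F j l))"
    proof (rule summable_comparison_test)
      show "\<exists>N. \<forall>l\<ge>N. norm (prob (F j l)) \<le> c j * (real (Suc l) * \<rho> ^ l)"
        using F_le[OF that] by (intro exI[of _ 0]) simp
    qed (rule sums_summable[OF sum_c])
    have "prob (B j) \<le> (\<Sum>l. prob (F j l))"
      unfolding B_def using F_event sum_F by (intro finite_measure_subadditive_countably) auto
    also have "\<dots> \<le> (\<Sum>l. c j * (real (Suc l) * \<rho> ^ l))"
      using F_le[OF that] by (intro suminf_le sum_F sums_summable[OF sum_c])
    also have "\<dots> = c j * (1 / (1 - \<rho>)\<^sup>2)"
      using sum_c by (rule sums_unique[symmetric])
    finally show ?thesis .
  qed
  have "summable (\<lambda>j. c j * (1 / (1 - \<rho>)\<^sup>2))"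
    unfolding c_def using \<open>\<epsilon> > 0\<close>
    by (intro summable_mult2 summable_mult) (simp add: summable_real_powr_iff)
  then have "summable (\<lambda>j. prob (B j))"
  proof (rule summable_comparison_test[rotated])
    show "\<exists>N. \<forall>j\<ge>N. norm (prob (B j)) \<le> c j * (1 / (1 - \<rho>)\<^sup>2)"
      using B_le by (intro exI[of _ 1]) simp
  qed
  moreover have "B j \<in> events" for j unfolding B_def using F_event by blast
  ultimately have "AE \<omega> in M. \<forall>\<^sub>F j in sequentially. \<omega> \<in> space M - B j"
    by (intro borel_cantelli_AE1) (auto simp: emeasure_eq_measure)
  then show ?thesis
  proof eventually_elim
    case (elim \<omega>)
    then show ?case
    proof (rule eventually_mono, intro allI impI)
      fix j k l assume "\<omega> \<in> space M - B j" "k \<le> l" "\<omega> \<in> stable_pattern k l j i"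
      then have "\<not> ?bad j k l" unfolding B_def F_def by blast
      then show "rate CARD('d) ?p (real k) (real (Suc l)) \<le> (1 + \<epsilon>) * ln (real j)" by simp
    qed
  qed
qed

lemma visits_steps_shifted:
  "visits A x (steps j t \<omega>) = card {n \<in> {j<..j + t}. x + (walk X \<omega> n - walk X \<omega> j) \<in> A}"
proof -
  have "bij_betw ((+) j) {i \<in> {1..t}. x + (walk X \<omega> (j + i) - walk X \<omega> j) \<in> A}
      {n \<in> {j<..j + t}. x + (walk X \<omega> n - walk X \<omega> j) \<in> A}"
    by (rule bij_betw_byWitness[where f' = "\<lambda>n. n - j"]) auto
  then show ?thesis unfolding visits_steps by (rule bij_betw_same_card)
qed

lemma stable_patternI:
  assumes fin: "\<And>z. finite {n. walk X \<omega> n = z}" and "\<omega> \<in> space M"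
  shows "\<omega> \<in> stable_pattern (card {n. n > j \<and> walk X \<omega> n = walk X \<omega> j + e i})
    (card {n. n > j \<and> walk X \<omega> n - (walk X \<omega> j + e i) \<in> unit_sphere}) j i"
proof -
  let ?w = "walk X \<omega>"
  let ?x = "- e i :: int ^ 'd"
  define V where "V A = {n. n > j \<and> ?x + (?w n - ?w j) \<in> A}" for A
  have fin_V: "finite (V A)" if "finite A" for A
  proof -
    have "V A \<subseteq> (\<Union>a\<in>A. {n. ?w n = ?w j + e i + a})"
      by (auto simp: V_def algebra_simps)
    then show ?thesis by (rule finite_subset) (use that fin in auto)
  qed
  \<comment> \<open>An absolute time after which the ball is never met again, hence also a
    sufficient horizon when counted from \<open>j\<close>.\<close>
  obtain s where s: "V (insert 0 unit_sphere) \<subseteq> {..s}"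
    using fin_V[of "insert 0 unit_sphere"] finite_nat_iff_bounded_le by auto
  have V_eq: "visits A ?x (steps j t \<omega>) = card (V A)" if "t \<ge> s" "A \<subseteq> insert 0 unit_sphere" for t A
  proof -
    have "V A \<subseteq> V (insert 0 unit_sphere)" using that by (auto simp: V_def)
    then have "{n \<in> {j<..j + t}. ?x + (?w n - ?w j) \<in> A} = V A"
      using s that by (auto simp: V_def)
    then show ?thesis by (simp only: visits_steps_shifted)
  qed
  have "excursion_pattern (card (V {0})) (card (V unit_sphere)) s' ?x (steps j (s' + 2) \<omega>)" if "s' \<ge> s" for s'
  proof -
    have "visits unit_sphere ?x (take s' (steps j (s' + 2) \<omega>)) +
        visits unit_sphere (?x + sum_list (take s' (steps j (s' + 2) \<omega>))) (drop s' (steps j (s' + 2) \<omega>))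
        = card (V unit_sphere)"
      unfolding visits_append[symmetric] append_take_drop_id using that by (intro V_eq) auto
    moreover have "visits unit_sphere ?x (take s' (steps j (s' + 2) \<omega>)) = card (V unit_sphere)"
      using that V_eq[OF that subset_insertI] by (simp add: take_steps)
    moreover have "visits {0} ?x (steps j (s' + 2) \<omega>) = card (V {0})"
      using that by (intro V_eq) auto
    ultimately show ?thesis by (simp add: excursion_pattern_def)
  qed
  moreover have "V {0} = {n. n > j \<and> ?w n = ?w j + e i}" "V unit_sphere = {n. n > j \<and> ?w n - (?w j + e i) \<in> unit_sphere}"
    by (auto simp: V_def algebra_simps)
  ultimately show ?thesis
    unfolding stable_pattern_def using \<open>\<omega> \<in> space M\<close> by auto
qed

lemma step_mem_sphere:
  assumes "\<And>j t. set (steps j t \<omega>) \<subseteq> unit_sphere"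
  shows "walk X \<omega> (Suc n) - walk X \<omega> n \<in> unit_sphere"
proof -
  have "steps n 1 \<omega> = [X (Suc n) \<omega>]" by (simp add: steps_def)
  then have "X (Suc n) \<omega> \<in> unit_sphere" using assms[of n 1] by simp
  then show ?thesis by (simp add: walk_def)
qed

text \<open>A site is entered only from its sphere, so no visit to \<open>z\<close> precedes the
  first time \<open>j\<close> on the sphere. That time counts as a sphere visit unless
  \<open>j = 0\<close>.\<close>

lemma times_at_first_visit:
  assumes nn: "\<And>n. walk X \<omega> (Suc n) - walk X \<omega> n \<in> unit_sphere"
    and first: "\<And>t. t < j \<Longrightarrow> walk X \<omega> t - z \<notin> unit_sphere"
    and j: "walk X \<omega> j - z \<in> unit_sphere"
  shows "{n. n > 0 \<and> walk X \<omega> n = z} = {n. n > j \<and> walk X \<omega> n = z}"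
    and "{n. n > 0 \<and> walk X \<omega> n - z \<in> unit_sphere} =
      (if j = 0 then {} else {j}) \<union> {n. n > j \<and> walk X \<omega> n - z \<in> unit_sphere}"
proof -
  have "n > j" if "n > 0" "walk X \<omega> n = z" for n
  proof (rule ccontr)
    assume "\<not> n > j"
    moreover have "n \<noteq> j" using j that by auto
    ultimately have "n - 1 < j" by simp
    then have "walk X \<omega> (n - 1) - z \<notin> unit_sphere" by (rule first)
    moreover have "walk X \<omega> n - walk X \<omega> (n - 1) \<in> unit_sphere" using nn[of "n - 1"] that by simp
    then have "- (walk X \<omega> n - walk X \<omega> (n - 1)) \<in> unit_sphere" by (simp only: uminus_mem_unit_sphere_iff)
    ultimately show False using that by simp
  qed
  then show "{n. n > 0 \<and> walk X \<omega> n = z} = {n. n > j \<and> walk X \<omega> n = z}" by auto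
  have "n \<ge> j" if "walk X \<omega> n - z \<in> unit_sphere" for n
    using first[of n] that by (meson not_le)
  then show "{n. n > 0 \<and> walk X \<omega> n - z \<in> unit_sphere} =
      (if j = 0 then {} else {j}) \<union> {n. n > j \<and> walk X \<omega> n - z \<in> unit_sphere}"
    using j by (auto simp: le_less)
qed

text \<open>Each site is viewed from the first visit to its sphere, where all remaining counts lie
  in the future. Finitely many sites are reached too early for the Borel-Cantelli bound; the growth
  of \<open>ln n\<close> absorbs them.\<close>

lemma AE_joint_upper:
  assumes d3: "CARD('d) \<ge> 3" and "\<epsilon> > 0"
  shows "AE \<omega> in M. \<exists>n0. \<forall>n\<ge>n0. \<forall>j\<in>{1..n}. \<forall>i\<in>{1..2 * CARD('d)}. \<exists>a b.
    local_time (walk X \<omega>) (walk X \<omega> j + e i) = enat a \<and>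
    occupation_time (walk X \<omega>) (walk X \<omega> j + e i) = enat b \<and> a \<le> b \<and>
    rate CARD('d) (ret_prob TYPE('d)) (real a) (real b) \<le> (1 + \<epsilon>) * ln (real n)"
proof -
  let ?I = "{1..2 * CARD('d)}"
  let ?rate = "rate CARD('d) (ret_prob TYPE('d))"
  have "AE \<omega> in M. \<forall>i\<in>?I. \<forall>\<^sub>F j in sequentially. \<forall>k l. k \<le> l \<longrightarrow> \<omega> \<in> stable_pattern k l j i \<longrightarrow>
      ?rate (real k) (real (Suc l)) \<le> (1 + \<epsilon>) * ln (real j)"
    by (subst AE_ball_countable) (simp_all only: countable_finite finite_atLeastAtMost, intro ballI AE_eventually_rate_le assms)
  with AE_space AE_finite_visits[OF d3] AE_steps_sphere AE_stable_pattern_le show ?thesis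
  proof eventually_elim
    case (elim \<omega>)
    let ?w = "walk X \<omega>"
    have fin: "finite {n. ?w n = z}" for z using elim(2) by blast
    have nn: "?w (Suc n) - ?w n \<in> unit_sphere" for n
      using elim(3) by (intro step_mem_sphere) blast
    define \<xi> \<Xi> where "\<xi> z = card {n. n > 0 \<and> ?w n = z}" "\<Xi> z = card {n. n > 0 \<and> ?w n - z \<in> unit_sphere}" for z
    have times: "local_time ?w z = enat (\<xi> z)" "occupation_time ?w z = enat (\<Xi> z)" for z
      unfolding \<xi>_\<Xi>_def using fin by (simp_all add: local_time_eq occupation_time_eq)
    have "\<forall>\<^sub>F j in sequentially. \<forall>i\<in>?I. \<forall>k l. k \<le> l \<longrightarrow> \<omega> \<in> stable_pattern k l j i \<longrightarrow>
      ?rate (real k) (real (Suc l)) \<le> (1 + \<epsilon>) * ln (real j)"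
      by (rule eventually_ball_finite[OF _ elim(5)]) simp
    then obtain J where J: "\<forall>j\<ge>J. \<forall>i\<in>?I. \<forall>k l. k \<le> l \<longrightarrow> \<omega> \<in> stable_pattern k l j i \<longrightarrow>
      ?rate (real k) (real (Suc l)) \<le> (1 + \<epsilon>) * ln (real j)"
      unfolding eventually_sequentially ..
    define Z where "Z = (\<lambda>(j, i). ?w j + e i) ` ({..J} \<times> ?I)"
    have "finite Z" unfolding Z_def by auto
    have "filterlim (\<lambda>n. (1 + \<epsilon>) * ln (real n)) at_top sequentially"
      using \<open>\<epsilon> > 0\<close>
      by (intro filterlim_tendsto_pos_mult_at_top[OF tendsto_const _ filterlim_compose[OF ln_at_top filterlim_real_sequentially]]) simp
    then have "\<forall>\<^sub>F n in sequentially. \<forall>z\<in>Z. ?rate (real (\<xi> z)) (real (\<Xi> z)) \<le> (1 + \<epsilon>) * ln (real n)"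
      using \<open>finite Z\<close> unfolding filterlim_at_top by (intro eventually_ball_finite) auto
    then obtain n0 where n0: "\<forall>n\<ge>n0. \<forall>z\<in>Z. ?rate (real (\<xi> z)) (real (\<Xi> z)) \<le> (1 + \<epsilon>) * ln (real n)"
      unfolding eventually_sequentially ..
    have key: "\<xi> z \<le> \<Xi> z \<and> ?rate (real (\<xi> z)) (real (\<Xi> z)) \<le> (1 + \<epsilon>) * ln (real n)"
      if n: "n \<ge> n0" "j \<in> {1..n}" "i \<in> ?I" "z = ?w j + e i" for n j i z
    proof -
      have "?w j - z \<in> unit_sphere" using e_mem_sphere[OF n(3)] by (simp add: n(4))
      then obtain j' where j': "?w j' - z \<in> unit_sphere" "\<And>t. t < j' \<Longrightarrow> ?w t - z \<notin> unit_sphere" "j' \<le> j"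
        using ex_least_nat_le[of "\<lambda>t. ?w t - z \<in> unit_sphere" j] by blast
      then have "- (?w j' - z) \<in> unit_sphere" by (simp only: uminus_mem_unit_sphere_iff)
      \<comment> \<open>Seen from the first visit, the same site may lie in another direction
        \<open>i'\<close>.\<close>
      then obtain i' where "i' \<in> ?I" "- (?w j' - z) = e i'"
        unfolding unit_sphere_eq by blast
      then have i': "i' \<in> ?I" "z = ?w j' + e i'" by (simp_all add: diff_eq_eq add.commute)
      define K L where "K = card {n. n > j' \<and> ?w n = z}" "L = card {n. n > j' \<and> ?w n - z \<in> unit_sphere}"
      have "\<omega> \<in> stable_pattern K L j' i'"
        unfolding K_L_def i'(2) using fin elim(1) by (rule stable_patternI)
      then have "K \<le> L" using elim(4) i'(1) by blast
      have sets_\<xi>: "{n. n > 0 \<and> ?w n = z} = {n. n > j' \<and> ?w n = z}"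
        by (rule times_at_first_visit(1)) (use nn j' in auto)
      have sets_\<Xi>: "{n. n > 0 \<and> ?w n - z \<in> unit_sphere} =
          (if j' = 0 then {} else {j'}) \<union> {n. n > j' \<and> ?w n - z \<in> unit_sphere}"
        by (rule times_at_first_visit(2)) (use nn j' in auto)
      have \<xi>: "\<xi> z = K"
        unfolding \<xi>_\<Xi>_def K_L_def by (rule arg_cong[OF sets_\<xi>])
      have "finite {n. n > j' \<and> ?w n - z \<in> unit_sphere}"
      proof (rule finite_subset)
        show "{n. n > j' \<and> ?w n - z \<in> unit_sphere} \<subseteq> (\<Union>v\<in>unit_sphere. {n. ?w n = z + v})"
        proof
          fix n assume "n \<in> {n. n > j' \<and> ?w n - z \<in> unit_sphere}"
          then show "n \<in> (\<Union>v\<in>unit_sphere. {n. ?w n = z + v})" by (intro UN_I[of "?w n - z"]) auto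
        qed
      qed (use fin in auto)
      then have \<Xi>: "\<Xi> z = (if j' = 0 then L else Suc L)"
        unfolding \<xi>_\<Xi>_def K_L_def sets_\<Xi> by (simp add: card_insert_if)
      show ?thesis
      proof (cases "j' \<le> J")
        case True
        then have "z \<in> Z" unfolding Z_def using i' by auto
        then have "?rate (real (\<xi> z)) (real (\<Xi> z)) \<le> (1 + \<epsilon>) * ln (real n)" using n0 n(1) by simp
        moreover have "\<xi> z \<le> \<Xi> z" unfolding \<xi> \<Xi> using \<open>K \<le> L\<close> by simp
        ultimately show ?thesis by blast
      next
        case False
        then have "?rate (real K) (real (Suc L)) \<le> (1 + \<epsilon>) * ln (real j')"
          using J[rule_format, OF _ i'(1) \<open>K \<le> L\<close> \<open>\<omega> \<in> stable_pattern K L j' i'\<close>] by simp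
        also have "\<dots> \<le> (1 + \<epsilon>) * ln (real n)"
          using False j'(3) n(2) \<open>\<epsilon> > 0\<close> by (intro mult_left_mono ln_mono) auto
        finally have "?rate (real K) (real (Suc L)) \<le> (1 + \<epsilon>) * ln (real n)" .
        moreover have "\<Xi> z = Suc L" unfolding \<Xi> using False by simp
        ultimately show ?thesis using \<open>K \<le> L\<close> unfolding \<xi> by (simp only:) simp
      qed
    qed
    show ?case
    proof (rule exI[of _ n0], intro allI impI ballI)
      fix n j i assume "n \<ge> n0" "j \<in> {1..n}" "i \<in> ?I"
      from key[OF this refl]
      show "\<exists>a b. local_time ?w (?w j + e i) = enat a \<and> occupation_time ?w (?w j + e i) = enat b \<and>
          a \<le> b \<and> ?rate (real a) (real b) \<le> (1 + \<epsilon>) * ln (real n)"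
        by (intro exI[of _ "\<xi> (?w j + e i)"] exI[of _ "\<Xi> (?w j + e i)"] conjI times) simp_all
    qed
  qed
qed

end

subsection \<open>The lower bound\<close>

text \<open>Disjoint blocks of steps are independent and identically distributed, so probabilities
  multiply.\<close>

lemma pavg_blocks:
  fixes A :: "(int ^ 'd::finite) list \<Rightarrow> bool"
  shows "pavg (W * N) (\<lambda>l. of_bool (\<forall>b<N. A (take W (drop (W * b) l)))) = pavg W (\<lambda>l. of_bool (A l)) ^ N"
proof (induction N)
  case (Suc N)
  let ?P = "\<lambda>N l. \<forall>b<N. A (take W (drop (W * b) l))"
  have "pavg (W * N + W) (\<lambda>l. of_bool (?P (Suc N) l)) = pavg (W * N) (\<lambda>l. pavg W (\<lambda>m. of_bool (?P (Suc N) (l @ m))))"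
    by (rule pavg_append)
  also have "\<dots> = pavg (W * N) (\<lambda>l. of_bool (?P N l) * pavg W (\<lambda>m. of_bool (A m)))"
  proof (rule pavg_cong)
    fix l :: "(int ^ 'd) list" assume l: "length l = W * N"
    have "pavg W (\<lambda>m. of_bool (?P (Suc N) (l @ m))) = pavg W (\<lambda>m. of_bool (?P N l) * of_bool (A m))"
    proof (rule pavg_cong)
      fix m :: "(int ^ 'd) list" assume m: "length m = W"
      have *: "take W (drop (W * b) (l @ m)) = take W (drop (W * b) l)" if "b < N" for b
      proof -
        have "W * (b + 1) \<le> W * N" using that by (intro mult_le_mono2) simp
        then show ?thesis using l by simp
      qed
      have "A (take W (drop (W * N) (l @ m))) = A m" using l m by simp
      moreover have "?P N (l @ m) \<longleftrightarrow> ?P N l" by (intro all_cong arg_cong[where f = A] *)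
      moreover have "(\<forall>b<Suc N. Q b) \<longleftrightarrow> (\<forall>b<N. Q b) \<and> Q N" for Q by (auto simp: less_Suc_eq)
      ultimately have "?P (Suc N) (l @ m) \<longleftrightarrow> ?P N l \<and> A m" by (simp only:)
      then show "of_bool (?P (Suc N) (l @ m)) = of_bool (?P N l) * (of_bool (A m) :: real)"
        by simp
    qed
    then show "pavg W (\<lambda>m. of_bool (?P (Suc N) (l @ m))) = of_bool (?P N l) * pavg W (\<lambda>m. of_bool (A m))"
      by (simp only: pavg_cmult)
  qed
  finally show ?case
    using Suc.IH by (simp only: pavg_multc mult_Suc_right add.commute power_Suc2)
qed simp

text \<open>Two steps without a sphere visit leave the walk outside the ball, from where the centre
  is reached only across the sphere. A pattern over a long horizon thus implies the same pattern
  over \<open>s + 2\<close> steps, an event independent of all later steps.\<close>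

lemma excursion_pattern_take:
  fixes x :: "int ^ 'd::finite"
  assumes pat: "excursion_pattern k l s x w" and w: "set w \<subseteq> unit_sphere" "length w \<ge> s + 2"
  shows "excursion_pattern k l s x (take (s + 2) w)"
proof -
  define y where "y = x + sum_list (take s w)"
  obtain v v' u where u: "drop s w = v # v' # u"
  proof -
    have "Suc (Suc 0) \<le> length (drop s w)" using w by simp
    then show thesis using that unfolding Suc_le_length_iff by blast
  qed
  have vis: "visits unit_sphere y (v # v' # u) = 0"
    using pat unfolding excursion_pattern_def y_def u by simp
  have inS: "v' \<in> unit_sphere" "set u \<subseteq> unit_sphere"
    using w(1) set_drop_subset[of s w] unfolding u by auto
  have "y + v \<notin> unit_sphere" "y + v + v' \<notin> unit_sphere" "visits unit_sphere (y + v + v') u = 0"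
    using vis by (auto split: if_splits)
  moreover have "y + v + v' \<noteq> 0"
  proof
    assume "y + v + v' = 0"
    then have "y + v = - v'" by (simp add: eq_neg_iff_add_eq_0)
    then show False using \<open>y + v \<notin> unit_sphere\<close> inS(1) by simp
  qed
  ultimately have "visits {0} (y + v + v') u = 0"
    using inS(2) by (intro visits_center_eq_0) auto
  have w_eq: "w = take s w @ (v # v' # u)" by (metis append_take_drop_id u)
  have tk: "take (s + 2) w = take s w @ [v, v']"
    using w(2) by (subst w_eq) simp
  have "visits {0} x w = visits {0} x (take s w @ [v, v'])"
    using \<open>visits {0} (y + v + v') u = 0\<close>
    by (subst w_eq) (simp add: visits_append y_def[symmetric])
  moreover have "take s (take (s + 2) w) = take s w" "drop s (take (s + 2) w) = [v, v']"
    using w(2) unfolding tk by simp_all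
  moreover have "visits unit_sphere y [v, v'] = 0"
    using vis by (auto split: if_splits)
  ultimately show ?thesis
    using pat unfolding excursion_pattern_def tk y_def by simp
qed

text \<open>The window is read from its midpoint. The reversed and negated first half is the walk
  backwards in time, which must stay off the ball, so the midpoint is the first visit within the
  window.\<close>

definition good_window :: "nat \<Rightarrow> nat \<Rightarrow> nat \<Rightarrow> nat \<Rightarrow> int ^ 'd::finite \<Rightarrow> (int ^ 'd) list \<Rightarrow> bool"
  where "good_window h s k l x w \<longleftrightarrow>
    visits (insert 0 unit_sphere) x (map uminus (rev (take h w))) = 0 \<and>
    excursion_pattern k l s x (drop h w)"

text \<open>Past and future of the midpoint are independent, and reversal and reflection turn the
  past into an ordinary walk that avoids the ball.\<close>

lemma pavg_good_window:
  fixes x :: "int ^ 'd::finite"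
  assumes "s \<le> h"
  shows "pavg (2 * h) (\<lambda>w. of_bool (good_window h s k l x w)) = avoid_prob h x * pattern_prob (h - s) k l s x"
proof -
  let ?past = "\<lambda>u. visits (insert 0 unit_sphere) x (map uminus (rev u)) = 0"
  have "pavg (h + h) (\<lambda>w. of_bool (good_window h s k l x w)) =
      pavg h (\<lambda>u. pavg h (\<lambda>v. of_bool (good_window h s k l x (u @ v))))"
    by (rule pavg_append)
  also have "\<dots> = pavg h (\<lambda>u. of_bool (?past u) * pattern_prob (h - s) k l s x)"
  proof (rule pavg_cong)
    fix u :: "(int ^ 'd) list" assume "length u = h"
    then have "pavg h (\<lambda>v. of_bool (good_window h s k l x (u @ v))) =
        pavg h (\<lambda>v. of_bool (?past u) * of_bool (excursion_pattern k l s x v))"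
      by (intro pavg_cong) (simp add: good_window_def)
    then show "pavg h (\<lambda>v. of_bool (good_window h s k l x (u @ v))) = of_bool (?past u) * pattern_prob (h - s) k l s x"
      using assms by (simp add: pavg_cmult pattern_prob_def)
  qed
  also have "\<dots> = pavg h (\<lambda>u. of_bool (?past u)) * pattern_prob (h - s) k l s x"
    by (rule pavg_multc)
  also have "pavg h (\<lambda>u. of_bool (?past u)) = avoid_prob h x"
    using pavg_rev[of h "\<lambda>u. of_bool (visits (insert 0 unit_sphere) x (map uminus u) = 0)"]
      pavg_uminus[of h "\<lambda>u. of_bool (visits (insert 0 unit_sphere) x u = 0)"] pavg_avoid[of h x]
    by simp
  finally show ?thesis by (simp only: mult_2)
qed

definition heat_const :: "'d::finite itself \<Rightarrow> real"
  where "heat_const _ = real (2 * CARD('d) + 1) * (2 * sqrt (real CARD('d) ^ 3))"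

lemma heat_const_nonneg: "heat_const T \<ge> 0"
  by (simp add: heat_const_def)

lemma card_ball: "card (insert 0 unit_sphere :: (int ^ 'd::finite) set) = 2 * CARD('d) + 1"
  by (simp add: card_unit_sphere)

section \<open>Visits to the ball from outside a window\<close>

context simple_random_walk
begin

text \<open>The pattern is part of the event, so the probability keeps the factor \<open>W\<close>,
  without which a union over more than \<open>1 / W\<close> windows would be useless.\<close>

definition late_visit :: "nat \<Rightarrow> nat \<Rightarrow> nat \<Rightarrow> nat \<Rightarrow> int ^ 'd \<Rightarrow> nat \<Rightarrow> 'a set"
  where "late_visit h s k l x j = (\<Union>t\<in>{j + h<..}. {\<omega> \<in> space M.
    excursion_pattern k l s x (steps j (s + 2) \<omega>) \<and> x + sum_list (steps j (t - j) \<omega>) \<in> insert 0 unit_sphere})"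

definition early_visit :: "nat \<Rightarrow> nat \<Rightarrow> nat \<Rightarrow> nat \<Rightarrow> int ^ 'd \<Rightarrow> nat \<Rightarrow> 'a set"
  where "early_visit h s k l x j = (\<Union>t\<in>{t. t + h < j}. {\<omega> \<in> space M.
    excursion_pattern k l s x (steps j (s + 2) \<omega>) \<and> x - sum_list (steps t (j - t) \<omega>) \<in> insert 0 unit_sphere})"

lemma event_late_visit [measurable]: "late_visit h s k l x j \<in> events"
  unfolding late_visit_def by measurable

lemma event_early_visit [measurable]: "early_visit h s k l x j \<in> events"
  unfolding early_visit_def by measurable

lemma weight_nonneg: "excursion_weight TYPE('d) (ret_prob TYPE('d)) k l \<ge> 0"
  using ret_prob_pos[where 'd = 'd] by (intro excursion_weight_nonneg) simp

text \<open>After the \<open>s + 2\<close> steps that decide the pattern the walk starts afresh, and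
  the heat kernel bounds the chance of being in the ball later, whatever the current
  position.\<close>

lemma prob_late_visit_le:
  assumes d3: "CARD('d) \<ge> 3" and x: "x \<in> unit_sphere" and h: "s + 2 \<le> h"
  shows "prob (late_visit h s k l x j) \<le> excursion_weight TYPE('d) (ret_prob TYPE('d)) k l * heat_const TYPE('d) / sqrt (real (h - s - 1))"
proof -
  let ?T = "insert 0 unit_sphere :: (int ^ 'd) set"
  let ?c = "real (2 * CARD('d) + 1)" and ?w = "excursion_weight TYPE('d) (ret_prob TYPE('d)) k l"
  \<comment> \<open>This is \<open>h + 1 - (s + 2)\<close>, the least number of fresh steps before a
    visit counted as late.\<close>
  let ?V = "h - s - 1"
  let ?E = "\<lambda>v. {\<omega> \<in> space M. excursion_pattern k l s x (steps j (s + 2) \<omega>) \<and>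
    x + sum_list (steps j (s + 2 + (?V + v)) \<omega>) \<in> ?T}"
  have E: "?E v \<in> events" for v by measurable
  have prob_E: "prob (?E v) \<le> ?w * ?c * heat_bound TYPE('d) (?V + v)" for v
  proof -
    let ?t = "?V + v"
    let ?f = "\<lambda>u v. of_bool (excursion_pattern k l s x (take (s + 2) (u @ v)) \<and> x + sum_list (u @ v) \<in> ?T)"
    have E_eq: "?E v = {\<omega> \<in> space M. (\<lambda>w. excursion_pattern k l s x (take (s + 2) w) \<and> x + sum_list w \<in> ?T) (steps j (s + 2 + ?t) \<omega>)}"
      by (simp add: take_steps)
    have "prob (?E v) = pavg (s + 2 + ?t) (\<lambda>w. of_bool (excursion_pattern k l s x (take (s + 2) w) \<and> x + sum_list w \<in> ?T))"
      unfolding E_eq by (rule prob_steps)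
    also have "\<dots> = pavg (s + 2) (\<lambda>u. pavg ?t (\<lambda>v. ?f u v))"
      by (rule pavg_append)
    also have "\<dots> \<le> pavg (s + 2) (\<lambda>u. of_bool (excursion_pattern k l s x u) * (?c * heat_bound TYPE('d) ?t))"
    proof (rule pavg_mono)
      fix u :: "(int ^ 'd) list" assume u: "length u = s + 2"
      have "pavg ?t (\<lambda>v. ?f u v) =
         pavg ?t (\<lambda>v. of_bool (excursion_pattern k l s x u) * of_bool ((x + sum_list u) + sum_list v \<in> ?T))"
        using u by (intro pavg_cong) (simp add: add.assoc)
      also have "\<dots> = of_bool (excursion_pattern k l s x u) * pavg ?t (\<lambda>v. of_bool ((x + sum_list u) + sum_list v \<in> ?T))"
        by (rule pavg_cmult)
      also have "\<dots> \<le> of_bool (excursion_pattern k l s x u) * (?c * heat_bound TYPE('d) ?t)"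
        using pavg_mem_le[OF d3, of ?T ?t "x + sum_list u"] unfolding card_ball by (intro mult_left_mono) auto
      finally show "pavg ?t (\<lambda>v. ?f u v) \<le> \<dots>" .
    qed
    also have "\<dots> = pattern_prob 2 k l s x * (?c * heat_bound TYPE('d) ?t)"
      unfolding pattern_prob_def by (rule pavg_multc)
    also have "\<dots> \<le> excursion_weight TYPE('d) (ret_prob TYPE('d)) k l * (?c * heat_bound TYPE('d) ?t)"
      using pattern_prob_le[OF x, of 2 k l s] by (intro mult_right_mono mult_nonneg_nonneg heat_bound_nonneg) auto
    finally show ?thesis by (simp only: mult.assoc)
  qed
  have V: "?V \<ge> 1" using h by simp
  have sum_g: "summable (\<lambda>v. ?w * ?c * heat_bound TYPE('d) (?V + v))"
    by (intro summable_mult summable_heat_bound V)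
  have sum_E: "summable (\<lambda>v. prob (?E v))"
  proof (rule summable_comparison_test)
    show "\<exists>N. \<forall>v\<ge>N. norm (prob (?E v)) \<le> ?w * ?c * heat_bound TYPE('d) (?V + v)"
      using prob_E by (intro exI[of _ 0]) simp
  qed (rule sum_g)
  have "late_visit h s k l x j \<subseteq> (\<Union>v. ?E v)"
  proof
    fix \<omega> assume "\<omega> \<in> late_visit h s k l x j"
    then obtain t where t: "t > j + h" "\<omega> \<in> space M" "excursion_pattern k l s x (steps j (s + 2) \<omega>)"
      "x + sum_list (steps j (t - j) \<omega>) \<in> ?T"
      unfolding late_visit_def by blast
    have "t - j = s + 2 + (?V + (t - j - (s + 2) - ?V))" using t(1) h by simp
    then have "\<omega> \<in> ?E (t - j - (s + 2) - ?V)" using t by simp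
    then show "\<omega> \<in> (\<Union>v. ?E v)" by blast
  qed
  then have "prob (late_visit h s k l x j) \<le> prob (\<Union>v. ?E v)"
    using E by (intro finite_measure_mono) auto
  also have "\<dots> \<le> (\<Sum>v. prob (?E v))"
    using E sum_E by (intro finite_measure_subadditive_countably) auto
  also have "\<dots> \<le> (\<Sum>v. ?w * ?c * heat_bound TYPE('d) (?V + v))"
    using prob_E by (intro suminf_le sum_E sum_g)
  also have "\<dots> = ?w * ?c * (\<Sum>v. heat_bound TYPE('d) (?V + v))"
    by (intro suminf_mult summable_heat_bound V)
  also have "\<dots> \<le> ?w * ?c * (2 * sqrt (real CARD('d) ^ 3) / sqrt (real ?V))"
    using weight_nonneg by (intro mult_left_mono suminf_heat_bound_le V mult_nonneg_nonneg) auto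
  also have "\<dots> = excursion_weight TYPE('d) (ret_prob TYPE('d)) k l * heat_const TYPE('d) / sqrt (real ?V)"
    by (simp add: heat_const_def)
  finally show ?thesis .
qed

text \<open>The position at time \<open>t\<close> relative to the midpoint is minus the sum of the
  steps in between, which are independent of the pattern. The resulting tail is weakened to the form
  of the late bound.\<close>

lemma prob_early_visit_le:
  assumes d3: "CARD('d) \<ge> 3" and x: "x \<in> unit_sphere" and h: "s + 2 \<le> h"
  shows "prob (early_visit h s k l x j) \<le> excursion_weight TYPE('d) (ret_prob TYPE('d)) k l * heat_const TYPE('d) / sqrt (real (h - s - 1))"
proof -
  let ?T = "insert 0 unit_sphere :: (int ^ 'd) set"
  let ?c = "real (2 * CARD('d) + 1)" and ?w = "excursion_weight TYPE('d) (ret_prob TYPE('d)) k l"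
  let ?E = "\<lambda>t. {\<omega> \<in> space M. excursion_pattern k l s x (steps j (s + 2) \<omega>) \<and>
    x - sum_list (steps t (j - t) \<omega>) \<in> ?T}"
  have E: "?E t \<in> events" for t by measurable
  have prob_E: "prob (?E t) \<le> ?w * ?c * heat_bound TYPE('d) (j - t)" if "t < j" for t
  proof -
    let ?u = "j - t"
    let ?f = "\<lambda>u v. of_bool (excursion_pattern k l s x (drop ?u (u @ v)) \<and> x - sum_list (take ?u (u @ v)) \<in> ?T)"
    have E_eq: "?E t = {\<omega> \<in> space M. (\<lambda>w. excursion_pattern k l s x (drop ?u w) \<and> x - sum_list (take ?u w) \<in> ?T) (steps t (?u + (s + 2)) \<omega>)}"
      using that by (simp add: take_steps drop_steps)
    have "prob (?E t) = pavg (?u + (s + 2)) (\<lambda>w. of_bool (excursion_pattern k l s x (drop ?u w) \<and> x - sum_list (take ?u w) \<in> ?T))"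
      unfolding E_eq by (rule prob_steps)
    also have "\<dots> = pavg ?u (\<lambda>u. pavg (s + 2) (\<lambda>v. ?f u v))"
      by (rule pavg_append)
    also have "\<dots> = pavg ?u (\<lambda>u. of_bool (x + sum_list (map uminus u) \<in> ?T) * pattern_prob 2 k l s x)"
    proof (rule pavg_cong)
      fix u :: "(int ^ 'd) list" assume u: "length u = ?u"
      have "sum_list (map uminus u) = - sum_list u"
        by (rule sum_list_map_additive) simp
      then have "pavg (s + 2) (\<lambda>v. ?f u v) =
         pavg (s + 2) (\<lambda>v. of_bool (x + sum_list (map uminus u) \<in> ?T) * of_bool (excursion_pattern k l s x v))"
        unfolding \<open>sum_list (map uminus u) = - sum_list u\<close> using u
        by (intro pavg_cong) (simp del: insert_iff, blast)
      also have "\<dots> = of_bool (x + sum_list (map uminus u) \<in> ?T) * pattern_prob 2 k l s x"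
        unfolding pattern_prob_def by (rule pavg_cmult)
      finally show "pavg (s + 2) (\<lambda>v. ?f u v) = \<dots>" .
    qed
    also have "\<dots> = pavg ?u (\<lambda>u. of_bool (x + sum_list (map uminus u) \<in> ?T)) * pattern_prob 2 k l s x"
      by (rule pavg_multc)
    also have "pavg ?u (\<lambda>u. of_bool (x + sum_list (map uminus u) \<in> ?T)) = pavg ?u (\<lambda>u. of_bool (x + sum_list u \<in> ?T))"
      by (rule pavg_uminus)
    also have "\<dots> * pattern_prob 2 k l s x \<le> (?c * heat_bound TYPE('d) ?u) * excursion_weight TYPE('d) (ret_prob TYPE('d)) k l"
    proof (rule mult_mono)
      show "pavg ?u (\<lambda>u. of_bool (x + sum_list u \<in> ?T)) \<le> ?c * heat_bound TYPE('d) ?u"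
        using pavg_mem_le[OF d3, of ?T ?u x] by (simp only: card_ball finite_insert finite_unit_sphere simp_thms)
    qed (use pattern_prob_le[OF x, of 2 k l s] in \<open>auto intro: mult_nonneg_nonneg heat_bound_nonneg pattern_prob_nonneg\<close>)
    finally show ?thesis by (simp only: mult_ac)
  qed
  have "prob (early_visit h s k l x j) = prob (\<Union>t\<in>{t. t + h < j}. ?E t)"
    by (simp only: early_visit_def)
  also have "\<dots> \<le> (\<Sum>t\<in>{t. t + h < j}. prob (?E t))"
  proof (rule finite_measure_subadditive_finite)
    show "finite {t. t + h < j}" by (rule finite_subset[of _ "{..j}"]) auto
  qed (use E in auto)
  also have "\<dots> \<le> (\<Sum>t\<in>{t. t + h < j}. ?w * ?c * heat_bound TYPE('d) (j - t))"
    by (intro sum_mono prob_E) simp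
  also have "\<dots> = ?w * ?c * (\<Sum>t\<in>{t. t + h < j}. heat_bound TYPE('d) (j - t))"
    by (rule sum_distrib_left[symmetric])
  also have "(\<Sum>t\<in>{t. t + h < j}. heat_bound TYPE('d) (j - t)) = (\<Sum>v<j - h. heat_bound TYPE('d) (h + 1 + v))"
  proof (rule sum.reindex_bij_witness[where i = "\<lambda>v. j - h - 1 - v" and j = "\<lambda>t. j - h - 1 - t"])
    fix t assume "t \<in> {t. t + h < j}"
    then have "h + 1 + (j - h - 1 - t) = j - t" by simp
    then show "heat_bound TYPE('d) (h + 1 + (j - h - 1 - t)) = heat_bound TYPE('d) (j - t)" by (rule arg_cong)
  qed auto
  also have "?w * ?c * (\<Sum>v<j - h. heat_bound TYPE('d) (h + 1 + v)) \<le> ?w * ?c * (2 * sqrt (real CARD('d) ^ 3) / sqrt (real (h + 1)))"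
    using weight_nonneg by (intro mult_left_mono sum_heat_bound_le mult_nonneg_nonneg) auto
  also have "\<dots> \<le> ?w * ?c * (2 * sqrt (real CARD('d) ^ 3) / sqrt (real (h - s - 1)))"
    using weight_nonneg h by (intro mult_left_mono divide_left_mono mult_nonneg_nonneg) auto
  also have "\<dots> = excursion_weight TYPE('d) (ret_prob TYPE('d)) k l * heat_const TYPE('d) / sqrt (real (h - s - 1))"
    by (simp add: heat_const_def)
  finally show ?thesis .
qed

text \<open>If none of these events occurs, then some window is good and the ball is visited only
  inside it.\<close>

definition failure :: "nat \<Rightarrow> nat \<Rightarrow> nat \<Rightarrow> nat \<Rightarrow> nat \<Rightarrow> int ^ 'd \<Rightarrow> 'a set"
  where "failure N h s k l x =
    {\<omega> \<in> space M. \<forall>b<N. \<not> good_window h s k l x (steps (2 * h * b) (2 * h) \<omega>)} \<union>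
    (\<Union>b<N. late_visit h s k l x (2 * h * b + h) \<union> early_visit h s k l x (2 * h * b + h))"

lemma event_failure [measurable]: "failure N h s k l x \<in> events"
  unfolding failure_def by measurable

text \<open>A window is good with probability at least \<open>g\<close>: one escape factor comes
  from its past, the other from the end of the pattern. Independence gives
  \<open>(1 - q) ^ N\<close>, and the spoiling events are summed.\<close>

lemma prob_failure_le:
  fixes k :: nat
  assumes d3: "CARD('d) \<ge> 3" and x: "x \<in> unit_sphere" and h: "s + 2 \<le> h" and "m \<ge> 2" "m * l \<le> s"
  defines "g \<equiv> (esc_prob TYPE('d))\<^sup>2 * excursion_weight TYPE('d) (\<Sum>u<m. hit_kernel u (e 1 :: int ^ 'd)) k l"
  shows "prob (failure N h s k l x) \<le>
    exp (- (real N * g)) + real N * (2 * (excursion_weight TYPE('d) (ret_prob TYPE('d)) k l * heat_const TYPE('d) / sqrt (real (h - s - 1))))"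
proof -
  let ?V = "\<lambda>b. late_visit h s k l x (2 * h * b + h) \<union> early_visit h s k l x (2 * h * b + h)" and ?q = "\<Sum>u<m. hit_kernel u (e 1 :: int ^ 'd)"
  let ?B = "excursion_weight TYPE('d) (ret_prob TYPE('d)) k l * heat_const TYPE('d) / sqrt (real (h - s - 1))"
  let ?G = "{\<omega> \<in> space M. \<forall>b<N. \<not> good_window h s k l x (steps (2 * h * b) (2 * h) \<omega>)}"
  define q where "q = pavg (2 * h) (\<lambda>w. of_bool (good_window h s k l x w))"
  have esc: "esc_prob TYPE('d) > 0" by (rule esc_prob_pos[OF d3])
  have q: "q \<ge> g"
  proof -
    have "avoid_prob h x \<ge> esc_prob TYPE('d)"
      using h by (intro avoid_prob_ge x) simp
    moreover have "pattern_prob (h - s) k l s x \<ge>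
        esc_prob TYPE('d) * excursion_weight TYPE('d) ?q k l"
      using assms esc by (intro pattern_prob_ge) auto
    ultimately have "esc_prob TYPE('d) * (esc_prob TYPE('d) * excursion_weight TYPE('d) ?q k l) \<le> q"
      unfolding q_def using h esc
      by (subst pavg_good_window) (auto intro!: mult_mono mult_nonneg_nonneg excursion_weight_nonneg sum_nonneg hit_kernel_nonneg)
    then show ?thesis by (simp only: g_def power2_eq_square mult.assoc)
  qed
  have "prob ?G = (1 - q) ^ N"
  proof -
    have G_eq: "?G = {\<omega> \<in> space M. (\<lambda>w. \<forall>b<N. \<not> good_window h s k l x (take (2 * h) (drop (2 * h * b) w))) (steps 0 (2 * h * N) \<omega>)}"
    proof -
      have "take (2 * h) (drop (2 * h * b) (steps 0 (2 * h * N) \<omega>)) = steps (2 * h * b) (2 * h) \<omega>" if "b < N" for b \<omega>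
      proof -
        have "2 * h * (b + 1) \<le> 2 * h * N" using that by (intro mult_le_mono2) simp
        then have le: "2 * h * b + 2 * h \<le> 2 * h * N" by simp
        have "drop (2 * h * b) (steps 0 (2 * h * N) \<omega>) = steps (0 + 2 * h * b) (2 * h * N - 2 * h * b) \<omega>"
          by (rule drop_steps) (use le in linarith)
        moreover have "take (2 * h) (steps (2 * h * b) (2 * h * N - 2 * h * b) \<omega>) = steps (2 * h * b) (2 * h) \<omega>"
          by (rule take_steps) (use le in linarith)
        ultimately show ?thesis by (simp only: add_0)
      qed
      then show ?thesis by auto
    qed
    have "prob ?G = pavg (2 * h * N) (\<lambda>w. of_bool (\<forall>b<N. \<not> good_window h s k l x (take (2 * h) (drop (2 * h * b) w))))"
      unfolding G_eq by (rule prob_steps)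
    also have "\<dots> = pavg (2 * h) (\<lambda>w. of_bool (\<not> good_window h s k l x w)) ^ N"
      by (rule pavg_blocks)
    also have "pavg (2 * h) (\<lambda>w. of_bool (\<not> good_window h s k l x w)) = 1 - q"
    proof -
      have "pavg (2 * h) (\<lambda>w. of_bool (\<not> good_window h s k l x w)) = pavg (2 * h) (\<lambda>w. 1 - of_bool (good_window h s k l x w))"
        by (rule pavg_cong) simp
      then show ?thesis by (simp only: pavg_diff pavg_const q_def)
    qed
    finally show ?thesis .
  qed
  also have "\<dots> \<le> exp (- q) ^ N"
  proof (rule power_mono)
    show "1 - q \<le> exp (- q)" using exp_ge_add_one_self[of "- q"] by simp
    have "q \<le> pavg (2 * h) (\<lambda>w :: (int ^ 'd) list. 1)" unfolding q_def by (rule pavg_mono) simp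
    then show "0 \<le> 1 - q" by simp
  qed
  also have "\<dots> = exp (- (real N * q))" by (simp flip: exp_of_nat_mult)
  also have "\<dots> \<le> exp (- (real N * g))" using q by (simp add: mult_left_mono)
  finally have G: "prob ?G \<le> exp (- (real N * g))" .
  have "prob (\<Union>b<N. ?V b)
      \<le> (\<Sum>b<N. prob (?V b))"
    by (rule finite_measure_subadditive_finite) auto
  also have "\<dots> \<le> (\<Sum>b<N. ?B + ?B)"
  proof (rule sum_mono)
    fix b
    have "prob (?V b) \<le>
        prob (late_visit h s k l x (2 * h * b + h)) + prob (early_visit h s k l x (2 * h * b + h))"
      by (rule measure_Un_le) auto
    also have "\<dots> \<le> ?B + ?B"
      by (intro add_mono prob_late_visit_le prob_early_visit_le d3 x h)
    finally show "prob (?V b) \<le> ?B + ?B" .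
  qed
  also have "\<dots> = real N * (2 * ?B)" by simp
  finally have L: "prob (\<Union>b<N. ?V b) \<le> real N * (2 * ?B)" .
  have "prob (failure N h s k l x) \<le> prob ?G + prob (\<Union>b<N. ?V b)"
    unfolding failure_def by (rule measure_Un_le) measurable
  then show ?thesis using G L by linarith
qed

text \<open>Visits are excluded after the window, before it, and in its first half, so all of them
  are seen by the pattern. Only the midpoint is added: it lies on the sphere at a positive time,
  hence \<open>Suc l\<close>.\<close>

lemma good_window_times:
  assumes good: "good_window h s k l (- e i) (steps (2 * h * b) (2 * h) \<omega>)"
    and S: "\<And>j t. set (steps j t \<omega>) \<subseteq> unit_sphere" and fin: "\<And>z. finite {n. walk X \<omega> n = z}"
    and "\<omega> \<in> space M" and h: "s + 2 \<le> h" and i: "i \<in> {1..2 * CARD('d)}"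
    and late: "\<omega> \<notin> late_visit h s k l (- e i) (2 * h * b + h)"
    and early: "\<omega> \<notin> early_visit h s k l (- e i) (2 * h * b + h)"
  shows "local_time (walk X \<omega>) (walk X \<omega> (2 * h * b + h) + e i) = enat k"
    and "occupation_time (walk X \<omega>) (walk X \<omega> (2 * h * b + h) + e i) = enat (Suc l)"
proof -
  let ?w = "walk X \<omega>"
  let ?T = "insert 0 unit_sphere :: (int ^ 'd) set"
  let ?x = "- e i :: int ^ 'd"
  define j where "j = 2 * h * b + h"
  define z where "z = ?w j + e i"
  have x: "?x \<in> unit_sphere" using e_mem_sphere[OF i] by simp
  have rel: "?x + (?w n - ?w j) = ?w n - z" for n by (simp add: z_def)
  have past: "visits ?T ?x (map uminus (rev (steps (2 * h * b) h \<omega>))) = 0"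
    and pat: "excursion_pattern k l s ?x (steps j h \<omega>)"
    using good by (simp_all add: good_window_def take_steps drop_steps j_def)
  have pat': "excursion_pattern k l s ?x (steps j (s + 2) \<omega>)"
    using excursion_pattern_take[OF pat S] h by (simp add: take_steps)
  have not_late: "?w n - z \<notin> ?T" if "n > j + h" for n
  proof
    assume "?w n - z \<in> ?T"
    moreover have "?x + sum_list (steps j (n - j) \<omega>) = ?w n - z"
      using that by (simp add: sum_list_steps z_def)
    ultimately have "?x + sum_list (steps j (n - j) \<omega>) \<in> ?T" by (simp only:)
    then have "\<omega> \<in> late_visit h s k l ?x j"
      unfolding late_visit_def using that pat' \<open>\<omega> \<in> space M\<close> by blast
    then show False using late by (simp add: j_def)
  qed
  have not_early: "?w n - z \<notin> ?T" if "n + h < j" for n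
  proof
    assume "?w n - z \<in> ?T"
    moreover have "?x - sum_list (steps n (j - n) \<omega>) = ?w n - z"
      using that by (simp add: sum_list_steps z_def)
    ultimately have "\<omega> \<in> early_visit h s k l ?x j"
      unfolding early_visit_def using that pat' \<open>\<omega> \<in> space M\<close> by (intro UN_I[of n]) auto
    then show False using early by (simp add: j_def)
  qed
  have not_past: "?w (j - u) - z \<notin> ?T" if u: "u \<in> {1..h}" for u
  proof
    let ?p = "steps (2 * h * b) h \<omega>"
    assume "?w (j - u) - z \<in> ?T"
    \<comment> \<open>Reversal turns the last \<open>u\<close> steps of the first half into the
      displacement from time \<open>j\<close> back to time \<open>j - u\<close>.\<close>
    moreover have "sum_list (take u (map uminus (rev ?p))) = ?w (j - u) - ?w j"
    proof -
      have "take u (map uminus (rev ?p)) = map uminus (rev (drop (h - u) ?p))"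
        by (simp add: take_map take_rev)
      also have "drop (h - u) ?p = steps (2 * h * b + (h - u)) (h - (h - u)) \<omega>"
        by (rule drop_steps) simp
      also have "sum_list (map uminus (rev (steps (2 * h * b + (h - u)) (h - (h - u)) \<omega>))) =
          - sum_list (rev (steps (2 * h * b + (h - u)) (h - (h - u)) \<omega>))"
        by (rule sum_list_map_additive) simp
      also have "\<dots> = - (?w (2 * h * b + (h - u) + (h - (h - u))) - ?w (2 * h * b + (h - u)))"
        by (simp only: sum_list_rev sum_list_steps)
      also have "2 * h * b + (h - u) + (h - (h - u)) = j"
        using u by (simp add: j_def)
      also have "2 * h * b + (h - u) = j - u"
        using u by (simp add: j_def)
      finally show ?thesis by simp
    qed
    ultimately have "?x + sum_list (take u (map uminus (rev ?p))) \<in> ?T"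
      by (simp only: rel)
    then have "u \<in> {i \<in> {1..length (map uminus (rev ?p))}. ?x + sum_list (take i (map uminus (rev ?p))) \<in> ?T}"
      using u by (simp del: insert_iff)
    moreover have "finite {i \<in> {1..length (map uminus (rev ?p))}. ?x + sum_list (take i (map uminus (rev ?p))) \<in> ?T}"
      by simp
    ultimately have "visits ?T ?x (map uminus (rev ?p)) \<noteq> 0"
      unfolding visits_eq_card by (subst card_0_eq) blast+
    then show False using past by (rule notE)
  qed
  have window: "j \<le> n \<and> n \<le> j + h" if "?w n - z \<in> ?T" for n
  proof (rule ccontr)
    assume not: "\<not> (j \<le> n \<and> n \<le> j + h)"
    have "n \<le> j + h" using not_late[of n] that by (cases "n > j + h") auto
    moreover have "j \<le> n + h" using not_early[of n] that by (cases "n + h < j") auto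
    ultimately have "j - n \<in> {1..h}" "j - (j - n) = n" using not by auto
    then show False using not_past[of "j - n"] that by simp
  qed
  have "j > 0" using h by (simp add: j_def)
  have z_ne: "?w j \<noteq> z" "?w j - z \<in> unit_sphere"
    using x by (auto simp: z_def)
  have C: "{n. n > 0 \<and> ?w n = z} = {n \<in> {j<..j + h}. ?x + (?w n - ?w j) \<in> {0}}"
  proof -
    have "n > 0 \<and> n \<in> {j<..j + h}" if "?w n = z" for n
    proof -
      have "n \<noteq> j" using that z_ne(1) by blast
      then show ?thesis using window[of n] that by simp
    qed
    then show ?thesis unfolding rel by (intro set_eqI) (simp, blast)
  qed
  have O: "{n. n > 0 \<and> ?w n - z \<in> unit_sphere} = insert j {n \<in> {j<..j + h}. ?x + (?w n - ?w j) \<in> unit_sphere}"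
  proof -
    have "n = j \<or> n \<in> {j<..j + h}" if "?w n - z \<in> unit_sphere" for n
      using window[of n] that by auto
    then show ?thesis unfolding rel using \<open>j > 0\<close> z_ne(2) by auto
  qed
  have "local_time ?w z = enat k"
    unfolding local_time_eq[OF fin] C using pat by (simp only: visits_steps_shifted[symmetric] excursion_pattern_def)
  then show "local_time ?w (?w (2 * h * b + h) + e i) = enat k" by (simp only: z_def j_def)
  have "visits unit_sphere ?x (take s (steps j h \<omega>) @ drop s (steps j h \<omega>)) = l"
    unfolding visits_append using pat by (simp only: excursion_pattern_def)
  then have "card {n \<in> {j<..j + h}. ?x + (?w n - ?w j) \<in> unit_sphere} = l"
    by (simp only: append_take_drop_id visits_steps_shifted)
  then have "occupation_time ?w z = enat (Suc l)"
    unfolding occupation_time_eq[OF fin] O by simp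
  then show "occupation_time ?w (?w (2 * h * b + h) + e i) = enat (Suc l)" by (simp only: z_def j_def)
qed

lemma not_failureE:
  assumes "\<omega> \<notin> failure N h s k l (- e i)" "\<omega> \<in> space M"
    and "\<And>j t. set (steps j t \<omega>) \<subseteq> unit_sphere" "\<And>z. finite {n. walk X \<omega> n = z}"
    and "s + 2 \<le> h" "i \<in> {1..2 * CARD('d)}"
  obtains j where "j \<le> 2 * h * N" "local_time (walk X \<omega>) (walk X \<omega> j + e i) = enat k"
    "occupation_time (walk X \<omega>) (walk X \<omega> j + e i) = enat (Suc l)"
proof -
  from assms(1,2) obtain b where b: "b < N" "good_window h s k l (- e i) (steps (2 * h * b) (2 * h) \<omega>)"
    "\<omega> \<notin> late_visit h s k l (- e i) (2 * h * b + h)" "\<omega> \<notin> early_visit h s k l (- e i) (2 * h * b + h)"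
    unfolding failure_def by blast
  have "2 * h * (b + 1) \<le> 2 * h * N" using b(1) by (intro mult_le_mono2) simp
  then have "2 * h * b + h \<le> 2 * h * N" by simp
  moreover note good_window_times[OF b(2) assms(3,4,2,5,6) b(3,4)]
  ultimately show thesis by (rule that)
qed

end

section \<open>Choice of scales\<close>

lemma eventually_poly_le_power2: "\<forall>\<^sub>F t in sequentially. (c * (real t + 1)) ^ 4 \<le> 2 ^ t"
proof -
  let ?x = "root 4 2 :: real"
  have x: "?x > 1" "?x ^ 4 = 2" by simp_all
  have "(\<lambda>t. c * (real t / ?x ^ t + 1 / ?x ^ t)) \<longlonglongrightarrow> c * (0 + 0)"
  proof (intro tendsto_intros)
    show "(\<lambda>t. real t / ?x ^ t) \<longlonglongrightarrow> 0" using x lim_n_over_pown[of ?x] by simp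
    show "(\<lambda>t. 1 / ?x ^ t) \<longlonglongrightarrow> 0"
      using LIMSEQ_inverse_realpow_zero[OF x(1)] by (simp add: inverse_eq_divide)
  qed
  then have "(\<lambda>t. \<bar>c * (real t / ?x ^ t + 1 / ?x ^ t)\<bar>) \<longlonglongrightarrow> 0"
    by (intro tendsto_rabs_zero) simp
  then have "\<forall>\<^sub>F t in sequentially. \<bar>c * (real t / ?x ^ t + 1 / ?x ^ t)\<bar> < 1"
    by (rule order_tendstoD) simp
  then show ?thesis
  proof eventually_elim
    case (elim t)
    have pos: "?x ^ t > 0" using x by simp
    have "c * (real t / ?x ^ t + 1 / ?x ^ t) = c * (real t + 1) / ?x ^ t"
      by (simp add: add_divide_distrib distrib_left)
    then have "\<bar>c * (real t + 1)\<bar> \<le> ?x ^ t"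
      using elim pos by (simp add: abs_divide divide_less_eq)
    then have "\<bar>c * (real t + 1)\<bar> ^ 4 \<le> (?x ^ t) ^ 4"
      by (intro power_mono) auto
    also have "(?x ^ t) ^ 4 = 2 ^ t"
      using x(2) by (metis power_mult mult.commute)
    finally show ?case by (simp add: power_even_abs)
  qed
qed

text \<open>Only the \<open>l - k\<close> direct excursions feel the truncation, each losing at most
  a factor \<open>exp (- \<eta>)\<close>.\<close>

lemma excursion_weight_ratio:
  assumes "0 < q" "q * exp (- \<eta>) \<le> q'" "\<eta> \<ge> 0"
  shows "excursion_weight T q' k l \<ge> excursion_weight T q k l * exp (- (\<eta> * real l))"
proof -
  have "exp (- (\<eta> * real l)) \<le> exp (- (\<eta> * real (l - k)))"
    using assms by (simp add: mult_left_mono)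
  also have "\<dots> = exp (- \<eta>) ^ (l - k)" by (simp flip: exp_of_nat_mult add: mult.commute)
  finally have "q ^ (l - k) * exp (- (\<eta> * real l)) \<le> q ^ (l - k) * exp (- \<eta>) ^ (l - k)"
    using assms by (intro mult_left_mono) auto
  also have "\<dots> = (q * exp (- \<eta>)) ^ (l - k)" by (rule power_mult_distrib[symmetric])
  also have "\<dots> \<le> q' ^ (l - k)"
    using assms by (intro power_mono) auto
  finally have "real (l choose k) * (1 / (2 * real CARD('a))) ^ k * (q ^ (l - k) * exp (- (\<eta> * real l))) \<le>
      real (l choose k) * (1 / (2 * real CARD('a))) ^ k * q' ^ (l - k)"
    by (intro mult_left_mono) auto
  then show ?thesis by (simp only: excursion_weight_def mult.assoc)
qed

lemma window_room:
  fixes a b c :: nat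
  assumes "2 * (c + 2) \<le> b" "a \<le> c"
  shows "a + 2 \<le> b" and "b \<le> 4 * (b - a - 1)"
proof -
  have "2 * a + 4 \<le> b" using assms by simp
  then obtain y where "b = 2 * a + 4 + y" using le_Suc_ex by blast
  then show "a + 2 \<le> b" "b \<le> 4 * (b - a - 1)" by simp_all
qed

context simple_random_walk
begin

text \<open>A pattern of probability \<open>W\<close> is sought in about \<open>4 ^ t / W\<close> windows of half-width \<open>2 ^ (8 * t)\<close>.
  These fit into \<open>2 ^ (8 * K * t)\<close> steps as \<open>W\<close> is at least \<open>2 ^ (- (1 - \<epsilon>) * 8 * K * t)\<close> up to a
  polynomial factor. Truncating the excursions at length \<open>m\<close> costs a factor of at most \<open>2 ^ t\<close>.\<close>

lemma failure_estimate:
  fixes k l m B t K :: nat and \<epsilon> :: real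
  defines "p \<equiv> ret_prob TYPE('d)"
  defines "W \<equiv> excursion_weight TYPE('d) p k l"
  defines "N \<equiv> nat \<lceil>4 ^ t / W\<rceil>"
  assumes d3: "CARD('d) \<ge> 3" and "\<epsilon> > 0" and K: "8 * real K * \<epsilon> \<ge> 11"
    and B: "B > 0" and m: "m \<ge> 2" "p * exp (- (ln 2 / real B)) \<le> (\<Sum>u<m. hit_kernel u (e 1 :: int ^ 'd))"
    and kl: "k \<le> l" "l \<le> B * t" and rate: "rate CARD('d) p (real k) (real l) \<le> (1 - \<epsilon>) * (8 * real K * real t * ln 2)"
    and poly: "4 * (exp 2 * (real (B * t) + 1)\<^sup>2) \<le> 2 ^ t" and h: "2 * (m * (B * t) + 2) \<le> 2 ^ (8 * t)"
    and x: "x \<in> unit_sphere"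
  shows "2 * 2 ^ (8 * t) * N \<le> 2 ^ (8 * K * t)"
    and "prob (failure N (2 ^ (8 * t)) (m * l) k l x) \<le> (1 / (esc_prob TYPE('d))\<^sup>2 + 8 * heat_const TYPE('d)) / 2 ^ t"
proof -
  have p: "p > 0" unfolding p_def by (rule ret_prob_pos)
  have esc: "esc_prob TYPE('d) > 0" by (rule esc_prob_pos[OF d3])
  have r: "p + 1 / (2 * real CARD('d)) < 1" using esc by (simp add: esc_prob_def p_def)
  define Q where "Q = exp 2 * (real (B * t) + 1)\<^sup>2"
  define E where "E = 8 * real K * real t * ln 2"
  have expE: "exp E = 2 ^ (8 * K * t)"
  proof -
    have "E = real (8 * K * t) * ln 2" by (simp add: E_def)
    then show ?thesis by (simp only: exp_of_nat_mult) simp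
  qed
  have Q: "Q > 0" unfolding Q_def by (intro mult_pos_pos zero_less_power) (auto intro: add_nonneg_pos)
  have "exp (- ((1 - \<epsilon>) * E)) \<le> exp (- rate CARD('d) p (real k) (real l))"
    using rate by (simp add: E_def)
  also have "\<dots> \<le> exp 2 * (real l + 1)\<^sup>2 * W"
    unfolding W_def by (rule excursion_weight_ge_exp[OF kl(1) p])
  also have "\<dots> \<le> Q * W"
  proof -
    have "real l \<le> real (B * t)" using kl(2) by (simp only: of_nat_le_iff)
    then have "(real l + 1)\<^sup>2 \<le> (real (B * t) + 1)\<^sup>2" by (intro power_mono) auto
    then show ?thesis unfolding Q_def W_def using p
      by (intro mult_right_mono mult_left_mono excursion_weight_nonneg) auto
  qed
  finally have W_ge: "exp (- ((1 - \<epsilon>) * E)) \<le> Q * W" .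
  then have "Q * W > 0" using exp_gt_zero[of "- ((1 - \<epsilon>) * E)"] by linarith
  then have W: "W > 0" using Q by (simp add: zero_less_mult_iff)
  have W1: "W \<le> 1"
  proof -
    have "W \<le> (p + 1 / (2 * real CARD('d))) ^ l"
      unfolding W_def using p by (intro excursion_weight_le_power) simp
    also have "\<dots> \<le> 1" using p r by (intro power_le_one) (auto intro: add_nonneg_nonneg)
    finally show ?thesis .
  qed
  have NW: "real N \<ge> 4 ^ t / W" unfolding N_def by linarith
  have "real N \<le> 4 ^ t / W + 1"
    unfolding N_def using W by (simp add: of_nat_nat ceiling_correct order.strict_implies_order le_of_int_ceiling)
  moreover have "1 \<le> 4 ^ t / W"
  proof -
    have "W \<le> 4 ^ t" using W1 one_le_power[of "4 :: real" t] by linarith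
    then show ?thesis using W by (simp add: le_divide_eq)
  qed
  ultimately have N2: "real N \<le> 2 * (4 ^ t / W)" by linarith
  have inv_W: "1 / W \<le> Q * exp ((1 - \<epsilon>) * E)"
  proof -
    have "exp (- ((1 - \<epsilon>) * E)) * exp ((1 - \<epsilon>) * E) \<le> Q * W * exp ((1 - \<epsilon>) * E)"
      using W_ge by (intro mult_right_mono) auto
    then have "1 \<le> Q * exp ((1 - \<epsilon>) * E) * W"
      by (simp add: mult_exp_exp mult_ac)
    then show ?thesis using W by (simp add: divide_le_eq)
  qed
  have "exp ((1 - \<epsilon>) * E) = 2 ^ (8 * K * t) / exp (\<epsilon> * E)"
    by (simp add: left_diff_distrib exp_diff expE)
  \<comment> \<open>11 = 8 + 2 + 1: the width \<open>2 ^ (8 * t)\<close>, the factor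
    \<open>4 ^ t\<close> in the number of windows, and a spare \<open>2 ^ t\<close> that absorbs
    \<open>4 * Q\<close>.\<close>
  also have "\<dots> \<le> 2 ^ (8 * K * t) / 2 ^ (11 * t)"
  proof -
    have "11 * (real t * ln 2) \<le> 8 * real K * \<epsilon> * (real t * ln 2)"
      using K by (intro mult_right_mono) auto
    then have "real (11 * t) * ln 2 \<le> \<epsilon> * E" by (simp add: E_def mult_ac)
    then have "exp (real (11 * t) * ln 2) \<le> exp (\<epsilon> * E)" by simp
    then have "2 ^ (11 * t) \<le> exp (\<epsilon> * E)" by (simp only: exp_of_nat_mult) simp
    then show ?thesis by (intro divide_left_mono) auto
  qed
  finally have exp_le: "exp ((1 - \<epsilon>) * E) \<le> 2 ^ (8 * K * t) / 2 ^ (11 * t)" .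
  have "2 * 2 ^ (8 * t) * real N \<le> 2 * 2 ^ (8 * t) * (2 * (4 ^ t / W))"
    using N2 by (intro mult_left_mono) auto
  also have "\<dots> = 4 * 2 ^ (8 * t) * 4 ^ t * (1 / W)" by simp
  also have "\<dots> \<le> 4 * 2 ^ (8 * t) * 4 ^ t * (Q * (2 ^ (8 * K * t) / 2 ^ (11 * t)))"
    using inv_W exp_le Q by (intro mult_left_mono order_trans[OF inv_W]) auto
  also have "\<dots> = (4 * Q) * (2 ^ (8 * K * t) * (2 ^ (8 * t) * 4 ^ t / 2 ^ (11 * t)))" by simp
  also have "2 ^ (8 * t) * 4 ^ t / 2 ^ (11 * t) = 1 / (2 :: real) ^ t"
  proof -
    have "(4 :: real) ^ t = 2 ^ (2 * t)" by (simp add: power_mult)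
    moreover have "(2 :: real) ^ (11 * t) = 2 ^ (8 * t) * 2 ^ (2 * t) * 2 ^ t"
      by (simp flip: power_add)
    ultimately show ?thesis by simp
  qed
  also have "(4 * Q) * (2 ^ (8 * K * t) * (1 / 2 ^ t)) = 2 ^ (8 * K * t) * (4 * Q / 2 ^ t)" by simp
  also have "\<dots> \<le> 2 ^ (8 * K * t) * 1"
    using poly by (intro mult_left_mono) (auto simp: Q_def divide_le_eq_1)
  finally have "real (2 * 2 ^ (8 * t) * N) \<le> real (2 ^ (8 * K * t))" by simp
  then show "2 * 2 ^ (8 * t) * N \<le> 2 ^ (8 * K * t)" by (simp only: of_nat_le_iff)

  let ?c = "(esc_prob TYPE('d))\<^sup>2" and ?h = "heat_const TYPE('d)"
  let ?H = "2 ^ (8 * t) :: nat" and ?q = "\<Sum>u<m. hit_kernel u (e 1 :: int ^ 'd)"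
  have s: "m * l \<le> m * (B * t)" using kl(2) by (rule mult_le_mono2)
  have hs: "m * l + 2 \<le> ?H" by (rule window_room(1)[OF h s])
  have gap: "?H \<le> 4 * (?H - m * l - 1)" by (rule window_room(2)[OF h s])
  let ?g = "?c * excursion_weight TYPE('d) ?q k l"
  have "W * exp (- (ln 2 / real B * real l)) \<le> excursion_weight TYPE('d) ?q k l"
    unfolding W_def by (rule excursion_weight_ratio[OF p m(2)]) simp
  moreover have "W * (1 / 2 ^ t) \<le> W * exp (- (ln 2 / real B * real l))"
  proof -
    have "real l \<le> real B * real t" using kl(2) by (metis of_nat_le_iff of_nat_mult)
    then have "ln 2 / real B * real l \<le> ln 2 / real B * (real B * real t)"
      by (intro mult_left_mono) auto
    also have "\<dots> = real t * ln 2" using B by simp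
    finally have "exp (- (real t * ln 2)) \<le> exp (- (ln 2 / real B * real l))" by simp
    moreover have "exp (- (real t * ln 2)) = 1 / 2 ^ t"
      by (simp add: exp_minus exp_of_nat_mult inverse_eq_divide)
    ultimately show ?thesis using W by (intro mult_left_mono) auto
  qed
  ultimately have "W * (1 / 2 ^ t) \<le> excursion_weight TYPE('d) ?q k l" by linarith
  then have g: "?c * (W * (1 / 2 ^ t)) \<le> ?g"
    by (intro mult_left_mono) auto
  \<comment> \<open>Even after the truncation the \<open>4 ^ t / W\<close> windows have at least
    \<open>2 ^ t\<close> expected successes, up to a constant.\<close>
  have "?c * 2 ^ t = 4 ^ t / W * (?c * (W * (1 / 2 ^ t)))"
  proof -
    have "(4 :: real) ^ t = 2 ^ t * 2 ^ t" by (simp flip: power_mult_distrib)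
    then show ?thesis using W by simp
  qed
  also have "\<dots> \<le> real N * ?g"
    using W by (intro mult_mono[OF NW g]) auto
  finally have Ng: "?c * 2 ^ t \<le> real N * ?g" .
  have pos: "?c * 2 ^ t > 0" using esc by simp
  have "exp (- (real N * ?g)) \<le> exp (- (?c * 2 ^ t))" using Ng by simp
  also have "\<dots> \<le> 1 / (?c * 2 ^ t)"
  proof -
    have "?c * 2 ^ t \<le> exp (?c * 2 ^ t)"
      using exp_ge_add_one_self[of "?c * 2 ^ t"] by linarith
    then show ?thesis using pos by (simp add: exp_minus inverse_eq_divide frac_le)
  qed
  finally have first: "exp (- (real N * ?g)) \<le> 1 / ?c / 2 ^ t" by simp
  \<comment> \<open>The square root of the half-width has to beat \<open>N * W\<close>, which is of
    order \<open>4 ^ t\<close>; the exponent 8 ensures this with room to spare.\<close>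
  have sqrt_gap: "1 / sqrt (real (?H - m * l - 1)) \<le> 2 / 2 ^ (4 * t)"
  proof -
    have "(2 ^ (4 * t) / 2)\<^sup>2 = (2 :: real) ^ (8 * t) / 4"
      by (simp add: power_divide flip: power_mult)
    also have "\<dots> \<le> real (?H - m * l - 1)"
    proof -
      have "real ?H \<le> real (4 * (?H - m * l - 1))" using gap by (simp only: of_nat_le_iff)
      then show ?thesis by simp
    qed
    finally have "2 ^ (4 * t) / 2 \<le> sqrt (real (?H - m * l - 1))" by (rule real_le_rsqrt)
    then have "1 / sqrt (real (?H - m * l - 1)) \<le> 1 / (2 ^ (4 * t) / 2)"
      by (intro frac_le) auto
    then show ?thesis by simp
  qed
  have "real N * (2 * (W * ?h / sqrt (real (?H - m * l - 1)))) =
      2 * ?h * (real N * W) * (1 / sqrt (real (?H - m * l - 1)))" by simp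
  also have "\<dots> \<le> 2 * ?h * (2 * 4 ^ t) * (2 / 2 ^ (4 * t))"
  proof -
    have "real N * W \<le> 2 * 4 ^ t" using N2 W by (simp add: le_divide_eq)
    then have "2 * ?h * (real N * W) \<le> 2 * ?h * (2 * 4 ^ t)"
      by (rule mult_left_mono) (simp add: heat_const_nonneg)
    then show ?thesis
      by (rule mult_mono[OF _ sqrt_gap]) (simp_all add: heat_const_nonneg)
  qed
  also have "\<dots> = 8 * ?h * (4 ^ t / 2 ^ (4 * t))" by simp
  also have "\<dots> \<le> 8 * ?h * (1 / 2 ^ t)"
  proof -
    have "(2 :: real) ^ (4 * t) = 4 ^ t * 4 ^ t" by (simp add: power_mult flip: power_mult_distrib)
    then have "(4 :: real) ^ t / 2 ^ (4 * t) = 1 / 4 ^ t" by simp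
    also have "\<dots> \<le> 1 / 2 ^ t" by (intro divide_left_mono power_mono) auto
    finally show ?thesis using heat_const_nonneg by (intro mult_left_mono) auto
  qed
  finally have second: "real N * (2 * (W * ?h / sqrt (real (?H - m * l - 1)))) \<le> 8 * ?h / 2 ^ t"
    by simp
  have "prob (failure N ?H (m * l) k l x) \<le> exp (- (real N * ?g)) + real N * (2 * (W * ?h / sqrt (real (?H - m * l - 1))))"
    unfolding W_def p_def by (rule prob_failure_le[OF d3 x hs m(1) order_refl])
  also have "\<dots> \<le> 1 / ?c / 2 ^ t + 8 * ?h / 2 ^ t"
    using first second by (rule add_mono)
  finally show "prob (failure N ?H (m * l) k l x) \<le> (1 / ?c + 8 * ?h) / 2 ^ t"
    by (simp add: add_divide_distrib)
qed

text \<open>Along the times \<open>2 ^ (8 * K * t)\<close> the failure probability of order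
  \<open>1 / 2 ^ t\<close>, multiplied by the polynomially many pairs, is summable, and
  Borel-Cantelli applies.\<close>

lemma AE_joint_lower_dyadic:
  assumes d3: "CARD('d) \<ge> 3" and "0 < \<epsilon>" "\<epsilon> \<le> 1"
  obtains K :: nat where "K \<ge> 1"
    "AE \<omega> in M. \<forall>\<^sub>F t in sequentially. \<forall>k l. k \<le> l \<longrightarrow>
      rate CARD('d) (ret_prob TYPE('d)) (real k) (real l) \<le> (1 - \<epsilon>) * (8 * real K * real t * ln 2) \<longrightarrow>
      (\<forall>i\<in>{1..2 * CARD('d)}. \<exists>j\<le>2 ^ (8 * K * t). local_time (walk X \<omega>) (walk X \<omega> j + e i) = enat k \<and>
        occupation_time (walk X \<omega>) (walk X \<omega> j + e i) = enat (Suc l))"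
proof -
  let ?p = "ret_prob TYPE('d)" and ?I = "{1..2 * CARD('d)}"
  let ?ok = "\<lambda>\<omega> k l i j. local_time (walk X \<omega>) (walk X \<omega> j + e i) = enat k \<and>
    occupation_time (walk X \<omega>) (walk X \<omega> j + e i) = enat (Suc l)"
  \<comment> \<open>Chosen for \<open>8 * K * \<epsilon> \<ge> 11\<close>; a large \<open>K\<close>
    makes a window short compared with the whole time span.\<close>
  define K where "K = nat \<lceil>11 / (8 * \<epsilon>)\<rceil> + 1"
  have K: "K \<ge> 1" "8 * real K * \<epsilon> \<ge> 11"
  proof -
    have "real K \<ge> 11 / (8 * \<epsilon>)" unfolding K_def by linarith
    then show "8 * real K * \<epsilon> \<ge> 11" using \<open>0 < \<epsilon>\<close> by (simp add: field_simps)
  qed (simp add: K_def)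
  \<comment> \<open>The linear growth of \<open>rate\<close> in \<open>l\<close> from
    \<open>rate_ge\<close>, positive because escape is possible. It confines the pairs to
    \<open>l \<le> B * t\<close>.\<close>
  define lam where "lam = - ln (?p + 1 / (2 * real CARD('d)))"
  have p: "?p > 0" by (rule ret_prob_pos)
  have lam: "lam > 0"
    using p esc_prob_pos[OF d3] unfolding lam_def esc_prob_def
    by (simp add: ln_less_zero add_pos_nonneg)
  define B where "B = nat \<lceil>8 * real K * ln 2 / lam\<rceil> + 1"
  have B: "B > 0" "real B \<ge> 8 * real K * ln 2 / lam"
    unfolding B_def by simp linarith
  have l_le: "l \<le> B * t" if "k \<le> l" "rate CARD('d) ?p (real k) (real l) \<le> (1 - \<epsilon>) * (8 * real K * real t * ln 2)" for k l t
  proof -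
    have "real l * lam \<le> rate CARD('d) ?p (real k) (real l)"
      using rate_ge[of "real k" "real l" ?p "CARD('d)"] that p by (simp add: lam_def)
    also have "\<dots> \<le> (1 - \<epsilon>) * (8 * real K * real t * ln 2)" by (rule that)
    also have "\<dots> \<le> 1 * (8 * real K * real t * ln 2)"
      using \<open>0 < \<epsilon>\<close> by (intro mult_right_mono) auto
    finally have "real l \<le> 8 * real K * ln 2 / lam * real t"
      using lam by (simp add: field_simps)
    also have "\<dots> \<le> real B * real t" using B(2) by (intro mult_right_mono) auto
    finally show ?thesis by (metis of_nat_le_iff of_nat_mult)
  qed
  \<comment> \<open>A loss of \<open>exp (- ln 2 / B)\<close> per excursion amounts to at most a
    factor \<open>2 ^ t\<close> over \<open>B * t\<close> excursions.\<close>
  obtain m where m: "m \<ge> 2" "?p * exp (- (ln 2 / real B)) \<le> (\<Sum>u<m. hit_kernel u (e 1 :: int ^ 'd))"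
  proof -
    have "?p * exp (- (ln 2 / real B)) < ?p" using p B(1) by simp
    then have "\<forall>\<^sub>F m in sequentially. ?p * exp (- (ln 2 / real B)) < (\<Sum>u<m. hit_kernel u (e 1 :: int ^ 'd))"
      using hit_kernel_sums[where 'd = 'd] unfolding sums_def by (intro order_tendstoD(1))
    then have "\<forall>\<^sub>F m in sequentially. m \<ge> 2 \<and> ?p * exp (- (ln 2 / real B)) < (\<Sum>u<m. hit_kernel u (e 1 :: int ^ 'd))"
      using eventually_ge_at_top[of 2] by eventually_elim blast
    then obtain m where "m \<ge> 2 \<and> ?p * exp (- (ln 2 / real B)) < (\<Sum>u<m. hit_kernel u (e 1 :: int ^ 'd))"
      unfolding eventually_sequentially by blast
    then show thesis by (intro that[of m]) auto
  qed
  define C where "C = 1 / (esc_prob TYPE('d))\<^sup>2 + 8 * heat_const TYPE('d)"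
  have C: "C \<ge> 0" unfolding C_def by (intro add_nonneg_nonneg mult_nonneg_nonneg heat_const_nonneg) auto
  \<comment> \<open>Large enough for the polynomial loss of \<open>binomial_lower\<close>, for the
    room in a window and for the number of pairs.\<close>
  define c where "c = 2 * exp 1 * (real B + 1) + 2 * real m * real B + 4"
  \<comment> \<open>The fourth power leaves one square for polynomial factors and another for
    summability in \<open>t\<close>.\<close>
  let ?big = "\<lambda>t::nat. (c * (real t + 1)) ^ 4 \<le> 2 ^ t"
  have c_ge: "2 * exp 1 * (real B + 1) \<le> c" "2 * real m * real B + 4 \<le> c"
    unfolding c_def by auto
  have c4: "4 \<le> c"
  proof -
    have "0 \<le> 2 * real m * real B" by simp
    then show ?thesis using c_ge(2) by linarith
  qed
  have c_lin: "z * real t + y \<le> c * (real t + 1)" if "z \<le> c" "y \<le> c" for z y t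
    using mult_right_mono[OF that(1), of "real t"] that(2) by (simp add: distrib_left)
  have c1: "c * (real t + 1) \<ge> 1" for t using c_lin[of 0 1 t] c4 by linarith
  have square_le: "(c * (real t + 1))\<^sup>2 \<le> 2 ^ t" if "?big t" for t
    using order_trans[OF power_increasing[of 2 4 "c * (real t + 1)"] that] c1 by simp
  have exp_B: "2 * exp 1 * (real (B * t) + 1) \<le> c * (real t + 1)" for t
  proof -
    have le: "2 * exp 1 * real B \<le> 2 * exp 1 * (real B + 1)" "2 * exp 1 \<le> 2 * exp 1 * (real B + 1)"
      by simp_all
    have "2 * exp 1 * real B * real t + 2 * exp 1 \<le> c * (real t + 1)"
      by (rule c_lin[OF order_trans[OF le(1) c_ge(1)] order_trans[OF le(2) c_ge(1)]])
    then show ?thesis by (simp add: distrib_left mult.assoc)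
  qed
  have poly: "4 * (exp 2 * (real (B * t) + 1)\<^sup>2) \<le> 2 ^ t" if "?big t" for t
  proof -
    have "4 * (exp 2 * (real (B * t) + 1)\<^sup>2) = (2 * exp 1 * (real (B * t) + 1))\<^sup>2"
      using exp_of_nat_mult[of 2 "1 :: real"] by (simp add: power_mult_distrib)
    also have "\<dots> \<le> (c * (real t + 1))\<^sup>2" by (intro power_mono exp_B) simp
    finally show ?thesis using square_le[OF that] by linarith
  qed
  have room: "2 * (m * (B * t) + 2) \<le> 2 ^ (8 * t)" if "?big t" for t
  proof -
    have "real (2 * (m * (B * t) + 2)) = 2 * real m * real B * real t + 4" by simp
    also have "\<dots> \<le> c * (real t + 1)"
    proof (rule c_lin)
      show "2 * real m * real B \<le> c" using c_ge(2) by linarith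
    qed (rule c4)
    also have "\<dots> \<le> (c * (real t + 1))\<^sup>2" using c1[of t] by (simp add: self_le_power)
    also have "\<dots> \<le> 2 ^ t" by (rule square_le[OF that])
    also have "\<dots> \<le> 2 ^ (8 * t)" by (intro power_increasing) auto
    finally have "real (2 * (m * (B * t) + 2)) \<le> real (2 ^ (8 * t))" by simp
    then show ?thesis by (simp only: of_nat_le_iff)
  qed
  define N where "N t k l = nat \<lceil>4 ^ t / excursion_weight TYPE('d) ?p k l\<rceil>" for t k l
  define P where "P t = (SIGMA l:{..B * t}. {k. k \<le> l \<and> rate CARD('d) ?p (real k) (real l) \<le> (1 - \<epsilon>) * (8 * real K * real t * ln 2)})" for t
  define F where "F t = (\<Union>q\<in>?I \<times> P t. case q of (i, l, k) \<Rightarrow> failure (N t k l) (2 ^ (8 * t)) (m * l) k l (- e i))" for t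
  have P_sub: "P t \<subseteq> {..B * t} \<times> {..B * t}" for t by (auto simp: P_def)
  have fin: "finite (?I \<times> P t)" for t
    by (rule finite_subset[of _ "?I \<times> ({..B * t} \<times> {..B * t})"]) (use P_sub in auto)
  have estimate: "2 * 2 ^ (8 * t) * N t k l \<le> 2 ^ (8 * K * t)"
    "prob (failure (N t k l) (2 ^ (8 * t)) (m * l) k l (- e i)) \<le> C / 2 ^ t"
    if "?big t" "(i, l, k) \<in> ?I \<times> P t" for t i k l
  proof -
    have x: "- e i \<in> (unit_sphere :: (int ^ 'd) set)" using that e_mem_sphere[of i] by auto
    have kl: "k \<le> l" "l \<le> B * t" "rate CARD('d) ?p (real k) (real l) \<le> (1 - \<epsilon>) * (8 * real K * real t * ln 2)"
      using that by (auto simp: P_def)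
    note est = failure_estimate[OF d3 \<open>0 < \<epsilon>\<close> K(2) B(1) m kl poly[OF that(1)] room[OF that(1)] x]
    show "2 * 2 ^ (8 * t) * N t k l \<le> 2 ^ (8 * K * t)" unfolding N_def by (rule est(1))
    show "prob (failure (N t k l) (2 ^ (8 * t)) (m * l) k l (- e i)) \<le> C / 2 ^ t"
      unfolding N_def C_def by (rule est(2))
  qed
  have F_event: "F t \<in> events" for t
    unfolding F_def by (intro sets.finite_UN fin) (auto split: prod.split)
  have F_le: "prob (F t) \<le> 2 * real CARD('d) * C * (1 / real (Suc t) ^ 2)" if "?big t" for t
  proof -
    have "prob (F t) \<le> (\<Sum>q\<in>?I \<times> P t. prob (case q of (i, l, k) \<Rightarrow> failure (N t k l) (2 ^ (8 * t)) (m * l) k l (- e i)))"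
      unfolding F_def by (intro finite_measure_subadditive_finite fin) (auto split: prod.split)
    also have "\<dots> \<le> (\<Sum>q\<in>?I \<times> P t. C / 2 ^ t)"
    proof (rule sum_mono)
      fix q assume q: "q \<in> ?I \<times> P t"
      obtain i l k where "q = (i, l, k)" by (cases q) auto
      then show "prob (case q of (i, l, k) \<Rightarrow> failure (N t k l) (2 ^ (8 * t)) (m * l) k l (- e i)) \<le> C / 2 ^ t"
        using estimate(2)[OF that, of i l k] q by simp
    qed
    also have "\<dots> = real (card (?I \<times> P t)) * (C / 2 ^ t)" by simp
    also have "\<dots> \<le> real (2 * CARD('d) * (B * t + 1)\<^sup>2) * (C / 2 ^ t)"
    proof (intro mult_right_mono)
      have "card (P t) \<le> card ({..B * t} \<times> {..B * t})" by (rule card_mono[OF _ P_sub]) simp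
      also have "\<dots> = (B * t + 1)\<^sup>2" by (simp add: card_cartesian_product power2_eq_square)
      finally have "2 * CARD('d) * card (P t) \<le> 2 * CARD('d) * (B * t + 1)\<^sup>2" by (rule mult_le_mono2)
      then have "card (?I \<times> P t) \<le> 2 * CARD('d) * (B * t + 1)\<^sup>2"
        by (simp only: card_cartesian_product card_atLeastAtMost diff_Suc_1 Suc_eq_plus1 add_diff_cancel_right')
      then show "real (card (?I \<times> P t)) \<le> real (2 * CARD('d) * (B * t + 1)\<^sup>2)" by (simp only: of_nat_le_iff)
    qed (use C in simp)
    also have "\<dots> = 2 * real CARD('d) * C * ((real (B * t) + 1)\<^sup>2 / 2 ^ t)" by simp
    also have "\<dots> \<le> 2 * real CARD('d) * C * (1 / real (Suc t) ^ 2)"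
    proof (intro mult_left_mono)
      let ?y = "c * (real t + 1)"
      have "1 * (real (B * t) + 1) \<le> 2 * exp 1 * (real (B * t) + 1)"
      proof (rule mult_right_mono)
        show "(1 :: real) \<le> 2 * exp 1" using exp_ge_add_one_self[of "1 :: real"] by simp
      qed simp
      also have "\<dots> \<le> ?y" by (rule exp_B)
      finally have "(real (B * t) + 1)\<^sup>2 \<le> ?y\<^sup>2" by (intro power_mono) auto
      then have "(real (B * t) + 1)\<^sup>2 / 2 ^ t \<le> ?y\<^sup>2 / ?y ^ 4"
        using that c1[of t] by (intro frac_le) (auto intro: zero_less_power)
      also have "\<dots> = 1 / ?y\<^sup>2"
        using c1[of t] by (simp add: power2_eq_square power4_eq_xxxx)
      also have "\<dots> \<le> 1 / real (Suc t) ^ 2"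
      proof (rule divide_left_mono)
        have "c \<ge> 1" using c4 by linarith
        have "real (Suc t) = 1 * (real t + 1)" by simp
        also have "\<dots> \<le> ?y" using \<open>c \<ge> 1\<close> by (intro mult_right_mono) auto
        finally have "real (Suc t) \<le> ?y" .
        then show "real (Suc t) ^ 2 \<le> ?y\<^sup>2" by (rule power_mono) simp
        show "0 < ?y\<^sup>2 * real (Suc t) ^ 2" using c4 by (intro mult_pos_pos zero_less_power) auto
      qed simp
      finally show "(real (B * t) + 1)\<^sup>2 / 2 ^ t \<le> 1 / real (Suc t) ^ 2" .
    qed (use C in simp)
    finally show ?thesis .
  qed
  have big: "\<forall>\<^sub>F t in sequentially. ?big t" by (rule eventually_poly_le_power2)
  have "summable (\<lambda>t. 1 / real (Suc t) ^ 2)"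
    using inverse_power_summable[of 2, where 'a = real]
    by (subst summable_Suc_iff) (simp add: inverse_eq_divide)
  then have "summable (\<lambda>t. 2 * real CARD('d) * C * (1 / real (Suc t) ^ 2))"
    by (rule summable_mult)
  then have "summable (\<lambda>t. prob (F t))"
  proof (rule summable_comparison_test_ev[rotated])
    show "\<forall>\<^sub>F t in sequentially. norm (prob (F t)) \<le> 2 * real CARD('d) * C * (1 / real (Suc t) ^ 2)"
      using big by eventually_elim (use F_le in simp)
  qed
  then have "AE \<omega> in M. \<forall>\<^sub>F t in sequentially. \<omega> \<in> space M - F t"
    using F_event by (intro borel_cantelli_AE1) (auto simp: emeasure_eq_measure)
  with AE_finite_visits[OF d3] AE_steps_sphere
  have "AE \<omega> in M. \<forall>\<^sub>F t in sequentially. \<forall>k l. k \<le> l \<longrightarrow>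
      rate CARD('d) ?p (real k) (real l) \<le> (1 - \<epsilon>) * (8 * real K * real t * ln 2) \<longrightarrow>
      (\<forall>i\<in>?I. \<exists>j\<le>2 ^ (8 * K * t). ?ok \<omega> k l i j)"
  proof eventually_elim
    case (elim \<omega>)
    have S: "set (steps j t \<omega>) \<subseteq> unit_sphere" for j t using elim(2) by blast
    have V: "finite {n. walk X \<omega> n = z}" for z using elim(1) by blast
    from elim(3) big show ?case
    proof eventually_elim
      case (elim t)
      show ?case
      proof (intro allI impI ballI)
        fix k l i
        assume kl: "k \<le> l" "rate CARD('d) ?p (real k) (real l) \<le> (1 - \<epsilon>) * (8 * real K * real t * ln 2)"
          and i: "i \<in> ?I"
        have l: "l \<le> B * t" by (rule l_le[OF kl])
        then have q: "(i, l, k) \<in> ?I \<times> P t" using kl i by (simp add: P_def)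
        then have "\<omega> \<notin> failure (N t k l) (2 ^ (8 * t)) (m * l) k l (- e i)"
          using elim(1) unfolding F_def by fastforce
        moreover have "\<omega> \<in> space M" using elim(1) by blast
        moreover have "m * l + 2 \<le> 2 ^ (8 * t)"
          using l by (intro window_room(1)[OF room[OF elim(2)]] mult_le_mono2)
        ultimately obtain j where j: "j \<le> 2 * 2 ^ (8 * t) * N t k l"
          "local_time (walk X \<omega>) (walk X \<omega> j + e i) = enat k"
          "occupation_time (walk X \<omega>) (walk X \<omega> j + e i) = enat (Suc l)"
          using not_failureE[OF _ _ S V _ i] by metis
        have "j \<le> 2 ^ (8 * K * t)" using j(1) estimate(1)[OF elim(2) q] by (rule order_trans)
        then show "\<exists>j\<le>2 ^ (8 * K * t). ?ok \<omega> k l i j"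
          using j(2,3) by blast
      qed
    qed
  qed
  with K(1) show thesis by (rule that)
qed

text \<open>A general \<open>n\<close> lies between two consecutive dyadic times; halving \<epsilon>
  makes up for the ratio \<open>(t + 1) / t\<close> of their logarithms. What is realised by the
  smaller time is realised by time \<open>n\<close>.\<close>

lemma AE_joint_lower:
  assumes d3: "CARD('d) \<ge> 3" and "0 < \<epsilon>" "\<epsilon> \<le> 1"
  shows "AE \<omega> in M. \<exists>n0. \<forall>n\<ge>n0. \<forall>k l. k \<le> l \<longrightarrow>
    rate CARD('d) (ret_prob TYPE('d)) (real k) (real l) \<le> (1 - \<epsilon>) * ln (real n) \<longrightarrow>
    (\<forall>i\<in>{1..2 * CARD('d)}. \<exists>j\<le>n. local_time (walk X \<omega>) (walk X \<omega> j + e i) = enat k \<and>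
      occupation_time (walk X \<omega>) (walk X \<omega> j + e i) = enat (Suc l))"
proof -
  let ?ok = "\<lambda>\<omega> k l i j. local_time (walk X \<omega>) (walk X \<omega> j + e i) = enat k \<and>
    occupation_time (walk X \<omega>) (walk X \<omega> j + e i) = enat (Suc l)"
  let ?rate = "rate CARD('d) (ret_prob TYPE('d))"
  obtain K :: nat where K: "K \<ge> 1" and AE: "AE \<omega> in M. \<forall>\<^sub>F t in sequentially. \<forall>k l. k \<le> l \<longrightarrow>
      ?rate (real k) (real l) \<le> (1 - \<epsilon> / 2) * (8 * real K * real t * ln 2) \<longrightarrow>
      (\<forall>i\<in>{1..2 * CARD('d)}. \<exists>j\<le>2 ^ (8 * K * t). ?ok \<omega> k l i j)"
    using AE_joint_lower_dyadic[OF d3, of "\<epsilon> / 2"] assms(2,3) by auto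
  let ?b = "2 ^ (8 * K) :: nat"
  from AE show ?thesis
  proof eventually_elim
    case (elim \<omega>)
    then obtain T where T: "\<forall>t\<ge>T. \<forall>k l. k \<le> l \<longrightarrow>
      ?rate (real k) (real l) \<le> (1 - \<epsilon> / 2) * (8 * real K * real t * ln 2) \<longrightarrow>
      (\<forall>i\<in>{1..2 * CARD('d)}. \<exists>j\<le>2 ^ (8 * K * t). ?ok \<omega> k l i j)"
      unfolding eventually_sequentially ..
    \<comment> \<open>\<open>t \<ge> 2 / \<epsilon>\<close> yields
      \<open>(1 - \<epsilon>) * (t + 1) \<le> (1 - \<epsilon> / 2) * t\<close>.\<close>
    define T' where "T' = max T (nat \<lceil>2 / \<epsilon>\<rceil>)"
    show ?case
    proof (rule exI[of _ "?b ^ T'"], intro allI impI ballI)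
      fix n k l i
      assume n: "?b ^ T' \<le> n" and kl: "k \<le> l"
        and rate: "?rate (real k) (real l) \<le> (1 - \<epsilon>) * ln (real n)"
        and i: "i \<in> {1..2 * CARD('d)}"
      have b1: "1 < ?b" by (rule one_less_power) (use K in auto)
      then have b2: "?b \<ge> 2" by (simp only: Suc_1[symmetric] Suc_le_eq One_nat_def[symmetric])
      have "1 \<le> ?b ^ T'" by simp
      then have "n \<ge> 1" using n by (rule order_trans)
      then obtain t where t: "?b ^ t \<le> n" "n < ?b ^ (t + 1)"
        using ex_power_ivl1[OF b2] by blast
      have "?b ^ T' < ?b ^ (t + 1)" using n t(2) by (rule le_less_trans)
      with b1 have "T' < t + 1" by (rule power_less_imp_less_exp)
      then have tT: "t \<ge> T" "real t \<ge> 2 / \<epsilon>" unfolding T'_def by linarith+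
      let ?c = "8 * real K * ln 2"
      have "real n \<le> real (?b ^ (t + 1))" using t(2) by (simp only: of_nat_le_iff less_imp_le)
      also have "\<dots> = 2 ^ (8 * K * (t + 1))" by (simp only: power_mult of_nat_power of_nat_numeral)
      finally have le: "real n \<le> 2 ^ (8 * K * (t + 1))" .
      have "real n > 0" using \<open>n \<ge> 1\<close> by simp
      then have "ln (real n) \<le> ln (2 ^ (8 * K * (t + 1)))"
        using le by (intro ln_mono)
      also have "\<dots> = real (8 * K * (t + 1)) * ln 2" by (rule ln_realpow)
      also have "\<dots> = (real t + 1) * ?c" by (simp add: algebra_simps)
      finally have "(1 - \<epsilon>) * ln (real n) \<le> (1 - \<epsilon>) * ((real t + 1) * ?c)"
        using \<open>\<epsilon> \<le> 1\<close> by (intro mult_left_mono) auto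
      also have "\<dots> = ((1 - \<epsilon>) * (real t + 1)) * ?c" by (simp only: mult.assoc)
      also have "\<dots> \<le> ((1 - \<epsilon> / 2) * real t) * ?c"
      proof (rule mult_right_mono)
        have "2 \<le> \<epsilon> * real t" using tT(2) \<open>0 < \<epsilon>\<close> by (simp add: field_simps)
        then show "(1 - \<epsilon>) * (real t + 1) \<le> (1 - \<epsilon> / 2) * real t"
          using \<open>0 < \<epsilon>\<close> by (simp add: algebra_simps)
      qed simp
      also have "\<dots> = (1 - \<epsilon> / 2) * (8 * real K * real t * ln 2)" by simp
      finally have "?rate (real k) (real l) \<le> (1 - \<epsilon> / 2) * (8 * real K * real t * ln 2)"
        using rate by (rule order_trans[rotated])
      then obtain j where j: "j \<le> 2 ^ (8 * K * t)" "local_time (walk X \<omega>) (walk X \<omega> j + e i) = enat k"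
          "occupation_time (walk X \<omega>) (walk X \<omega> j + e i) = enat (Suc l)"
        using T tT(1) kl i by blast
      have "j \<le> n" using j(1) t(1) by (simp only: power_mult)
      then show "\<exists>j\<le>n. ?ok \<omega> k l i j"
        using j(2,3) by blast
    qed
  qed
qed

end

section \<open>Both bounds in terms of the dilated region\<close>

theorem theorem1p4:
  fixes M :: "'a measure" and X :: "nat \<Rightarrow> 'a \<Rightarrow> int ^ 'd::finite" and \<epsilon> :: real
  assumes "CARD('d) \<ge> 3"
    and "simple_random_walk M X"
    and "\<epsilon> > 0"
  shows "AE \<omega> in M. \<exists>n0. \<forall>n\<ge>n0.
    (\<forall>j\<in>{1..n}. \<forall>i\<in>{1..2 * CARD('d)}. \<exists>a b.
        local_time (walk X \<omega>) (walk X \<omega> j + e i) = enat a \<and>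
        occupation_time (walk X \<omega>) (walk X \<omega> j + e i) = enat b \<and>
        (real a, real b) \<in> dilate ((1 + \<epsilon>) * ln (real n))
          (joint_region CARD('d) (sphere_return_prob M X))) \<and>
    (\<forall>k l :: nat. (real k, real l) \<in> dilate ((1 - \<epsilon>) * ln (real n))
          (joint_region CARD('d) (sphere_return_prob M X)) \<longrightarrow>
        (\<forall>i\<in>{1..2 * CARD('d)}. \<exists>j\<le>n.
          (local_time (walk X \<omega>) (walk X \<omega> j + e i),
           occupation_time (walk X \<omega>) (walk X \<omega> j + e i)) = (enat k, enat (l + 1))))"
proof -
  interpret simple_random_walk M X by (rule assms(2))
  let ?p = "ret_prob TYPE('d)" and ?I = "{1..2 * CARD('d)}"
  have p: "?p > 0" by (rule ret_prob_pos)
  \<comment> \<open>For \<epsilon> \<ge> 1 only the pair \<open>(0, 0)\<close> can lie in the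
    region; it has rate 0 and is covered by the lower bound with \<delta> = 1.\<close>
  define \<delta> where "\<delta> = min \<epsilon> 1"
  have \<delta>: "0 < \<delta>" "\<delta> \<le> 1" using assms(3) by (auto simp: \<delta>_def)
  from AE_joint_upper[OF assms(1,3)] AE_joint_lower[OF assms(1) \<delta>] show ?thesis
    unfolding sphere_return_prob_eq
  proof eventually_elim
    case (elim \<omega>)
    let ?s = "walk X \<omega>"
    obtain n1 where n1: "\<forall>n\<ge>n1. \<forall>j\<in>{1..n}. \<forall>i\<in>?I. \<exists>a b. local_time ?s (?s j + e i) = enat a \<and>
        occupation_time ?s (?s j + e i) = enat b \<and> a \<le> b \<and> rate CARD('d) ?p (real a) (real b) \<le> (1 + \<epsilon>) * ln (real n)"
      using elim(1) ..
    obtain n2 where n2: "\<forall>n\<ge>n2. \<forall>k l. k \<le> l \<longrightarrow> rate CARD('d) ?p (real k) (real l) \<le> (1 - \<delta>) * ln (real n) \<longrightarrow>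
        (\<forall>i\<in>?I. \<exists>j\<le>n. local_time ?s (?s j + e i) = enat k \<and> occupation_time ?s (?s j + e i) = enat (Suc l))"
      using elim(2) ..
    show ?case
    \<comment> \<open>\<open>n \<ge> 2\<close> makes \<open>ln n\<close> positive, as
      \<open>mem_dilate_iff\<close> requires of the factor.\<close>
    proof (rule exI[of _ "max 2 (max n1 n2)"], intro allI impI conjI ballI)
      fix n j i assume n: "max 2 (max n1 n2) \<le> n" and ji: "j \<in> {1..n}" "i \<in> ?I"
      then obtain a b where ab: "local_time ?s (?s j + e i) = enat a" "occupation_time ?s (?s j + e i) = enat b"
        "a \<le> b" "rate CARD('d) ?p (real a) (real b) \<le> (1 + \<epsilon>) * ln (real n)"
        using n1 by (meson max.bounded_iff)
      have "(1 + \<epsilon>) * ln (real n) > 0" using n assms(3) by (intro mult_pos_pos) auto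
      then have "(real a, real b) \<in> dilate ((1 + \<epsilon>) * ln (real n)) (joint_region CARD('d) ?p)"
        using ab(3,4) p by (simp add: mem_dilate_iff)
      then show "\<exists>a b. local_time ?s (?s j + e i) = enat a \<and> occupation_time ?s (?s j + e i) = enat b \<and>
          (real a, real b) \<in> dilate ((1 + \<epsilon>) * ln (real n)) (joint_region CARD('d) ?p)"
        using ab(1,2) by blast
    next
      fix n k l i assume n: "max 2 (max n1 n2) \<le> n" and i: "i \<in> ?I"
        and kl: "(real k, real l) \<in> dilate ((1 - \<epsilon>) * ln (real n)) (joint_region CARD('d) ?p)"
      have ln: "ln (real n) > 0" using n by simp
      have "k \<le> l \<and> rate CARD('d) ?p (real k) (real l) \<le> (1 - \<delta>) * ln (real n)"
      proof (cases "\<epsilon> < 1")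
        case True
        then have "(1 - \<epsilon>) * ln (real n) > 0" using ln by simp
        then show ?thesis using kl p True by (simp add: mem_dilate_iff \<delta>_def)
      next
        case False
        then have "(1 - \<epsilon>) * ln (real n) \<le> 0" using ln by (simp add: mult_nonpos_nonneg)
        then have "k = 0 \<and> l = 0" using kl by (rule mem_dilate_nonpos)
        then show ?thesis using \<delta> ln by (simp add: rate_def)
      qed
      then obtain j where "j \<le> n" "local_time ?s (?s j + e i) = enat k" "occupation_time ?s (?s j + e i) = enat (Suc l)"
        using n2 n i by (meson max.bounded_iff)
      then show "\<exists>j\<le>n. (local_time ?s (?s j + e i), occupation_time ?s (?s j + e i)) = (enat k, enat (l + 1))"
        by auto
    qed
  qed
qed

end
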